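(* Suppose that the data $f,U,\psi^1,\dots,\psi^I$ satisfy the assumptions A1--A4 written out in the context, and let $\{\sigma_k\}$, $\{\gamma_k\}$, $\{\mu_k\}$ and the sets $C^k(t)$ be as in the context. Let $\{(x_k,u_k)\}$, with $u_k$ measurable and $u_k(t)\in U$ a.e. $t\in[0,T]$, be a sequence of solutions of the Cauchy problems $$\dot x_k(t)=f(t,x_k(t),u_k(t))-\sum_{i=1}^I\gamma_ke^{\gamma_k(\psi^i(t,x_k(t))-\sigma_k)}\nabla_x\psi^i(t,x_k(t)),\qquad x_k(0)=b_k\in C^k(0),\qquad(\ast_k)$$ on $[0,T]$. If $b_k\to x_0$, then there exist a subsequence of $\{x_k\}$ and a measurable function $u$ with $u(t)\in U$ a.e. $t\in[0,T]$ such that the subsequence converges uniformly on $[0,T]$ to $x$, the unique solution to the Cauchy problem $$\dot x(t)\in f(t,x(t),u(t))-N_{C(t)}(x(t)),\qquad x(0)=x_0.\qquad(\ast\ast)$$ If, moreover, all the controls $u_k$ are equal, $u_k=u$ for all $k$, then the subsequence converges to the unique solution of $(\ast\ast)$ with this $u$; that is, any solution of $$\dot x(t)\in f(t,x(t),U)-N_{C(t)}(x(t)),\qquad x(0)=x_0\in C(0)$$ can be approximated (uniformly on $[0,T]$) by solutions of $(\ast_k)$.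
   Context: Setting. Fix $T>0$, an integer $I>1$, functions $f:[0,T]\times\mathbb R^n\times\mathbb R^m\to\mathbb R^n$, $\psi^i:[0,T]\times\mathbb R^n\to\mathbb R$ ($i=1,\dots,I$), a set $U\subset\mathbb R^m$, and put $C(t)=\{x\in\mathbb R^n:\psi^i(t,x)\le0,\ i=1,\dots,I\}$. Solutions are absolutely continuous functions on $[0,T]$ satisfying the equation or inclusion for a.e. $t$. Notation. $N_S(s)$ is the Mordukhovich (limiting) normal cone to $S$ at $s\in S$; $|\cdot|$ is the Euclidean norm or induced matrix norm; $B_n$ is the closed unit ball of $\mathbb R^n$ centered at $0$; $\nabla_x$ is the derivative with respect to $x$, $\partial_t$ the derivative with respect to $t$. Assumptions. A1: The functions $\psi^i$, $i=1,\dots,I$, are $C^2$. The graph of $C(\cdot)$ is compact and contained in the interior of a ball $rB_{n+1}$, for some $r>0$. There exist constants $\beta>0$, $\eta>0$, $\rho\in\,]0,1[$ such that for all $(t,x)\in[0,T]\times\mathbb R^n$ and all $i$: (1) $\psi^i(t,x)\in[-\beta,\beta]\Rightarrow|\nabla_x\psi^i(t,x)|>\eta$; and, with $I(t,x)=\{i\in\{1,\dots,I\}:\psi^i(t,x)\in\,]-2\beta,\beta]\}$, (2) $\langle\nabla_x\psi^i(t,x),\nabla_x\psi^j(t,x)\rangle\ge0$ for $i,j\in I(t,x)$; (3) if $i\in I(t,x)$ then $\sum_{j\in I(t,x)\setminus\{i\}}|\langle\nabla_x\psi^i(t,x),\nabla_x\psi^j(t,x)\rangle|\le\rho|\nabla_x\psi^i(t,x)|^2$;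 (4) $\psi^i(t,x)\le-2\beta\Rightarrow\nabla_x\psi^i(t,x)=0$. A2: $f$ is continuous; $x\mapsto f(t,x,u)$ is continuously differentiable for all $(t,u)\in[0,T]\times\mathbb R^m$; there is a constant $M>0$ such that $|f(t,x,u)|\le M$ and $|\nabla_xf(t,x,u)|\le M$ for all $(t,x)\in rB_{n+1}$ (with $t\in[0,T]$) and $u\in U$. A3: For each $(t,x)$ the set $f(t,x,U)$ is convex. A4: $U$ is compact. Sequences. Let $\mu$ be a constant such that $$\max\{|\nabla_x\psi^i(t,x)||f(t,x,u)|+|\partial_t\psi^i(t,x)|+1:\ t\in[0,T],\ u\in U,\ x\in C(t)+B_n,\ i=1,\dots,I\}\le\mu,$$ and define $\mu(\gamma)=\frac1\gamma\log\left(\frac{\mu}{\eta^2\gamma}\right)$ for $\gamma>0$. Let $\sigma_k\downarrow0$ and let $\gamma_k\uparrow+\infty$ be chosen so that, with $\mu_k=\mu(\gamma_k)$ and $C^k(t)=\{x:\psi^i(t,x)-\sigma_k\le\mu_k,\ i=1,\dots,I\}$, one has $C(t)\subset\operatorname{int}C^k(t)$ for all $t\in[0,T]$. *)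

theory Defs
  imports "HOL-Analysis.Analysis"
begin

section \<open>Calculus\<close>

definition grad :: "('a::real_inner \<Rightarrow> real) \<Rightarrow> 'a \<Rightarrow> 'a" where
  "grad g x = (THE D. GDERIV g x :> D)"

text \<open>Derivatives are taken within \<open>S\<close>, so that on \<open>{0..T} \<times> UNIV\<close> they are one-sided in time
  at the two end points.\<close>

definition C1_on :: "('a::real_normed_vector \<Rightarrow> 'b::real_normed_vector) \<Rightarrow> 'a set \<Rightarrow> bool" where
  "C1_on g S \<longleftrightarrow> (\<exists>D :: 'a \<Rightarrow> 'a \<Rightarrow>\<^sub>L 'b.
     (\<forall>z\<in>S. (g has_derivative blinfun_apply (D z)) (at z within S)) \<and> continuous_on S D)"

definition C2_on :: "('a::real_normed_vector \<Rightarrow> 'b::real_normed_vector) \<Rightarrow> 'a set \<Rightarrow> bool" where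
  "C2_on g S \<longleftrightarrow> (\<exists>D :: 'a \<Rightarrow> 'a \<Rightarrow>\<^sub>L 'b.
     (\<forall>z\<in>S. (g has_derivative blinfun_apply (D z)) (at z within S)) \<and> C1_on D S)"

text \<open>Absolute continuity of a curve on \<open>[a, b]\<close>: a division of a subset of \<open>[a, b]\<close> is a finite
  family of compact intervals \<open>K = [Inf K, Sup K]\<close> with pairwise disjoint interiors.\<close>

definition abs_cont_on :: "real \<Rightarrow> real \<Rightarrow> (real \<Rightarrow> 'a::real_normed_vector) \<Rightarrow> bool" where
  "abs_cont_on a b g \<longleftrightarrow>
     (\<forall>\<epsilon>>0. \<exists>\<delta>>0. \<forall>\<D> S. \<D> division_of S \<and> S \<subseteq> {a..b} \<and> (\<Sum>K\<in>\<D>. Sup K - Inf K) < \<delta> \<longrightarrow>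
        (\<Sum>K\<in>\<D>. norm (g (Sup K) - g (Inf K))) < \<epsilon>)"

section \<open>Mordukhovich normal cone\<close>

text \<open>Frechet (regular) normals: \<open>limsup \<langle>v, y - s\<rangle> / \<bar>y - s\<bar> \<le> 0\<close> as \<open>y \<rightarrow> s\<close> within \<open>S\<close>. Limiting
  normals are limits of Frechet normals at nearby points of \<open>S\<close>. Both cones are empty at points
  outside \<open>S\<close>.\<close>

definition frechet_normal_cone :: "'a::euclidean_space set \<Rightarrow> 'a \<Rightarrow> 'a set" where
  "frechet_normal_cone S s = {v. s \<in> S \<and>
     (\<forall>\<epsilon>>0. \<exists>\<delta>>0. \<forall>y\<in>S. norm (y - s) < \<delta> \<longrightarrow> v \<bullet> (y - s) \<le> \<epsilon> * norm (y - s))}"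

definition limiting_normal_cone :: "'a::euclidean_space set \<Rightarrow> 'a \<Rightarrow> 'a set" where
  "limiting_normal_cone S s = {v. s \<in> S \<and>
     (\<exists>p w. (\<forall>j::nat. p j \<in> S \<and> w j \<in> frechet_normal_cone S (p j)) \<and>
            p \<longlonglongrightarrow> s \<and> w \<longlonglongrightarrow> v)}"

section \<open>Moving sets and standing assumptions\<close>

definition moving_set ::
  "nat \<Rightarrow> (nat \<Rightarrow> real \<Rightarrow> 'a \<Rightarrow> real) \<Rightarrow> real \<Rightarrow> 'a set" where
  "moving_set I \<psi> t = {x. \<forall>i\<in>{1..I}. \<psi> i t x \<le> 0}"

definition relaxed_moving_set ::
  "nat \<Rightarrow> (nat \<Rightarrow> real \<Rightarrow> 'a \<Rightarrow> real) \<Rightarrow> real \<Rightarrow> real \<Rightarrow> real \<Rightarrow> 'a set" where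
  "relaxed_moving_set I \<psi> \<sigma> m t = {x. \<forall>i\<in>{1..I}. \<psi> i t x - \<sigma> \<le> m}"

definition near_active ::
  "nat \<Rightarrow> (nat \<Rightarrow> real \<Rightarrow> 'a \<Rightarrow> real) \<Rightarrow> real \<Rightarrow> real \<Rightarrow> 'a \<Rightarrow> nat set" where
  "near_active I \<psi> \<beta> t x = {i\<in>{1..I}. - 2 * \<beta> < \<psi> i t x \<and> \<psi> i t x \<le> \<beta>}"

definition assumption_A1 ::
  "real \<Rightarrow> nat \<Rightarrow> (nat \<Rightarrow> real \<Rightarrow> 'a::euclidean_space \<Rightarrow> real) \<Rightarrow> real \<Rightarrow> real \<Rightarrow> real \<Rightarrow> real \<Rightarrow> bool"
  where
  "assumption_A1 T I \<psi> r \<beta> \<eta> \<rho> \<longleftrightarrow>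
     (\<forall>i\<in>{1..I}. C2_on (\<lambda>(t, x). \<psi> i t x) ({0..T} \<times> UNIV)) \<and>
     r > 0 \<and>
     compact (Sigma {0..T} (moving_set I \<psi>)) \<and>
     Sigma {0..T} (moving_set I \<psi>) \<subseteq> interior (cball 0 r) \<and>
     \<beta> > 0 \<and> \<eta> > 0 \<and> 0 < \<rho> \<and> \<rho> < 1 \<and>
     (\<forall>t\<in>{0..T}. \<forall>x. \<forall>i\<in>{1..I}.
        (\<psi> i t x \<in> {-\<beta>..\<beta>} \<longrightarrow> norm (grad (\<psi> i t) x) > \<eta>) \<and>
        (\<psi> i t x \<le> - 2 * \<beta> \<longrightarrow> grad (\<psi> i t) x = 0)) \<and>
     (\<forall>t\<in>{0..T}. \<forall>x. \<forall>i\<in>near_active I \<psi> \<beta> t x.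
        (\<forall>j\<in>near_active I \<psi> \<beta> t x. grad (\<psi> i t) x \<bullet> grad (\<psi> j t) x \<ge> 0) \<and>
        (\<Sum>j\<in>near_active I \<psi> \<beta> t x - {i}. \<bar>grad (\<psi> i t) x \<bullet> grad (\<psi> j t) x\<bar>)
          \<le> \<rho> * (norm (grad (\<psi> i t) x))\<^sup>2)"

definition assumption_A2 ::
  "real \<Rightarrow> (real \<Rightarrow> 'a::euclidean_space \<Rightarrow> 'b::euclidean_space \<Rightarrow> 'a) \<Rightarrow> 'b set \<Rightarrow> real \<Rightarrow> real \<Rightarrow> bool"
  where
  "assumption_A2 T f U r M \<longleftrightarrow>
     continuous_on ({0..T} \<times> UNIV \<times> UNIV) (\<lambda>(t, x, u). f t x u) \<and>
     (\<forall>t\<in>{0..T}. \<forall>u. C1_on (\<lambda>x. f t x u) UNIV) \<and>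
     M > 0 \<and>
     (\<forall>t\<in>{0..T}. \<forall>x. \<forall>u\<in>U. (t, x) \<in> cball 0 r \<longrightarrow>
        norm (f t x u) \<le> M \<and> onorm (frechet_derivative (\<lambda>x. f t x u) (at x)) \<le> M)"

definition assumption_A3 :: "real \<Rightarrow> (real \<Rightarrow> 'a::real_vector \<Rightarrow> 'b \<Rightarrow> 'a) \<Rightarrow> 'b set \<Rightarrow> bool" where
  "assumption_A3 T f U \<longleftrightarrow> (\<forall>t\<in>{0..T}. \<forall>x. convex (f t x ` U))"

definition assumption_A4 :: "'b::topological_space set \<Rightarrow> bool" where
  "assumption_A4 U \<longleftrightarrow> compact U"

section \<open>The approximating parameters\<close>

definition mu_bound ::
  "real \<Rightarrow> nat \<Rightarrow> (nat \<Rightarrow> real \<Rightarrow> 'a::euclidean_space \<Rightarrow> real) \<Rightarrow> (real \<Rightarrow> 'a \<Rightarrow> 'b \<Rightarrow> 'a) \<Rightarrow> 'b set \<Rightarrow> real \<Rightarrow> bool"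
  where
  "mu_bound T I \<psi> f U \<mu> \<longleftrightarrow>
     (\<forall>t\<in>{0..T}. \<forall>u\<in>U. \<forall>x\<in>{c + e |c e. c \<in> moving_set I \<psi> t \<and> e \<in> cball 0 1}. \<forall>i\<in>{1..I}.
        norm (grad (\<psi> i t) x) * norm (f t x u)
          + \<bar>vector_derivative (\<lambda>s. \<psi> i s x) (at t within {0..T})\<bar> + 1 \<le> \<mu>)"

definition mu_fun :: "real \<Rightarrow> real \<Rightarrow> real \<Rightarrow> real" where
  "mu_fun \<mu> \<eta> \<gamma> = (1 / \<gamma>) * ln (\<mu> / (\<eta>\<^sup>2 * \<gamma>))"

section \<open>Controls and solutions\<close>

definition admissible_control :: "real \<Rightarrow> 'b::euclidean_space set \<Rightarrow> (real \<Rightarrow> 'b) \<Rightarrow> bool" where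
  "admissible_control T U u \<longleftrightarrow>
     u \<in> borel_measurable (lebesgue_on {0..T}) \<and> (AE t in lebesgue_on {0..T}. u t \<in> U)"

definition solves_inclusion ::
  "real \<Rightarrow> (real \<Rightarrow> 'a::euclidean_space \<Rightarrow> 'a set) \<Rightarrow> 'a \<Rightarrow> (real \<Rightarrow> 'a) \<Rightarrow> bool" where
  "solves_inclusion T F a x \<longleftrightarrow>
     abs_cont_on 0 T x \<and> x 0 = a \<and>
     (AE t in lebesgue_on {0..T}.
        \<exists>d\<in>F t (x t). (x has_vector_derivative d) (at t within {0..T}))"

text \<open>Curves are total functions on the reals of which only the restriction to \<open>[0, T]\<close> matters;
  uniqueness is therefore uniqueness on \<open>[0, T]\<close>.\<close>

definition unique_solution_of_inclusion ::
  "real \<Rightarrow> (real \<Rightarrow> 'a::euclidean_space \<Rightarrow> 'a set) \<Rightarrow> 'a \<Rightarrow> (real \<Rightarrow> 'a) \<Rightarrow> bool" where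
  "unique_solution_of_inclusion T F a x \<longleftrightarrow>
     solves_inclusion T F a x \<and> (\<forall>y. solves_inclusion T F a y \<longrightarrow> (\<forall>t\<in>{0..T}. y t = x t))"

definition penalized_rhs ::
  "nat \<Rightarrow> (nat \<Rightarrow> real \<Rightarrow> 'a::euclidean_space \<Rightarrow> real) \<Rightarrow> (real \<Rightarrow> 'a \<Rightarrow> 'b \<Rightarrow> 'a) \<Rightarrow>
   real \<Rightarrow> real \<Rightarrow> (real \<Rightarrow> 'b) \<Rightarrow> real \<Rightarrow> 'a \<Rightarrow> 'a" where
  "penalized_rhs I \<psi> f \<sigma> \<gamma> u t x =
     f t x (u t) - (\<Sum>i=1..I. (\<gamma> * exp (\<gamma> * (\<psi> i t x - \<sigma>))) *\<^sub>R grad (\<psi> i t) x)"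

definition penalized_solution ::
  "real \<Rightarrow> nat \<Rightarrow> (nat \<Rightarrow> real \<Rightarrow> 'a::euclidean_space \<Rightarrow> real) \<Rightarrow> (real \<Rightarrow> 'a \<Rightarrow> 'b \<Rightarrow> 'a) \<Rightarrow>
   real \<Rightarrow> real \<Rightarrow> real \<Rightarrow> (real \<Rightarrow> 'b) \<Rightarrow> 'a \<Rightarrow> (real \<Rightarrow> 'a) \<Rightarrow> bool" where
  "penalized_solution T I \<psi> f \<sigma> \<gamma> m u b x \<longleftrightarrow>
     b \<in> relaxed_moving_set I \<psi> \<sigma> m 0 \<and>
     solves_inclusion T (\<lambda>t y. {penalized_rhs I \<psi> f \<sigma> \<gamma> u t y}) b x"

definition sweeping_rhs ::
  "nat \<Rightarrow> (nat \<Rightarrow> real \<Rightarrow> 'a::euclidean_space \<Rightarrow> real) \<Rightarrow> (real \<Rightarrow> 'a \<Rightarrow> 'b \<Rightarrow> 'a) \<Rightarrow>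
   (real \<Rightarrow> 'b) \<Rightarrow> real \<Rightarrow> 'a \<Rightarrow> 'a set" where
  "sweeping_rhs I \<psi> f u t x =
     {f t x (u t) - v |v. v \<in> limiting_normal_cone (moving_set I \<psi> t) x}"

definition sweeping_inclusion_rhs ::
  "nat \<Rightarrow> (nat \<Rightarrow> real \<Rightarrow> 'a::euclidean_space \<Rightarrow> real) \<Rightarrow> (real \<Rightarrow> 'a \<Rightarrow> 'b \<Rightarrow> 'a) \<Rightarrow>
   'b set \<Rightarrow> real \<Rightarrow> 'a \<Rightarrow> 'a set" where
  "sweeping_inclusion_rhs I \<psi> f U t x =
     {f t x w - v |w v. w \<in> U \<and> v \<in> limiting_normal_cone (moving_set I \<psi> t) x}"

end

theory Submission
  imports Defs "HOL-Complex_Analysis.Great_Picard"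
begin

text \<open>A penalized solution cannot leave the relaxed set: where \<open>\<psi> i - \<sigma>\<close> exceeds \<open>mu_fun \<mu> \<eta> \<gamma>\<close>, the
  sign condition on the gradients makes the penalty contribute at most \<open>- \<mu>\<close> to the derivative of
  \<open>\<psi> i\<close> along the curve, so \<open>\<psi> i\<close> decreases. Hence the multipliers \<open>\<gamma> exp (\<gamma> (\<psi> i - \<sigma>))\<close> are
  bounded by \<open>\<mu> / \<eta>\<^sup>2\<close>, the penalized solutions are equi-Lipschitz, and a subsequence converges
  uniformly to some \<open>x\<close>. Where \<open>x\<close> is differentiable, the velocities of the approximations near
  \<open>t\<close> are close to the compact convex set \<open>f t (x t) U - P\<close>, where \<open>P\<close> consists of the
  combinations of the active gradients with coefficients in \<open>[0, \<mu> / \<eta>\<^sup>2]\<close>; a separating hyperplane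
  shows that \<open>x' t\<close> belongs to it, without any weak compactness. A measurable selection recovers
  the control. For a fixed control the same argument applies to \<open>x\<^sub>k\<close> minus the primitive of
  \<open>f s (x s) (u s)\<close>. Uniqueness follows from Gronwall's inequality, because limiting normals satisfy
  \<open>v \<bullet> (y - x) \<le> c (norm v) (norm (y - x))\<^sup>2\<close> for all feasible \<open>y\<close> and the normal components of
  the velocities of solutions are bounded.\<close>

section \<open>Absolutely continuous curves\<close>

text \<open>The estimates are shaped by hypotheses that hold only locally: the bounds on
  \<open>f\<close> on the ball, the bound by \<open>\<mu>\<close> within distance 1 of
  \<open>C t\<close>. Invariance is therefore a bootstrap from a fixed level \<open>\<delta>\<close>
  below which both are in force. The formula for \<open>mu_fun\<close> solves
  \<open>\<gamma> * exp (\<gamma> * m) = \<mu> / \<eta>\<^sup>2\<close> for \<open>m\<close>: at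
  that level the multiplier times a squared gradient norm, which is at least
  \<open>\<eta>\<^sup>2\<close>, outweighs the drift. The level may have either sign, but it tends
  to 0, where the gradients are bounded below. The controls need not converge in any sense, so the
  limit is taken for velocities and a control is reconstructed afterwards. A fixed control makes the
  drift merely measurable in time, without a limit near \<open>t\<close>; subtracting its primitive
  leaves an error governed by the Lipschitz constant \<open>M\<close>. A solution of the sweeping
  inclusion is a priori just absolutely continuous. A bound on its normals has to be derived from
  feasibility at earlier times before Gronwall's inequality applies with a constant rate.\<close>

lemma AE_lebesgue_on_iff_negligible:
  fixes S :: "'a::euclidean_space set"
  assumes "S \<in> sets lebesgue"
  shows "(AE t in lebesgue_on S. P t) \<longleftrightarrow> (\<exists>N. negligible N \<and> (\<forall>t\<in>S - N. P t))"
proof -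
  have "(AE t in lebesgue_on S. P t) \<longleftrightarrow> (AE t in lebesgue. t \<in> S \<longrightarrow> P t)"
    using assms by (subst AE_restrict_space_iff) auto
  also have "\<dots> \<longleftrightarrow> (\<exists>N. negligible N \<and> (\<forall>t\<in>S - N. P t))"
    unfolding eventually_ae_filter negligible_iff_null_sets by auto
  finally show ?thesis .
qed

lemma abs_cont_on_subset:
  assumes "abs_cont_on a b g" "a \<le> c" "d \<le> b"
  shows "abs_cont_on c d g"
proof -
  have "{c..d} \<subseteq> {a..b}" using assms by auto
  then show ?thesis using assms(1) unfolding abs_cont_on_def by (meson order_trans)
qed

text \<open>The increments of \<open>g\<close> over a division are bounded by those of time and of
  \<open>x\<close>, so one division controls both. This carries absolute continuity over to
  functions of \<open>(t, x t)\<close>, such as a constraint along a curve or a weighted squared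
  norm.\<close>

lemma abs_cont_on_dominated:
  fixes x :: "real \<Rightarrow> 'a::real_normed_vector" and g :: "real \<Rightarrow> 'c::real_normed_vector"
  assumes ac: "abs_cont_on a b x" and K: "K \<ge> 0"
    and dom: "\<And>s t. s \<in> {a..b} \<Longrightarrow> t \<in> {a..b} \<Longrightarrow> norm (g t - g s) \<le> K * (\<bar>t - s\<bar> + norm (x t - x s))"
  shows "abs_cont_on a b g"
  unfolding abs_cont_on_def
proof (intro allI impI)
  fix e :: real assume e: "e > 0"
  define e' where "e' = e / (2 * (K + 1))"
  have e': "e' > 0" using e K by (simp add: e'_def)
  obtain d where d: "d > 0" "\<And>D S. D division_of S \<and> S \<subseteq> {a..b} \<and> (\<Sum>K\<in>D. Sup K - Inf K) < d \<Longrightarrow>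
      (\<Sum>K\<in>D. norm (x (Sup K) - x (Inf K))) < e'"
    using ac e' unfolding abs_cont_on_def by meson
  show "\<exists>d>0. \<forall>D S. D division_of S \<and> S \<subseteq> {a..b} \<and> (\<Sum>K\<in>D. Sup K - Inf K) < d \<longrightarrow>
      (\<Sum>K\<in>D. norm (g (Sup K) - g (Inf K))) < e"
  \<comment> \<open>Taking \<open>min d e'\<close> keeps the total length below \<open>e'\<close> as
    well, since the increments of time enter the bound beside those of \<open>x\<close>.\<close>
  proof (intro exI[of _ "min d e'"] conjI allI impI)
    show "min d e' > 0" using d e' by simp
    fix D S assume DS: "D division_of S \<and> S \<subseteq> {a..b} \<and> (\<Sum>K\<in>D. Sup K - Inf K) < min d e'"
    have le: "Inf J \<le> Sup J \<and> Inf J \<in> {a..b} \<and> Sup J \<in> {a..b}" if J: "J \<in> D" for J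
    proof -
      have 1: "J \<noteq> {}" "J \<subseteq> S" using DS J by blast+
      obtain c d where "J = cbox c d" using DS J by (meson division_ofD(4))
      then have 2: "J = {c..d}" "c \<le> d" using 1 by auto
      have "{c..d} \<subseteq> {a..b}" using 1 2 DS by blast
      then have "a \<le> c" "d \<le> b" using 2 by auto
      then show ?thesis using 2 by simp
    qed
    have "(\<Sum>J\<in>D. norm (g (Sup J) - g (Inf J))) \<le> (\<Sum>J\<in>D. K * ((Sup J - Inf J) + norm (x (Sup J) - x (Inf J))))"
    proof (rule sum_mono)
      fix J assume "J \<in> D"
      then show "norm (g (Sup J) - g (Inf J)) \<le> K * ((Sup J - Inf J) + norm (x (Sup J) - x (Inf J)))"
        using dom[of "Inf J" "Sup J"] le by force
    qed
    also have "\<dots> = K * ((\<Sum>J\<in>D. Sup J - Inf J) + (\<Sum>J\<in>D. norm (x (Sup J) - x (Inf J))))"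
      by (simp add: sum_distrib_left[symmetric] sum.distrib)
    also have "\<dots> \<le> K * (e' + e')"
      using DS d(2)[of D S] K by (intro mult_left_mono add_mono) auto
    also have "\<dots> < (K + 1) * (e' + e')" using e' by (intro mult_strict_right_mono) auto
    also have "\<dots> = 2 * (K + 1) * e'" by simp
    also have "\<dots> = e"
    proof -
      have "2 * (K + 1) \<noteq> 0" using K by simp
      then show ?thesis unfolding e'_def times_divide_eq_right by (rule nonzero_mult_div_cancel_left)
    qed
    finally show "(\<Sum>J\<in>D. norm (g (Sup J) - g (Inf J))) < e" .
  qed
qed

lemma abs_cont_on_inner_left:
  fixes g :: "real \<Rightarrow> 'a::real_inner"
  assumes "abs_cont_on a b g"
  shows "abs_cont_on a b (\<lambda>t. g t \<bullet> v)"
proof (rule abs_cont_on_dominated[OF assms norm_ge_zero[of v]])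
  fix s t
  have "norm (g t \<bullet> v - g s \<bullet> v) \<le> norm v * norm (g t - g s)"
    using Cauchy_Schwarz_ineq2[of "g t - g s" v] by (simp add: inner_diff_left mult.commute)
  also have "\<dots> \<le> norm v * (\<bar>t - s\<bar> + norm (g t - g s))" by (intro mult_left_mono) auto
  finally show "norm (g t \<bullet> v - g s \<bullet> v) \<le> norm v * (\<bar>t - s\<bar> + norm (g t - g s))" .
qed

lemma lipschitz_imp_abs_cont_on:
  assumes "L-lipschitz_on {a..b} g"
  shows "abs_cont_on a b g"
proof (rule abs_cont_on_dominated)
  \<comment> \<open>The comparison curve is constant, so that only the time increments
    remain.\<close>
  show "abs_cont_on a b (\<lambda>_. 0 :: real)" by (auto simp: abs_cont_on_def intro: exI[of _ 1])
  show "L \<ge> 0" using assms by (rule lipschitz_on_nonneg)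
  show "norm (g t - g s) \<le> L * (\<bar>t - s\<bar> + norm (0 - 0 :: real))" if "s \<in> {a..b}" "t \<in> {a..b}" for s t
    using lipschitz_onD[OF assms that(2,1)] by (simp add: dist_norm)
qed

text \<open>A gauge argument in place of the fundamental theorem, so that no derivative has to be
  integrated. Over an interval with tag outside \<open>N\<close> the function grows by at most
  \<open>c + e\<close> per unit length. The intervals tagged in \<open>N\<close> lie in an open set
  of small measure, and absolute continuity makes the sum of the increments over them smaller than
  \<open>e\<close>.\<close>

lemma abs_cont_on_growth_le:
  fixes g :: "real \<Rightarrow> real"
  assumes ab: "a \<le> b" and ac: "abs_cont_on a b g" and N: "negligible N"
    and der: "\<And>t. t \<in> {a..b} - N \<Longrightarrow> \<exists>d\<le>c. (g has_real_derivative d) (at t within {a..b})"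
  shows "g b - g a \<le> c * (b - a)"
proof (rule field_le_epsilon)
  fix e0 :: real assume e0: "e0 > 0"
  \<comment> \<open>The errors to absorb are \<open>e * (b - a)\<close> from the good tags,
    \<open>\<bar>c\<bar> * e\<close> from the length of the bad intervals, and \<open>e\<close> from
    the increments over them.\<close>
  define e where "e = e0 / (b - a + \<bar>c\<bar> + 1)"
  have den: "b - a + \<bar>c\<bar> + 1 > 0" using ab by simp
  have e: "e > 0" unfolding e_def using e0 den by simp
  obtain \<delta> where \<delta>: "\<delta> > 0" "\<And>D S. D division_of S \<and> S \<subseteq> {a..b} \<and> (\<Sum>K\<in>D. Sup K - Inf K) < \<delta> \<Longrightarrow>
      (\<Sum>K\<in>D. norm (g (Sup K) - g (Inf K))) < e"
    using ac e unfolding abs_cont_on_def by meson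
  \<comment> \<open>Below \<open>\<delta>\<close> for absolute continuity, below \<open>e\<close>
    for the length that the bad intervals take away from the good ones.\<close>
  define \<delta>' where "\<delta>' = min \<delta> e"
  have \<delta>'0: "\<delta>' > 0" using \<delta>(1) e by (simp add: \<delta>'_def)
  obtain O' where O': "open O'" "N \<subseteq> O'" "O' - N \<in> lmeasurable" "emeasure lebesgue (O' - N) < ennreal \<delta>'"
    using sets_lebesgue_outer_open[OF negligible_imp_sets[OF N] \<delta>'0] by metis
  have O'm: "O' \<in> lmeasurable" "measure lebesgue O' < \<delta>'"
  proof -
    have "O' = (O' - N) \<union> N" using O'(2) by auto
    moreover have Nl: "N \<in> lmeasurable" using N by (rule negligible_imp_measurable)
    ultimately show 1: "O' \<in> lmeasurable" using fmeasurable.Un[OF O'(3) Nl] by simp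
    have "emeasure lebesgue O' \<le> emeasure lebesgue (O' - N) + emeasure lebesgue N"
      using emeasure_subadditive[OF fmeasurableD[OF O'(3)] fmeasurableD[OF Nl]] \<open>O' = (O' - N) \<union> N\<close> by simp
    also have "emeasure lebesgue N = 0"
      using N by (simp only: negligible_iff_null_sets null_setsD1)
    finally have "emeasure lebesgue O' < ennreal \<delta>'" using O'(4) by simp
    then show "measure lebesgue O' < \<delta>'"
      using 1 \<delta>'0 by (simp add: emeasure_eq_measure2 ennreal_less_iff)
  qed
  \<comment> \<open>For good points this is a straddle estimate: \<open>u\<close> and
    \<open>v\<close> lie on the two sides of the tag, so the errors add up to
    \<open>e * (v - u)\<close>.\<close>
  have "\<exists>r>0. (t \<in> N \<longrightarrow> ball t r \<subseteq> O') \<and>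
      (t \<in> {a..b} - N \<longrightarrow> (\<forall>u v. u \<in> {a..b} \<and> v \<in> {a..b} \<and> u \<le> t \<and> t \<le> v \<and> u \<in> ball t r \<and> v \<in> ball t r \<longrightarrow>
        g v - g u \<le> (c + e) * (v - u)))" for t
  proof (cases "t \<in> N")
    case True
    then obtain r where "r > 0" "ball t r \<subseteq> O'" using O' openE by blast
    then show ?thesis using True by auto
  next
    case tN: False
    show ?thesis
    proof (cases "t \<in> {a..b}")
      case False then show ?thesis using tN by (auto intro: exI[of _ 1])
    next
      case True
      then obtain d where d: "d \<le> c" "(g has_real_derivative d) (at t within {a..b})" using der tN by auto
      then have "\<exists>r>0. \<forall>y\<in>{a..b}. norm (y - t) < r \<longrightarrow> norm (g y - g t - d * (y - t)) \<le> e * norm (y - t)"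
        using e unfolding has_field_derivative_def has_derivative_within_alt by (simp add: mult.commute)
      then obtain r where r: "r > 0" "\<And>y. y \<in> {a..b} \<Longrightarrow> norm (y - t) < r \<Longrightarrow> norm (g y - g t - d * (y - t)) \<le> e * norm (y - t)"
        by blast
      have "g v - g u \<le> (c + e) * (v - u)" if uv: "u \<in> {a..b}" "v \<in> {a..b}" "u \<le> t" "t \<le> v" "u \<in> ball t r" "v \<in> ball t r" for u v
      proof -
        have "norm (g v - g t - d * (v - t)) \<le> e * (v - t)" "norm (g u - g t - d * (u - t)) \<le> e * (t - u)"
          using r(2)[of v] r(2)[of u] uv by (auto simp: dist_real_def)
        then have "g v - g u \<le> (d + e) * (v - u)" by (simp add: algebra_simps abs_le_iff)
        also have "\<dots> \<le> (c + e) * (v - u)" using d uv by (intro mult_right_mono) auto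
        finally show ?thesis .
      qed
      then show ?thesis using tN r(1) by (intro exI[of _ r]) simp
    qed
  qed
  then obtain R where R: "\<And>t. R t > 0" "\<And>t. t \<in> N \<Longrightarrow> ball t (R t) \<subseteq> O'"
     "\<And>t u v. \<lbrakk>t \<in> {a..b} - N; u \<in> {a..b}; v \<in> {a..b}; u \<le> t; t \<le> v; u \<in> ball t (R t); v \<in> ball t (R t)\<rbrakk> \<Longrightarrow>
        g v - g u \<le> (c + e) * (v - u)"
    by metis
  have "gauge (\<lambda>t. ball t (R t))" by (simp add: R(1) gauge_def)
  then obtain p where p: "p tagged_division_of {a..b}" "(\<lambda>t. ball t (R t)) fine p"
    using fine_division_exists_real by blast
  note pD = tagged_division_ofD[OF p(1)]
  have K: "\<exists>u v. K = {u..v} \<and> u \<le> x \<and> x \<le> v \<and> Sup K = v \<and> Inf K = u \<and> u \<in> {a..b} \<and> v \<in> {a..b} \<and> x \<in> {a..b}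
      \<and> u \<in> ball x (R x) \<and> v \<in> ball x (R x)"
    if xK: "(x, K) \<in> p" for x K
  proof -
    obtain u v where uv: "K = cbox u v" using pD(4)[OF xK] by blast
    then have 1: "u \<le> x" "x \<le> v" using pD(2)[OF xK] by auto
    have 2: "K \<subseteq> ball x (R x)" using p(2) xK by (auto simp: fine_def)
    have "u \<in> K" "v \<in> K" "x \<in> K" using uv 1 by auto
    then have "u \<in> ball x (R x)" "v \<in> ball x (R x)" "u \<in> {a..b}" "v \<in> {a..b}" "x \<in> {a..b}"
      using 2 pD(3)[OF xK] by blast+
    moreover have "K = {u..v}" "Sup K = v" "Inf K = u" using uv 1 by auto
    ultimately show ?thesis using 1 by blast
  qed
  define pN where "pN = {(x,K)\<in>p. x \<in> N}"
  have pN: "pN \<subseteq> p" by (auto simp: pN_def)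
  have finp: "finite p" "finite pN" using pD(1) pN finite_subset by auto
  have pNdiv: "pN tagged_division_of (\<Union>(snd ` pN))"
  proof (rule tagged_partial_division_of_Union_self)
    show "pN tagged_partial_division_of {a..b}"
      using tagged_partial_division_subset[OF _ pN] p(1) by (simp add: tagged_division_of_def)
  qed
  note dv = division_of_tagged_division[OF pNdiv]
  have sub: "\<Union>(snd ` pN) \<subseteq> {a..b}" "\<Union>(snd ` pN) \<subseteq> O'"
  proof -
    show "\<Union>(snd ` pN) \<subseteq> {a..b}" using pN pD(3) by (fastforce simp del: atLeastAtMost_iff)
    show "\<Union>(snd ` pN) \<subseteq> O'"
    proof (rule UN_least)
      fix y assume "y \<in> pN"
      then obtain x L where y: "y = (x, L)" "(x, L) \<in> p" "x \<in> N" by (cases y) (auto simp: pN_def)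
      then have "L \<subseteq> ball x (R x)" using p(2) unfolding fine_def by blast
      then show "snd y \<subseteq> O'" using R(2)[OF y(3)] y(1) by auto
    qed
  qed
  have sumK: "(\<Sum>K\<in>snd ` pN. Sup K - Inf K) < \<delta>'"
  proof -
    have "(\<Sum>K\<in>snd ` pN. Sup K - Inf K) = (\<Sum>K\<in>snd ` pN. measure lebesgue K)"
    proof (rule sum.cong[OF refl])
      fix L assume "L \<in> snd ` pN"
      then obtain x where "(x, L) \<in> p" using pN by auto
      from K[OF this] obtain u v where "L = {u..v}" "u \<le> v" "Sup L = v" "Inf L = u" by fastforce
      then show "Sup L - Inf L = measure lebesgue L" by simp
    qed
    also have "\<dots> = measure lebesgue (\<Union>(snd ` pN))" by (rule content_division[OF dv])
    also have "\<dots> \<le> measure lebesgue O'"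
      using sub(2) O'm(1) lmeasurable_division[OF dv] by (intro measure_mono_fmeasurable) (auto intro: fmeasurableD)
    finally show ?thesis using O'm(2) by simp
  qed
  have s1: "(\<Sum>(x,K)\<in>pN. norm (g (Sup K) - g (Inf K))) = (\<Sum>K\<in>snd ` pN. norm (g (Sup K) - g (Inf K)))"
    and s2: "(\<Sum>(x,K)\<in>pN. Sup K - Inf K) = (\<Sum>K\<in>snd ` pN. Sup K - Inf K)"
  proof -
    have *: "sum (\<lambda>(_, k). h k) pN = sum h (snd ` pN)" if h0: "\<And>u. h {u..u} = 0" for h :: "real set \<Rightarrow> real"
    proof -
      \<comment> \<open>\<open>Sup\<close> and \<open>Inf\<close> of the empty set are unspecified,
        whereas the lemma on tagged divisions asks for the value 0 on every interval without
        interior. No member of the division is empty, so the change is harmless.\<close>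
      define h' where "h' K = (if K = {} then 0 else h K)" for K
      have ne: "K \<noteq> {}" if "(x,K) \<in> pN" for x K using that pN pD(2) by blast
      have "sum (\<lambda>(_, k). h' k) pN = sum h' (snd ` pN)"
      proof (rule sum.over_tagged_division_lemma[OF pNdiv])
        fix u v :: real assume "box u v = {}"
        then have "cbox u v = {} \<or> u = v" by auto
        then show "h' (cbox u v) = 0" using h0 by (auto simp: h'_def)
      qed
      moreover have "sum (\<lambda>(_, k). h' k) pN = sum (\<lambda>(_, k). h k) pN"
        using ne by (intro sum.cong) (auto simp: h'_def)
      moreover have "sum h' (snd ` pN) = sum h (snd ` pN)"
        using ne by (intro sum.cong) (auto simp: h'_def)
      ultimately show ?thesis by simp
    qed
    show "(\<Sum>(x,K)\<in>pN. norm (g (Sup K) - g (Inf K))) = (\<Sum>K\<in>snd ` pN. norm (g (Sup K) - g (Inf K)))"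
      by (rule *) simp
    show "(\<Sum>(x,K)\<in>pN. Sup K - Inf K) = (\<Sum>K\<in>snd ` pN. Sup K - Inf K)"
      by (rule *) simp
  qed
  have bN1: "(\<Sum>(x,K)\<in>pN. norm (g (Sup K) - g (Inf K))) < e"
    unfolding s1 by (rule \<delta>(2)) (use dv sub sumK in \<open>auto simp: \<delta>'_def\<close>)
  have bN2: "(\<Sum>(x,K)\<in>pN. Sup K - Inf K) < e" using s2 sumK by (simp add: \<delta>'_def)
  have "g b - g a = (\<Sum>(x,K)\<in>p. g (Sup K) - g (Inf K))"
    using additive_tagged_division_1[OF ab p(1), of g] by simp
  also have "\<dots> = (\<Sum>(x,K)\<in>pN. g (Sup K) - g (Inf K)) + (\<Sum>(x,K)\<in>p - pN. g (Sup K) - g (Inf K))"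
    by (subst sum.subset_diff[OF pN finp(1)]) simp
  also have "(\<Sum>(x,K)\<in>p - pN. g (Sup K) - g (Inf K)) \<le> (\<Sum>(x,K)\<in>p - pN. (c + e) * (Sup K - Inf K))"
  proof (rule sum_mono)
    fix y assume "y \<in> p - pN"
    then obtain x L where y: "y = (x, L)" "(x, L) \<in> p" "x \<notin> N" by (cases y) (auto simp: pN_def)
    from K[OF y(2)] R(3)[of x "Inf L" "Sup L"] y(3)
    show "(case y of (x, K) \<Rightarrow> g (Sup K) - g (Inf K)) \<le> (case y of (x, K) \<Rightarrow> (c + e) * (Sup K - Inf K))"
      unfolding y(1) by auto
  qed
  also have "(\<Sum>(x,K)\<in>p - pN. (c + e) * (Sup K - Inf K)) = (c + e) * (\<Sum>(x,K)\<in>p - pN. (Sup K - Inf K))"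
    by (simp add: sum_distrib_left split_def)
  also have "(\<Sum>(x,K)\<in>p - pN. (Sup K - Inf K)) = (b - a) - (\<Sum>(x,K)\<in>pN. Sup K - Inf K)"
    using additive_tagged_division_1[OF ab p(1), of "\<lambda>x. x"] finp pN
    by (simp add: sum_diff)
  also have "(\<Sum>(x,K)\<in>pN. g (Sup K) - g (Inf K)) \<le> (\<Sum>(x,K)\<in>pN. norm (g (Sup K) - g (Inf K)))"
    by (rule sum_mono) (auto simp: split_def)
  finally have "g b - g a \<le> (\<Sum>(x,K)\<in>pN. norm (g (Sup K) - g (Inf K))) + (c + e) * (b - a - (\<Sum>(x,K)\<in>pN. Sup K - Inf K))" 
    by simp
  also have "\<dots> \<le> e + (c * (b - a) + e * (b - a) + \<bar>c\<bar> * e)"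
  proof -
    define s where "s = (\<Sum>(x,K)\<in>pN. Sup K - Inf K)"
    have s0: "s \<ge> 0" unfolding s_def
    proof (rule sum_nonneg)
      fix y assume "y \<in> pN"
      then obtain x L where y: "y = (x, L)" "(x, L) \<in> p" using pN by (cases y) auto
      from K[OF y(2)] show "0 \<le> (case y of (x, K) \<Rightarrow> Sup K - Inf K)" unfolding y(1) by auto
    qed
    \<comment> \<open>\<open>c\<close> may be negative, and then removing length from the good part
      increases the bound.\<close>
    have "- c * s \<le> \<bar>c\<bar> * e"
    proof -
      have "- c * s \<le> \<bar>c\<bar> * s" using s0 by (intro mult_right_mono) auto
      also have "\<dots> \<le> \<bar>c\<bar> * e" using bN2 unfolding s_def[symmetric] by (intro mult_left_mono) auto
      finally show ?thesis .
    qed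
    moreover have "- e * s \<le> 0" using e s0 by simp
    ultimately have "(c + e) * (b - a - s) \<le> c * (b - a) + e * (b - a) + \<bar>c\<bar> * e"
      by (simp add: algebra_simps)
    then show ?thesis using bN1 unfolding s_def by linarith
  qed
  also have "\<dots> = c * (b - a) + e * (b - a + \<bar>c\<bar> + 1)" by (simp add: algebra_simps)
  also have "\<dots> = c * (b - a) + e0" unfolding e_def using den by simp
  finally show "g b - g a \<le> c * (b - a) + e0" .
qed

lemma abs_cont_on_imp_continuous_on:
  assumes "abs_cont_on a b g"
  shows "continuous_on {a..b} g"
  unfolding continuous_on_iff
proof (intro ballI allI impI)
  fix x and e :: real assume x: "x \<in> {a..b}" and e: "e > 0"
  obtain d where d: "d > 0" "\<And>D S. D division_of S \<and> S \<subseteq> {a..b} \<and> (\<Sum>K\<in>D. Sup K - Inf K) < d \<Longrightarrow>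
      (\<Sum>K\<in>D. norm (g (Sup K) - g (Inf K))) < e"
    using assms e unfolding abs_cont_on_def by meson
  have *: "norm (g v - g u) < e" if "u \<in> {a..b}" "v \<in> {a..b}" "u \<le> v" "v - u < d" for u v
    using d(2)[of "{cbox u v}" "cbox u v"] division_of_self[of u v] that by auto
  show "\<exists>d>0. \<forall>y\<in>{a..b}. dist y x < d \<longrightarrow> dist (g y) (g x) < e"
  proof (intro exI conjI ballI impI)
    fix y assume "y \<in> {a..b}" "dist y x < d"
    then show "dist (g y) (g x) < e"
      using *[of x y] *[of y x] x by (cases "x \<le> y") (auto simp: dist_norm norm_minus_commute)
  qed (fact d(1))
qed

lemma interval_not_subset_negligible:
  fixes a b :: real
  assumes "a < b" "negligible N"
  obtains t where "t \<in> {a..b}" "t \<notin> N"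
proof -
  have "\<not> {a..b} \<subseteq> N"
  proof
    assume "{a..b} \<subseteq> N"
    then have "negligible (cbox a b)" using negligible_subset[OF assms(2)] by simp
    then have "box a b = {}" by (simp only: negligible_interval)
    then show False using assms(1) by simp
  qed
  then show thesis using that by blast
qed

text \<open>The scalar growth bound is applied to the component of \<open>g\<close> along its own
  total increment \<open>v\<close>; the growth of this component is the square of
  \<open>norm v\<close>.\<close>

lemma abs_cont_on_norm_growth_le:
  fixes g :: "real \<Rightarrow> 'a::real_inner"
  assumes ab: "a \<le> b" and ac: "abs_cont_on a b g" and N: "negligible N"
    and der: "\<And>t. t \<in> {a..b} - N \<Longrightarrow> \<exists>d. norm d \<le> L \<and> (g has_vector_derivative d) (at t within {a..b})"
  shows "norm (g b - g a) \<le> L * (b - a)"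
proof -
  define v where "v = g b - g a"
  have "g b \<bullet> v - g a \<bullet> v \<le> (L * norm v) * (b - a)"
  proof (rule abs_cont_on_growth_le[OF ab abs_cont_on_inner_left[OF ac] N])
    fix t assume "t \<in> {a..b} - N"
    then obtain d where d: "norm d \<le> L" "(g has_vector_derivative d) (at t within {a..b})" using der by blast
    have "((\<lambda>t. g t \<bullet> v) has_real_derivative d \<bullet> v) (at t within {a..b})"
      using d(2) unfolding has_vector_derivative_def has_field_derivative_def
      by (auto intro!: derivative_eq_intros simp: mult.commute)
    moreover have "d \<bullet> v \<le> L * norm v"
      using d(1) by (meson mult_right_mono norm_cauchy_schwarz norm_ge_zero order_trans)
    ultimately show "\<exists>d\<le>L * norm v. ((\<lambda>t. g t \<bullet> v) has_real_derivative d) (at t within {a..b})" by blast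
  qed
  then have *: "norm v * norm v \<le> (L * (b - a)) * norm v"
    by (simp add: v_def inner_diff_left[symmetric] power2_norm_eq_inner[symmetric] power2_eq_square mult_ac)
  show ?thesis
  proof (cases "norm v = 0")
    case True
    show ?thesis
    proof (cases "a = b")
      case False
      then have "a < b" using ab by simp
      \<comment> \<open>The sign of \<open>L\<close> is read off from a point where a derivative
        exists.\<close>
      then obtain t where "t \<in> {a..b}" "t \<notin> N" using N by (rule interval_not_subset_negligible)
      then obtain d :: 'a where "norm d \<le> L" using der by blast
      then have "L \<ge> 0" using norm_ge_zero[of d] by linarith
      then show ?thesis using True ab by (simp add: v_def)
    qed simp
  next
    case False
    then have "norm v > 0" by simp
    with * have "norm v \<le> L * (b - a)" by (rule mult_right_le_imp_le)
    then show ?thesis by (simp only: v_def)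
  qed
qed

lemma abs_cont_on_imp_lipschitz:
  fixes g :: "real \<Rightarrow> 'a::real_inner"
  assumes ac: "abs_cont_on a b g" and N: "negligible N" and L: "L \<ge> 0"
    and der: "\<And>t. t \<in> {a..b} - N \<Longrightarrow> \<exists>d. norm d \<le> L \<and> (g has_vector_derivative d) (at t within {a..b})"
  shows "L-lipschitz_on {a..b} g"
proof (rule lipschitz_onI[OF _ L])
  have *: "norm (g y - g x) \<le> L * (y - x)" if "x \<in> {a..b}" "y \<in> {a..b}" "x \<le> y" for x y
  proof (rule abs_cont_on_norm_growth_le[OF that(3) _ N])
    show "abs_cont_on x y g" using abs_cont_on_subset[OF ac] that by auto
    fix t assume t: "t \<in> {x..y} - N"
    then have "t \<in> {a..b} - N" using that by auto
    then obtain d where "norm d \<le> L" "(g has_vector_derivative d) (at t within {a..b})" using der by blast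
    then show "\<exists>d. norm d \<le> L \<and> (g has_vector_derivative d) (at t within {x..y})"
      using has_vector_derivative_within_subset[of g d t "{a..b}" "{x..y}"] that by auto
  qed
  fix x y assume "x \<in> {a..b}" "y \<in> {a..b}"
  then show "dist (g x) (g y) \<le> L * dist x y"
    using *[of x y] *[of y x] by (cases "x \<le> y") (auto simp: dist_norm norm_minus_commute)
qed

section \<open>Differentiability almost everywhere\<close>

text \<open>The averaging theorem speaks of means over intervals to the right of a point. Applied to
  the reflected function it yields those to the left, and outside both exceptional sets the two
  one-sided derivatives agree.\<close>

lemma indefinite_integral_has_vector_derivative_AE:
  fixes h :: "real \<Rightarrow> 'a::euclidean_space"
  assumes int: "\<And>a b. h integrable_on {a..b}"
    and F: "\<And>a b. a \<le> b \<Longrightarrow> F b - F a = integral {a..b} h"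
  obtains N where "negligible N" "\<And>t. t \<notin> N \<Longrightarrow> (F has_vector_derivative h t) (at t)"
proof -
  obtain N1 where N1: "negligible N1" "\<And>x e. \<lbrakk>x \<notin> N1; 0 < e\<rbrakk> \<Longrightarrow>
      \<exists>d>0. \<forall>k. 0 < k \<and> k < d \<longrightarrow> norm (integral (cbox x (x + k *\<^sub>R One)) h /\<^sub>R k ^ DIM(real) - h x) < e"
    using integrable_ccontinuous_explicit[of h] int by auto
  have int': "(\<lambda>s. h (- s)) integrable_on {a..b}" for a b
    using int[of "-b" "-a"] Henstock_Kurzweil_Integration.integrable_reflect_real[where f=h and a="-b" and b="-a"] by simp
  obtain N2 where N2: "negligible N2" "\<And>x e. \<lbrakk>x \<notin> N2; 0 < e\<rbrakk> \<Longrightarrow>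
      \<exists>d>0. \<forall>k. 0 < k \<and> k < d \<longrightarrow> norm (integral (cbox x (x + k *\<^sub>R One)) (\<lambda>s. h (- s)) /\<^sub>R k ^ DIM(real) - h (- x)) < e"
    using integrable_ccontinuous_explicit[of "\<lambda>s. h (- s)"] int' by auto
  have "negligible (uminus ` N2)"
    by (intro negligible_differentiable_image_negligible[OF order_refl N2(1)] differentiable_on_minus differentiable_on_ident)
  then have "negligible (N1 \<union> uminus ` N2)" using N1(1) by (rule negligible_Un[rotated])
  moreover have "(F has_vector_derivative h t) (at t)" if t: "t \<notin> N1 \<union> uminus ` N2" for t
    unfolding has_vector_derivative_def has_derivative_at_alt
  proof (intro conjI allI impI)
    show "bounded_linear (\<lambda>x. x *\<^sub>R h t)" by (rule bounded_linear_scaleR_left)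
    fix e :: real assume e: "e > 0"
    have t1: "t \<notin> N1" and t2: "- t \<notin> N2" using t by (auto simp: image_iff)
    obtain d1 where d1: "d1 > 0" "\<And>k. 0 < k \<Longrightarrow> k < d1 \<Longrightarrow> norm (integral {t..t + k} h /\<^sub>R k - h t) < e"
      using N1(2)[OF t1 e] by auto
    obtain d2 where d2: "d2 > 0" "\<And>k. 0 < k \<Longrightarrow> k < d2 \<Longrightarrow> norm (integral {- t..- t + k} (\<lambda>s. h (- s)) /\<^sub>R k - h t) < e"
      using N2(2)[OF t2 e] by auto
    show "\<exists>d>0. \<forall>y. norm (y - t) < d \<longrightarrow> norm (F y - F t - (y - t) *\<^sub>R h t) \<le> e * norm (y - t)"
    proof (intro exI[of _ "min d1 d2"] conjI allI impI)
      show "min d1 d2 > 0" using d1 d2 by simp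
      have scale: "norm (v - k *\<^sub>R h t) \<le> e * k" if "norm (v /\<^sub>R k - h t) < e" "k > 0" for v k
      proof -
        have "v - k *\<^sub>R h t = k *\<^sub>R (v /\<^sub>R k - h t)" using that(2) by (simp add: scaleR_diff_right)
        then have "norm (v - k *\<^sub>R h t) = k * norm (v /\<^sub>R k - h t)" using that(2) by simp
        also have "\<dots> \<le> k * e" using that by (intro mult_left_mono) auto
        finally show ?thesis by (simp add: mult.commute)
      qed
      fix y assume y: "norm (y - t) < min d1 d2"
      consider "y = t" | "y > t" | "y < t" by linarith
      then show "norm (F y - F t - (y - t) *\<^sub>R h t) \<le> e * norm (y - t)"
      proof cases
        case 2
        then have "F y - F t = integral {t..t + (y - t)} h" using F[of t y] by simp
        then show ?thesis using scale[OF d1(2)[of "y - t"]] 2 y by simp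
      next
        case 3
        have "F t - F y = integral {- t..- y} (\<lambda>s. h (- s))" using F[of y t] 3 by simp
        then have "norm (F t - F y - (t - y) *\<^sub>R h t) \<le> e * (t - y)"
          using scale[OF d2(2)[of "t - y"]] 3 y by simp
        moreover have "F y - F t - (y - t) *\<^sub>R h t = - (F t - F y - (t - y) *\<^sub>R h t)"
          by (simp add: algebra_simps)
        ultimately show ?thesis using 3 by (simp only: norm_minus_cancel) simp
      qed simp
    qed
  qed
  ultimately show thesis by (rule that)
qed

text \<open>Adding \<open>(L + 1) t\<close> makes \<open>F\<close> an increasing homeomorphism \<open>G\<close>; the image of Lebesgue measure
  under its inverse is then absolutely continuous because \<open>G\<close> is Lipschitz.\<close>

lemma lipschitz_on_real_has_density:
  fixes F :: "real \<Rightarrow> real"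
  assumes lip: "L-lipschitz_on UNIV F"
  obtains h where "\<And>a b. h integrable_on {a..b}" "\<And>a b. a \<le> b \<Longrightarrow> F b - F a = integral {a..b} h"
proof -
  have L: "L \<ge> 0" using lip by (rule lipschitz_on_nonneg)
  define G where "G t = F t + (L + 1) * t" for t
  have FL: "\<bar>F y - F x\<bar> \<le> L * (y - x)" if "x \<le> y" for x y
    using lipschitz_onD[OF lip, of y x] that by (simp add: dist_real_def)
  have Gincr: "y - x \<le> G y - G x" "G y - G x \<le> (2 * L + 1) * (y - x)" if "x \<le> y" for x y
    using FL[OF that] by (auto simp: G_def algebra_simps abs_le_iff)
  have Glip: "(2 * L + 1)-lipschitz_on UNIV G"
  proof (rule lipschitz_onI)
    fix x y show "dist (G x) (G y) \<le> (2 * L + 1) * dist x y"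
      using Gincr[of x y] Gincr[of y x] by (cases "x \<le> y") (auto simp: dist_real_def abs_if)
  qed (use L in simp)
  have Gle: "G x \<le> G y \<longleftrightarrow> x \<le> y" for x y
    using Gincr(1)[of x y] Gincr(1)[of y x] by (cases "x \<le> y") auto
  have contG: "continuous_on UNIV G" using Glip by (rule lipschitz_on_continuous_on)
  have "\<exists>x. G x = y" for y
  proof -
    \<comment> \<open>\<open>G\<close> grows at least as fast as the identity, so it has passed
      \<open>y\<close> at distance \<open>m\<close> from 0 on one side or the other.\<close>
    define m where "m = \<bar>y - G 0\<bar>"
    have "G (- m) \<le> y" "y \<le> G m" using Gincr(1)[of 0 m] Gincr(1)[of "-m" 0] by (auto simp: m_def)
    moreover have "- m \<le> m" by (simp add: m_def)
    ultimately show ?thesis using IVT'[of G "-m" y m] continuous_on_subset[OF contG] by blast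
  qed
  then have surj: "surj G" unfolding surj_def by (metis (no_types))
  have inj: "inj G" 
  proof (rule injI)
    fix x y assume "G x = G y"
    then have "x \<le> y" "y \<le> x" using Gle[of x y] Gle[of y x] by auto
    then show "x = y" by simp
  qed
  define H where "H = inv G"
  have GH: "G (H y) = y" and HG: "H (G x) = x" for x y
    using surj inj by (simp_all add: H_def surj_f_inv_f)
  have HGle: "a \<le> H y \<longleftrightarrow> G a \<le> y" "H y \<le> a \<longleftrightarrow> y \<le> G a" for a y
    using Gle[of a "H y"] Gle[of "H y" a] GH by simp_all
  have Hmono: "mono H" by (rule monoI) (simp add: HGle GH)
  have Hm [measurable]: "H \<in> borel_measurable borel" by (rule borel_measurable_mono[OF Hmono])
  define \<nu> where "\<nu> = distr lborel borel H"
  have vimage: "H -` A = G ` A" for A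
  proof (intro equalityI subsetI)
    fix y assume "y \<in> H -` A"
    then show "y \<in> G ` A" using GH[of y] by (intro image_eqI[of _ _ "H y"]) auto
  qed (use HG in auto)
  have ivl: "emeasure \<nu> {a..b} = ennreal (G b - G a)" if "a \<le> b" for a b
  proof -
    have "H -` {a..b} = {G a..G b}" by (auto simp: HGle)
    moreover have "G a \<le> G b" using that Gle by simp
    ultimately show ?thesis unfolding \<nu>_def by (simp add: emeasure_distr)
  qed
  have "absolutely_continuous lborel \<nu>"
    unfolding absolutely_continuous_def
  proof
    fix A :: "real set" assume A: "A \<in> null_sets lborel"
    then have "negligible A" by (simp add: negligible_iff_null_sets null_sets_completionI)
    then have "negligible (G ` A)"
    proof (rule negligible_locally_Lipschitz_image[rotated])
      fix x assume "x \<in> A"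
      have "open UNIV \<and> x \<in> UNIV \<and> (\<forall>y\<in>A \<inter> UNIV. norm (G y - G x) \<le> (2 * L + 1) * norm (y - x))"
        using lipschitz_onD[OF Glip] by (simp add: dist_norm)
      then show "\<exists>T B. open T \<and> x \<in> T \<and> (\<forall>y\<in>A \<inter> T. norm (G y - G x) \<le> B * norm (y - x))" by blast
    qed simp
    moreover have "H -` A \<in> sets borel" using measurable_sets[OF Hm, of A] A by auto
    ultimately have "emeasure lborel (H -` A) = 0"
      unfolding vimage by (simp add: negligible_iff_null_sets null_sets_def)
    then show "A \<in> null_sets \<nu>" using A unfolding \<nu>_def null_sets_def by (auto simp: emeasure_distr)
  qed
  moreover have "sets \<nu> = sets lborel" by (simp add: \<nu>_def)
  ultimately obtain f where f [measurable]: "f \<in> borel_measurable lborel" and dens: "density lborel f = \<nu>"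
    using sigma_finite_measure.Radon_Nikodym[OF sigma_finite_lborel, of \<nu>] by blast
  \<comment> \<open>Bounded intervals have finite mass under \<open>\<nu>\<close>, so the density is
    finite almost everywhere and \<open>enn2real\<close> changes no integral.\<close>
  define h0 where "h0 x = enn2real (f x)" for x
  have h0m [measurable]: "h0 \<in> borel_measurable lborel" unfolding h0_def by measurable
  have h0: "(h0 has_integral (G b - G a)) {a..b}" if ab: "a \<le> b" for a b
  proof -
    have 1: "(\<integral>\<^sup>+x. f x * indicator {a..b} x \<partial>lborel) = ennreal (G b - G a)"
      using ivl[OF ab] unfolding dens[symmetric] by (subst (asm) emeasure_density) auto
    then have "AE x in lborel. f x * indicator {a..b} x \<noteq> \<infinity>"
      by (intro nn_integral_noteq_infinite) auto
    then have "AE x in lborel. f x * indicator {a..b} x = ennreal (h0 x * indicator {a..b} x)"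
      by eventually_elim (auto simp: h0_def indicator_def less_top[symmetric] split: if_splits)
    then have 2: "(\<integral>\<^sup>+x. ennreal (h0 x * indicator {a..b} x) \<partial>lborel) = ennreal (G b - G a)"
      unfolding 1[symmetric] by (intro nn_integral_cong_AE) (auto elim: eventually_mono)
    have nn: "0 \<le> h0 x * indicator {a..b} x" for x by (simp add: h0_def)
    have "integrable lborel (\<lambda>x. h0 x * indicator {a..b} x)"
      by (rule integrableI_nonneg) (use nn 2 in \<open>auto\<close>)
    moreover have "integral\<^sup>L lborel (\<lambda>x. h0 x * indicator {a..b} x) = G b - G a"
      using 2 nn ab Gle by (subst integral_eq_nn_integral) auto
    ultimately have "((\<lambda>x. h0 x * indicator {a..b} x) has_integral (G b - G a)) UNIV"
      using has_integral_integral_lborel by metis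
    moreover have "(\<lambda>x. h0 x * indicator {a..b} x) = (\<lambda>x. if x \<in> {a..b} then h0 x else 0)"
      by (auto simp: indicator_def)
    ultimately show ?thesis by (simp only: has_integral_restrict_UNIV)
  qed
  have h: "((\<lambda>x. h0 x - (L + 1)) has_integral (F b - F a)) {a..b}" if ab: "a \<le> b" for a b
  proof -
    have "((\<lambda>x. h0 x - (L + 1)) has_integral (G b - G a - (b - a) *\<^sub>R (L + 1))) {a..b}"
      by (rule has_integral_diff[OF h0[OF ab]]) (use has_integral_const_real[of "L + 1" a b] ab in simp)
    moreover have "G b - G a - (b - a) *\<^sub>R (L + 1) = F b - F a" by (simp add: G_def algebra_simps)
    ultimately show ?thesis by simp
  qed
  show thesis
  proof (rule that)
    show "(\<lambda>x. h0 x - (L + 1)) integrable_on {a..b}" for a b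
      using h[of a b] by (cases "a \<le> b") (auto simp: integrable_on_def)
    show "F b - F a = integral {a..b} (\<lambda>x. h0 x - (L + 1))" if "a \<le> b" for a b
      using h[OF that] by (rule integral_unique[symmetric])
  qed
qed

text \<open>Rademacher's theorem in one variable, by coordinates. Clamping the time to
  \<open>{a..b}\<close> extends a coordinate to the line with the same constant \<open>L\<close>;
  the extension has a density and is differentiable at almost every point. In the open interval it
  coincides with the coordinate near each point.\<close>

theorem lipschitz_on_differentiable_AE:
  fixes x :: "real \<Rightarrow> 'a::euclidean_space"
  assumes lip: "L-lipschitz_on {a..b} x"
  obtains N where "negligible N" "\<And>t. t \<in> {a<..<b} - N \<Longrightarrow> \<exists>d. (x has_vector_derivative d) (at t)"
proof -
  have *: "\<exists>N. negligible N \<and> (\<forall>t\<in>{a<..<b} - N. \<exists>d. ((\<lambda>t. x t \<bullet> i) has_real_derivative d) (at t))" if i: "i \<in> Basis" for i :: 'a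
  proof (cases "a \<le> b")
    case True
    define c where "c t = max a (min b t)" for t
    have c: "c t \<in> {a..b}" "\<bar>c t - c s\<bar> \<le> \<bar>t - s\<bar>" for t s using True by (auto simp: c_def)
    define F where "F t = x (c t) \<bullet> i" for t
    have "L-lipschitz_on UNIV F"
    proof (rule lipschitz_onI)
      show "0 \<le> L" using lip by (rule lipschitz_on_nonneg)
      fix s t
      have "\<bar>F s - F t\<bar> \<le> norm (x (c s) - x (c t))"
        using Basis_le_norm[OF i, of "x (c s) - x (c t)"] by (simp add: F_def inner_diff_left)
      also have "\<dots> \<le> L * \<bar>c s - c t\<bar>" using lipschitz_onD[OF lip c(1) c(1), of s t] by (simp add: dist_norm)
      also have "\<dots> \<le> L * \<bar>s - t\<bar>" using c(2) \<open>0 \<le> L\<close> by (rule mult_left_mono)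
      finally show "dist (F s) (F t) \<le> L * dist s t" by (simp add: dist_real_def)
    qed
    then obtain h where "\<And>a b. h integrable_on {a..b}" "\<And>a b. a \<le> b \<Longrightarrow> F b - F a = integral {a..b} h"
      by (rule lipschitz_on_real_has_density[of L F]) blast+
    then obtain N where N: "negligible N" "\<And>t. t \<notin> N \<Longrightarrow> (F has_vector_derivative h t) (at t)"
      by (rule indefinite_integral_has_vector_derivative_AE[of h F]) blast+
    have "((\<lambda>t. x t \<bullet> i) has_real_derivative h t) (at t)" if t: "t \<in> {a<..<b} - N" for t
    proof (rule DERIV_cong_ev[OF refl _ refl, THEN iffD1])
      show "(F has_real_derivative h t) (at t)"
        using N(2) t by (simp add: has_real_derivative_iff_has_vector_derivative)
      show "\<forall>\<^sub>F s in nhds t. F s = x s \<bullet> i"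
        using t eventually_nhds_in_open[of "{a<..<b}" t] by (auto elim!: eventually_mono simp: F_def c_def)
    qed
    then show ?thesis using N(1) by blast
  qed (auto intro: exI[of _ "{}"])
  then obtain N where N: "\<And>i. i \<in> Basis \<Longrightarrow> negligible (N i)"
     "\<And>i t. i \<in> Basis \<Longrightarrow> t \<in> {a<..<b} - N i \<Longrightarrow> \<exists>d. ((\<lambda>t. x t \<bullet> i) has_real_derivative d) (at t)"
    by metis
  show thesis
  proof (rule that)
    show "negligible (\<Union>i\<in>Basis. N i)" using N(1) by (intro negligible_Union) auto
    fix t assume t: "t \<in> {a<..<b} - (\<Union>i\<in>Basis. N i)"
    then have "\<forall>i\<in>Basis. \<exists>d. ((\<lambda>t. x t \<bullet> i) has_real_derivative d) (at t)" using N(2) by blast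
    then obtain d where d: "\<And>i. i \<in> Basis \<Longrightarrow> ((\<lambda>t. x t \<bullet> i) has_real_derivative d i) (at t)" by metis
    have "(x has_vector_derivative (\<Sum>i\<in>Basis. d i *\<^sub>R i)) (at t)"
      unfolding has_vector_derivative_def
    proof (subst has_derivative_componentwise_within, intro ballI)
      fix i :: 'a assume i: "i \<in> Basis"
      show "((\<lambda>t. x t \<bullet> i) has_derivative (\<lambda>y. (y *\<^sub>R (\<Sum>i\<in>Basis. d i *\<^sub>R i)) \<bullet> i)) (at t)"
        using d[OF i] i by (simp add: has_field_derivative_def mult_commute_abs)
    qed
    then show "\<exists>d. (x has_vector_derivative d) (at t)" by blast
  qed
qed

section \<open>The constraint functions\<close>

lemma grad_eqI:
  assumes "GDERIV g x :> D"
  shows "grad g x = D"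
  unfolding grad_def
proof (rule the_equality)
  show "GDERIV g x :> D" by (fact assms)
next
  fix D' assume "GDERIV g x :> D'"
  then have "(\<lambda>h. h \<bullet> D') = (\<lambda>h. h \<bullet> D)"
    using assms unfolding gderiv_def by (rule has_derivative_unique)
  then have "(D' - D) \<bullet> (D' - D) = 0" by (simp add: inner_diff_right fun_eq_iff)
  then show "D' = D" by simp
qed

text \<open>Only the limit problem and the constant \<open>\<mu>\<close> are fixed here. The penalty
  parameters stay outside, since they change along subsequences.\<close>

locale sweeping_data =
  fixes T :: real and I :: nat
    and f :: "real \<Rightarrow> 'a::euclidean_space \<Rightarrow> 'b::euclidean_space \<Rightarrow> 'a"
    and \<psi> :: "nat \<Rightarrow> real \<Rightarrow> 'a \<Rightarrow> real"
    and U :: "'b set"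
    and r \<beta> \<eta> \<rho> M \<mu> :: real
  assumes T_pos: "T > 0"
    and A1: "assumption_A1 T I \<psi> r \<beta> \<eta> \<rho>"
    and A2: "assumption_A2 T f U r M"
    and A3: "assumption_A3 T f U"
    and A4: "assumption_A4 U"
    and mu: "mu_bound T I \<psi> f U \<mu>"
begin

abbreviation "C \<equiv> moving_set I \<psi>"
abbreviation "gr i t x \<equiv> grad (\<psi> i t) x"
abbreviation "dt i t x \<equiv> vector_derivative (\<lambda>s. \<psi> i s x) (at t within {0..T})"
abbreviation "S \<equiv> {0..T} \<times> (UNIV :: 'a set)"

lemma beta_pos: "\<beta> > 0" and eta_pos: "\<eta> > 0" and r_pos: "r > 0"
  using A1 by (auto simp: assumption_A1_def)

lemma grad_gt: "t \<in> {0..T} \<Longrightarrow> i \<in> {1..I} \<Longrightarrow> \<psi> i t x \<in> {-\<beta>..\<beta>} \<Longrightarrow> norm (gr i t x) > \<eta>"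
  using A1 unfolding assumption_A1_def by blast

lemma grad_far: "t \<in> {0..T} \<Longrightarrow> i \<in> {1..I} \<Longrightarrow> \<psi> i t x \<le> - 2 * \<beta> \<Longrightarrow> gr i t x = 0"
  using A1 unfolding assumption_A1_def by blast

text \<open>An index with value at most \<open>- 2 * \<beta>\<close> has zero gradient, so the sign
  condition extends from \<open>near_active\<close> to all indices with value at most
  \<open>\<beta>\<close>.\<close>

lemma grad_inner_nonneg:
  assumes "t \<in> {0..T}" "i \<in> {1..I}" "j \<in> {1..I}" "\<psi> i t x \<le> \<beta>" "\<psi> j t x \<le> \<beta>"
  shows "gr i t x \<bullet> gr j t x \<ge> 0"
proof (cases "\<psi> i t x \<le> - 2 * \<beta> \<or> \<psi> j t x \<le> - 2 * \<beta>")
  case True then show ?thesis using grad_far assms by auto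
next
  case False
  then have "i \<in> near_active I \<psi> \<beta> t x" "j \<in> near_active I \<psi> \<beta> t x" using assms by (auto simp: near_active_def)
  then show ?thesis using A1 assms(1) unfolding assumption_A1_def by blast
qed

text \<open>All inner products are nonnegative, so the diagonal term alone is a lower bound: a
  nonnegative combination of gradients never counteracts any of its members. The barrier argument
  and all inward directions rest on this.\<close>

lemma grad_inner_sum_ge:
  assumes t: "t \<in> {0..T}" and A: "A \<subseteq> {1..I}" "i \<in> A" and b: "\<And>j. j \<in> A \<Longrightarrow> \<psi> j t x \<le> \<beta>"
    and c: "\<And>j. j \<in> A \<Longrightarrow> c j \<ge> 0"
  shows "gr i t x \<bullet> (\<Sum>j\<in>A. c j *\<^sub>R gr j t x) \<ge> c i * (norm (gr i t x))\<^sup>2"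
proof -
  have fin: "finite A" using A finite_subset by blast
  have "gr i t x \<bullet> (\<Sum>j\<in>A. c j *\<^sub>R gr j t x) = (\<Sum>j\<in>A. c j * (gr i t x \<bullet> gr j t x))"
    by (simp add: inner_sum_right)
  also have "\<dots> \<ge> c i * (gr i t x \<bullet> gr i t x)"
    by (rule member_le_sum[OF A(2) _ fin]) (use A b c t in \<open>auto intro!: mult_nonneg_nonneg grad_inner_nonneg\<close>)
  finally show ?thesis by (simp add: power2_norm_eq_inner)
qed

text \<open>\<open>grad\<close> and the time derivative are defined on slices, while the smoothness
  assumption concerns the strip. Restricting the derivative \<open>D\<close> to the two slices
  through a point identifies its components, so that regularity of \<open>D\<close> transfers to the
  gradient; \<open>E\<close> is the second derivative.\<close>

lemma psi_structure:
  assumes i: "i \<in> {1..I}"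
  obtains D E where "\<And>z. z \<in> S \<Longrightarrow> ((\<lambda>(t, x). \<psi> i t x) has_derivative blinfun_apply (D z)) (at z within S)"
    "\<And>z. z \<in> S \<Longrightarrow> (D has_derivative blinfun_apply (E z)) (at z within S)"
    "continuous_on S D" "continuous_on S E"
    "\<And>t x s h. t \<in> {0..T} \<Longrightarrow> blinfun_apply (D (t, x)) (s, h) = s * dt i t x + gr i t x \<bullet> h"
proof -
  have "C2_on (\<lambda>(t, x). \<psi> i t x) S" using A1 i by (auto simp: assumption_A1_def)
  then obtain D where D0: "(\<forall>z\<in>S. ((\<lambda>(t, x). \<psi> i t x) has_derivative blinfun_apply (D z)) (at z within S)) \<and> C1_on D S"
    unfolding C2_on_def ..
  then have "C1_on D S" ..
  then obtain E where E0: "(\<forall>z\<in>S. (D has_derivative blinfun_apply (E z)) (at z within S)) \<and> continuous_on S E"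
    unfolding C1_on_def ..
  have D: "\<And>z. z \<in> S \<Longrightarrow> ((\<lambda>(t, x). \<psi> i t x) has_derivative blinfun_apply (D z)) (at z within S)"
    by (rule bspec[OF conjunct1[OF D0]])
  have E: "\<And>z. z \<in> S \<Longrightarrow> (D has_derivative blinfun_apply (E z)) (at z within S)" "continuous_on S E"
    by (rule bspec[OF conjunct1[OF E0]], assumption) (rule conjunct2[OF E0])
  have cD: "continuous_on S D" by (rule has_derivative_continuous_on[OF E(1)])
  have "blinfun_apply (D (t, x)) (s, h) = s * dt i t x + gr i t x \<bullet> h" if t: "t \<in> {0..T}" for t x s h
  proof -
    have tx: "(t, x) \<in> S" using t by simp
    have 1: "((\<lambda>y. (t, y)) has_derivative (\<lambda>h. (0, h))) (at x within UNIV)"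
      by (auto intro!: derivative_eq_intros)
    have 2: "((\<lambda>(t, x). \<psi> i t x) has_derivative blinfun_apply (D (t, x))) (at (t, x) within (\<lambda>y. (t, y)) ` UNIV)"
      by (rule has_derivative_subset[OF D[OF tx]]) (use t in auto)
    have d1: "((\<psi> i t) has_derivative (\<lambda>h. blinfun_apply (D (t, x)) (0, h))) (at x)"
      using diff_chain_within[OF 1 2] by (simp add: comp_def)
    \<comment> \<open>The Riesz representative of the spatial part of
      \<open>D (t, x)\<close>.\<close>
    define w where "w = (\<Sum>b\<in>Basis. blinfun_apply (D (t, x)) (0, b) *\<^sub>R b)"
    have lin: "linear (\<lambda>h. blinfun_apply (D (t, x)) (0, h))"
      by (rule has_derivative_linear[OF d1])
    have w: "blinfun_apply (D (t, x)) (0, h) = h \<bullet> w" for h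
    proof -
      have "blinfun_apply (D (t, x)) (0, h) = blinfun_apply (D (t, x)) (0, \<Sum>b\<in>Basis. (h \<bullet> b) *\<^sub>R b)"
        by (simp add: euclidean_representation)
      also have "\<dots> = (\<Sum>b\<in>Basis. (h \<bullet> b) *\<^sub>R blinfun_apply (D (t, x)) (0, b))"
        by (simp only: linear_sum[OF lin] linear_cmul[OF lin])
      also have "\<dots> = h \<bullet> w" by (simp add: w_def inner_sum_right mult.commute)
      finally show ?thesis .
    qed
    have gw: "gr i t x = w" by (rule grad_eqI) (use d1 in \<open>simp add: gderiv_def w\<close>)
    have 3: "((\<lambda>s. (s, x)) has_derivative (\<lambda>s. (s, 0))) (at t within {0..T})"
      by (auto intro!: derivative_eq_intros)
    have 4: "((\<lambda>(t, x). \<psi> i t x) has_derivative blinfun_apply (D (t, x))) (at (t, x) within (\<lambda>s. (s, x)) ` {0..T})"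
      by (rule has_derivative_subset[OF D[OF tx]]) auto
    have 5: "((\<lambda>s. \<psi> i s x) has_derivative (\<lambda>s. blinfun_apply (D (t, x)) (s, 0))) (at t within {0..T})"
      using diff_chain_within[OF 3 4] by (simp add: comp_def)
    have s0: "blinfun_apply (D (t, x)) (s, 0) = s *\<^sub>R blinfun_apply (D (t, x)) (1, 0)" for s
      using blinfun.scaleR_right[of "D (t, x)" s "(1, 0)"] by simp
    have "(\<lambda>s. blinfun_apply (D (t, x)) (s, 0)) = (\<lambda>s. s *\<^sub>R blinfun_apply (D (t, x)) (1, 0))"
      by (rule ext) (rule s0)
    with 5 have "((\<lambda>s. \<psi> i s x) has_vector_derivative blinfun_apply (D (t, x)) (1, 0)) (at t within {0..T})"
      unfolding has_vector_derivative_def by (simp only:)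
    then have "dt i t x = blinfun_apply (D (t, x)) (1, 0)"
      using vector_derivative_within_cbox[of 0 T t "\<lambda>s. \<psi> i s x"] t T_pos by simp
    moreover have "blinfun_apply (D (t, x)) (s, h) = blinfun_apply (D (t, x)) (s, 0) + blinfun_apply (D (t, x)) (0, h)"
      using blinfun.add_right[of "D (t, x)" "(s, 0)" "(0, h)"] by simp
    ultimately show ?thesis using s0[of s] w[of h] gw by (simp add: inner_commute)
  qed
  note eq = this
  show thesis by (rule that[OF D E(1) cD E(2) eq])
qed

lemma psi_has_derivative:
  assumes "i \<in> {1..I}" "t \<in> {0..T}"
  shows "((\<lambda>(t, x). \<psi> i t x) has_derivative (\<lambda>(s, h). s * dt i t x + gr i t x \<bullet> h)) (at (t, x) within S)"
proof -
  obtain D where D: "\<And>z. z \<in> S \<Longrightarrow> ((\<lambda>(t, x). \<psi> i t x) has_derivative blinfun_apply (D z)) (at z within S)"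
    "\<And>t x s h. t \<in> {0..T} \<Longrightarrow> blinfun_apply (D (t, x)) (s, h) = s * dt i t x + gr i t x \<bullet> h"
    by (rule psi_structure[OF assms(1)]) blast
  have "blinfun_apply (D (t, x)) = (\<lambda>(s, h). s * dt i t x + gr i t x \<bullet> h)"
    using D(2)[OF assms(2)] by (simp add: fun_eq_iff)
  then show ?thesis using D(1)[of "(t, x)"] assms(2) by auto
qed

lemma continuous_on_psi: "i \<in> {1..I} \<Longrightarrow> continuous_on S (\<lambda>(t, x). \<psi> i t x)"
  by (rule has_derivative_continuous_on[where f' = "\<lambda>(t, x) (s, h). s * dt i t x + gr i t x \<bullet> h"])
    (use psi_has_derivative in \<open>auto simp: split_beta'\<close>)

lemma psi_space_derivative:
  assumes "i \<in> {1..I}" "t \<in> {0..T}"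
  shows "((\<psi> i t) has_derivative (\<lambda>h. gr i t x \<bullet> h)) (at x)"
proof -
  have 1: "((\<lambda>y. (t, y)) has_derivative (\<lambda>h. (0, h))) (at x within UNIV)"
    by (auto intro!: derivative_eq_intros)
  have 2: "((\<lambda>(t, x). \<psi> i t x) has_derivative (\<lambda>(s, h). s * dt i t x + gr i t x \<bullet> h)) (at (t, x) within (\<lambda>y. (t, y)) ` UNIV)"
    by (rule has_derivative_subset[OF psi_has_derivative[OF assms]]) (use assms in auto)
  show ?thesis
    using diff_chain_within[OF 1 2] by (simp add: comp_def)
qed

lemma psi_along_curve:
  assumes "i \<in> {1..I}" "t \<in> {0..T}" "(x has_vector_derivative d) (at t within {0..T})"
  shows "((\<lambda>s. \<psi> i s (x s)) has_real_derivative (dt i t (x t) + gr i t (x t) \<bullet> d)) (at t within {0..T})"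
proof -
  have 1: "((\<lambda>s. (s, x s)) has_derivative (\<lambda>s. (s, s *\<^sub>R d))) (at t within {0..T})"
    using assms(3) unfolding has_vector_derivative_def by (auto intro!: derivative_eq_intros)
  have 2: "((\<lambda>(t, x). \<psi> i t x) has_derivative (\<lambda>(s, h). s * dt i t (x t) + gr i t (x t) \<bullet> h)) (at (t, x t) within (\<lambda>s. (s, x s)) ` {0..T})"
    by (rule has_derivative_subset[OF psi_has_derivative[OF assms(1,2)]]) auto
  show ?thesis
    using diff_chain_within[OF 1 2] 
    by (simp add: comp_def has_real_derivative_iff_has_vector_derivative has_vector_derivative_def algebra_simps)
qed

text \<open>Testing on \<open>(0, w)\<close>, with \<open>w\<close> the difference of the gradients,
  and on \<open>(1, 0)\<close> shows that the operator norm dominates both components without a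
  constant.\<close>

lemma derivative_diff_le:
  assumes "t \<in> {0..T}" "t' \<in> {0..T}"
    and D: "\<And>t x s h. t \<in> {0..T} \<Longrightarrow> blinfun_apply (D (t, x)) (s, h) = s * dt i t x + gr i t x \<bullet> h"
  shows "norm (gr i t x - gr i t' y) \<le> norm (D (t, x) - D (t', y))"
    and "\<bar>dt i t x - dt i t' y\<bar> \<le> norm (D (t, x) - D (t', y))"
proof -
  define w where "w = gr i t x - gr i t' y"
  have "w \<bullet> w = blinfun_apply (D (t, x) - D (t', y)) (0, w)"
    using D assms by (simp add: blinfun.diff_left w_def inner_diff_left)
  also have "\<dots> \<le> norm (D (t, x) - D (t', y)) * norm (0::real, w)"
    using norm_blinfun[of "D (t, x) - D (t', y)" "(0, w)"] by (simp add: abs_le_iff)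
  finally have "norm w * norm w \<le> norm (D (t, x) - D (t', y)) * norm w"
    by (simp add: power2_norm_eq_inner[symmetric] power2_eq_square norm_Pair)
  then show "norm w \<le> norm (D (t, x) - D (t', y))"
    by (cases "norm w = 0") (auto simp: mult_le_cancel_right)
  have "\<bar>dt i t x - dt i t' y\<bar> = norm (blinfun_apply (D (t, x) - D (t', y)) (1, 0))"
    using D assms by (simp add: blinfun.diff_left)
  also have "\<dots> \<le> norm (D (t, x) - D (t', y)) * norm (1::real, 0::'a)"
    by (rule norm_blinfun)
  finally show "\<bar>dt i t x - dt i t' y\<bar> \<le> norm (D (t, x) - D (t', y))" by (simp add: norm_Pair)
qed

lemma continuous_on_gr:
  assumes "i \<in> {1..I}"
  shows "continuous_on S (\<lambda>(t, x). gr i t x)" "continuous_on S (\<lambda>(t, x). dt i t x)"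
proof -
  obtain D where cD: "continuous_on S D" and
    D: "\<And>t x s h. t \<in> {0..T} \<Longrightarrow> blinfun_apply (D (t, x)) (s, h) = s * dt i t x + gr i t x \<bullet> h"
    by (rule psi_structure[OF assms]) blast
  have c: "continuous_on S g" if le: "\<And>z w. z \<in> S \<Longrightarrow> w \<in> S \<Longrightarrow> norm (g z - g w) \<le> norm (D z - D w)" for g :: "real \<times> 'a \<Rightarrow> 'c::real_normed_vector"
    unfolding continuous_on_iff
  proof (intro ballI allI impI)
    fix z and e :: real assume "z \<in> S" "e > 0"
    then obtain d where "d > 0" "\<And>w. w \<in> S \<Longrightarrow> dist w z < d \<Longrightarrow> dist (D w) (D z) < e"
      using cD unfolding continuous_on_iff by metis
    then show "\<exists>d>0. \<forall>w\<in>S. dist w z < d \<longrightarrow> dist (g w) (g z) < e"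
      using le \<open>z \<in> S\<close> unfolding dist_norm by (meson le_less_trans)
  qed
  show "continuous_on S (\<lambda>(t, x). gr i t x)"
    by (rule c) (use derivative_diff_le(1)[OF _ _ D] in auto)
  show "continuous_on S (\<lambda>(t, x). dt i t x)"
    by (rule c) (use derivative_diff_le(2)[OF _ _ D] in auto)
qed

section \<open>Uniform bounds on a compact convex part of the strip\<close>

abbreviation "Q \<equiv> S \<inter> cball 0 r"

text \<open>Compactness gives uniform constants, convexity the mean value inequality between any two
  points of \<open>Q\<close>.\<close>

lemma Q_compact: "compact Q" and Q_convex: "convex Q"
proof -
  have "closed S" by (intro closed_Times) auto
  then show "compact Q" by (simp add: closed_Int_compact)
  show "convex Q" by (intro convex_Int convex_Times) auto
qed

lemma bounded_on_Q:
  fixes g :: "nat \<Rightarrow> real \<times> 'a \<Rightarrow> 'c::real_normed_vector"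
  assumes "\<And>i. i \<in> {1..I} \<Longrightarrow> continuous_on S (g i)"
  obtains K where "K > 0" "\<And>i z. i \<in> {1..I} \<Longrightarrow> z \<in> Q \<Longrightarrow> norm (g i z) \<le> K"
proof -
  have "\<exists>K. \<forall>z\<in>Q. norm (g i z) \<le> K" if "i \<in> {1..I}" for i
    using compact_continuous_image[OF continuous_on_subset[OF assms[OF that]] Q_compact]
    by (auto dest!: compact_imp_bounded simp: bounded_iff)
  then obtain K where K: "\<And>i z. i \<in> {1..I} \<Longrightarrow> z \<in> Q \<Longrightarrow> norm (g i z) \<le> K i" by metis
  \<comment> \<open>The sum dominates every single bound; the added 1 keeps the constant positive
    even when there is no index.\<close>
  have "K i \<le> (\<Sum>i\<in>{1..I}. \<bar>K i\<bar>) + 1" if "i \<in> {1..I}" for i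
    using member_le_sum[of i "{1..I}" "\<lambda>i. \<bar>K i\<bar>"] that by auto
  then have "norm (g i z) \<le> (\<Sum>i\<in>{1..I}. \<bar>K i\<bar>) + 1" if "i \<in> {1..I}" "z \<in> Q" for i z
    using K that by (meson order_trans)
  then show thesis by (intro that[of "(\<Sum>i\<in>{1..I}. \<bar>K i\<bar>) + 1"]) (auto simp: add_nonneg_pos sum_nonneg)
qed

lemma gr_bounded:
  obtains G where "G > 0" "\<And>i t x. i \<in> {1..I} \<Longrightarrow> (t, x) \<in> Q \<Longrightarrow> norm (gr i t x) \<le> G"
    "\<And>i t x. i \<in> {1..I} \<Longrightarrow> (t, x) \<in> Q \<Longrightarrow> \<bar>dt i t x\<bar> \<le> G"
proof -
  obtain G1 where G1: "G1 > 0" "\<And>i z. i \<in> {1..I} \<Longrightarrow> z \<in> Q \<Longrightarrow> norm (case z of (t, x) \<Rightarrow> gr i t x) \<le> G1"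
    by (rule bounded_on_Q[OF continuous_on_gr(1)]) blast+
  obtain G2 where G2: "G2 > 0" "\<And>i z. i \<in> {1..I} \<Longrightarrow> z \<in> Q \<Longrightarrow> norm (case z of (t, x) \<Rightarrow> dt i t x) \<le> G2"
    by (rule bounded_on_Q[OF continuous_on_gr(2)]) blast+
  show thesis
  proof (rule that[of "max G1 G2"])
    fix i t x assume "i \<in> {1..I}" "(t, x) \<in> Q"
    then show "norm (gr i t x) \<le> max G1 G2" "\<bar>dt i t x\<bar> \<le> max G1 G2"
      using G1(2)[of i "(t, x)"] G2(2)[of i "(t, x)"] by auto
  qed (use G1 in auto)
qed

text \<open>Mean value inequality on \<open>Q\<close>: the bound on the second derivative makes the
  gradient Lipschitz in time and space jointly, the bound on the first does the same for the
  constraint function.\<close>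

lemma derivative_bounded_lipschitz_aux:
  assumes i: "i \<in> {1..I}"
  obtains K where
    "\<And>t x t' y. (t, x) \<in> Q \<Longrightarrow> (t', y) \<in> Q \<Longrightarrow> norm (gr i t x - gr i t' y) \<le> K * norm ((t, x) - (t', y))"
    "\<And>z w. z \<in> Q \<Longrightarrow> w \<in> Q \<Longrightarrow> \<bar>(case z of (t, x) \<Rightarrow> \<psi> i t x) - (case w of (t, x) \<Rightarrow> \<psi> i t x)\<bar> \<le> K * norm (z - w)"
proof (rule psi_structure[OF i])
  fix D E
  assume D: "\<And>z. z \<in> S \<Longrightarrow> ((\<lambda>(t, x). \<psi> i t x) has_derivative blinfun_apply (D z)) (at z within S)"
    and E: "\<And>z. z \<in> S \<Longrightarrow> (D has_derivative blinfun_apply (E z)) (at z within S)"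
    and c: "continuous_on S D" "continuous_on S E"
    and eq: "\<And>t x s h. t \<in> {0..T} \<Longrightarrow> blinfun_apply (D (t, x)) (s, h) = s * dt i t x + gr i t x \<bullet> h"
  obtain K1 where K1: "K1 > 0" "\<And>j z. j \<in> {1..I} \<Longrightarrow> z \<in> Q \<Longrightarrow> norm (D z) \<le> K1"
    by (rule bounded_on_Q[OF c(1)]) blast+
  obtain K2 where K2: "K2 > 0" "\<And>j z. j \<in> {1..I} \<Longrightarrow> z \<in> Q \<Longrightarrow> norm (E z) \<le> K2"
    by (rule bounded_on_Q[OF c(2)]) blast+
  have mono: "k * norm z \<le> max K1 K2 * norm z" if "k = K1 \<or> k = K2" for k and z :: "real \<times> 'a"
    using that by (intro mult_right_mono) auto
  show thesis
  proof (rule that[of "max K1 K2"])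
    fix t x t' y assume Q: "(t, x) \<in> Q" "(t', y) \<in> Q"
    have "norm (D (t, x) - D (t', y)) \<le> K2 * norm ((t, x) - (t', y))"
    proof (rule differentiable_bound[OF Q_convex _ _ Q(1) Q(2)])
      show "(D has_derivative blinfun_apply (E z)) (at z within Q)" if "z \<in> Q" for z
        by (rule has_derivative_subset[OF E]) (use that in auto)
      show "onorm (blinfun_apply (E z)) \<le> K2" if "z \<in> Q" for z
        using K2(2)[OF i that] by (simp add: norm_blinfun.rep_eq)
    qed
    moreover have "norm (gr i t x - gr i t' y) \<le> norm (D (t, x) - D (t', y))"
      by (rule derivative_diff_le(1)[OF _ _ eq]) (use Q in auto)
    ultimately show "norm (gr i t x - gr i t' y) \<le> max K1 K2 * norm ((t, x) - (t', y))"
      using mono[of K2 "(t, x) - (t', y)"] by linarith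
  next
    fix z w assume Q: "z \<in> Q" "w \<in> Q"
    have "norm ((case z of (t, x) \<Rightarrow> \<psi> i t x) - (case w of (t, x) \<Rightarrow> \<psi> i t x)) \<le> K1 * norm (z - w)"
    proof (rule differentiable_bound[OF Q_convex _ _ Q(1) Q(2)])
      show "((\<lambda>(t, x). \<psi> i t x) has_derivative blinfun_apply (D z)) (at z within Q)" if "z \<in> Q" for z
        by (rule has_derivative_subset[OF D]) (use that in auto)
      show "onorm (blinfun_apply (D z)) \<le> K1" if "z \<in> Q" for z
        using K1(2)[OF i that] by (simp add: norm_blinfun.rep_eq)
    qed
    then show "\<bar>(case z of (t, x) \<Rightarrow> \<psi> i t x) - (case w of (t, x) \<Rightarrow> \<psi> i t x)\<bar> \<le> max K1 K2 * norm (z - w)"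
      using mono[of K1 "z - w"] by simp
  qed
qed

lemma derivative_bounded_lipschitz:
  obtains K where "K > 0"
    "\<And>i t x t' y. i \<in> {1..I} \<Longrightarrow> (t, x) \<in> Q \<Longrightarrow> (t', y) \<in> Q \<Longrightarrow> norm (gr i t x - gr i t' y) \<le> K * norm ((t, x) - (t', y))"
    "\<And>i z w. i \<in> {1..I} \<Longrightarrow> z \<in> Q \<Longrightarrow> w \<in> Q \<Longrightarrow> \<bar>(case z of (t, x) \<Rightarrow> \<psi> i t x) - (case w of (t, x) \<Rightarrow> \<psi> i t x)\<bar> \<le> K * norm (z - w)"
proof -
  define P where "P i K \<longleftrightarrow> (\<forall>t x t' y. (t, x) \<in> Q \<longrightarrow> (t', y) \<in> Q \<longrightarrow> norm (gr i t x - gr i t' y) \<le> K * norm ((t, x) - (t', y)))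
    \<and> (\<forall>z\<in>Q. \<forall>w\<in>Q. \<bar>(case z of (t, x) \<Rightarrow> \<psi> i t x) - (case w of (t, x) \<Rightarrow> \<psi> i t x)\<bar> \<le> K * norm (z - w))" for i K
  have "\<exists>K. P i K" if "i \<in> {1..I}" for i
    unfolding P_def by (rule derivative_bounded_lipschitz_aux[OF that]) blast
  then obtain k where k: "\<And>i. i \<in> {1..I} \<Longrightarrow> P i (k i)" by metis
  define K where "K = (\<Sum>i\<in>{1..I}. \<bar>k i\<bar>) + 1"
  have kK: "k i * norm z \<le> K * norm z" if "i \<in> {1..I}" for i and z :: "real \<times> 'a"
  proof (rule mult_right_mono)
    show "k i \<le> K" using member_le_sum[of i "{1..I}" "\<lambda>i. \<bar>k i\<bar>"] that by (auto simp: K_def)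
  qed simp
  show thesis
  proof (rule that[of K])
    show "K > 0" by (auto simp: K_def add_nonneg_pos sum_nonneg)
    fix i t x t' y assume "i \<in> {1..I}" "(t, x) \<in> Q" "(t', y) \<in> Q"
    then show "norm (gr i t x - gr i t' y) \<le> K * norm ((t, x) - (t', y))"
      using k kK[of i "(t, x) - (t', y)"] unfolding P_def by (meson order_trans)
  next
    fix i z w assume "i \<in> {1..I}" "z \<in> Q" "w \<in> Q"
    then show "\<bar>(case z of (t, x) \<Rightarrow> \<psi> i t x) - (case w of (t, x) \<Rightarrow> \<psi> i t x)\<bar> \<le> K * norm (z - w)"
      using k kK[of i "z - w"] unfolding P_def by (meson order_trans)
  qed
qed

end

section \<open>The feasible sets and their normal cones\<close>

text \<open>Turns a bound on a one-sided derivative into an inequality for all small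
  \<open>h > 0\<close>. In this filter form several such inequalities combine without a choice of
  \<open>h\<close>.\<close>

lemma eventually_less_of_derivative:
  fixes \<phi> :: "real \<Rightarrow> real"
  assumes "(\<phi> has_real_derivative D) (at_right 0)" "D < c"
  shows "\<forall>\<^sub>F h in at_right 0. \<phi> h < \<phi> 0 + c * h"
proof -
  have "((\<lambda>h. (\<phi> h - \<phi> 0) / (h - 0)) \<longlongrightarrow> D) (at_right 0)"
    using assms(1) unfolding has_field_derivative_iff by simp
  then have "\<forall>\<^sub>F h in at_right 0. (\<phi> h - \<phi> 0) / (h - 0) < c" using assms(2) by (rule order_tendstoD)
  moreover have "\<forall>\<^sub>F h in at_right (0::real). h > 0" by (rule eventually_at_right_less)
  ultimately show ?thesis by eventually_elim (simp add: pos_divide_less_eq algebra_simps)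
qed

lemma continuous_on_Max_image:
  fixes g :: "'i \<Rightarrow> 'x::topological_space \<Rightarrow> real"
  assumes "finite A" "A \<noteq> {}" "\<And>i. i \<in> A \<Longrightarrow> continuous_on X (g i)"
  shows "continuous_on X (\<lambda>x. Max ((\<lambda>i. g i x) ` A))"
  using assms
proof (induction A rule: finite_ne_induct)
  case (insert a A)
  then have "continuous_on X (\<lambda>x. max (g a x) (Max ((\<lambda>i. g i x) ` A)))"
    by (intro continuous_on_max) auto
  then show ?case using insert by simp
qed simp

context sweeping_data
begin

lemma f_bound: "(t, x) \<in> Q \<Longrightarrow> u \<in> U \<Longrightarrow> norm (f t x u) \<le> M"
  using A2 unfolding assumption_A2_def by auto

lemma M_pos: "M > 0"
  using A2 unfolding assumption_A2_def by auto

text \<open>The slice of the ball at a fixed time is convex, so the segment from \<open>x\<close> to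
  \<open>y\<close> stays where the derivative bound holds.\<close>

lemma f_lipschitz:
  assumes "(t, x) \<in> Q" "(t, y) \<in> Q" "u \<in> U"
  shows "norm (f t x u - f t y u) \<le> M * norm (x - y)"
proof -
  have t: "t \<in> {0..T}" using assms by auto
  have "C1_on (\<lambda>x. f t x u) UNIV" using A2 t unfolding assumption_A2_def by blast
  then have "(\<lambda>x. f t x u) differentiable (at z)" for z
    unfolding C1_on_def differentiable_def by auto
  then have der: "((\<lambda>x. f t x u) has_derivative frechet_derivative (\<lambda>x. f t x u) (at z)) (at z)" for z
    using frechet_derivative_works by blast
  have conv: "convex ((\<lambda>z::'a. (t, z)) -` cball 0 r)"
  proof -
    have "(\<lambda>z::'a. (t, z)) -` cball 0 r = {z. (t, z) \<in> cball 0 r}" by auto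
    moreover have "convex {z. (t, z) \<in> cball (0 :: real \<times> 'a) r}"
    proof (rule convexI)
      fix z w and a b :: real assume "z \<in> {z. (t, z) \<in> cball (0 :: real \<times> 'a) r}" "w \<in> {z. (t, z) \<in> cball (0 :: real \<times> 'a) r}" and ab: "0 \<le> a" "0 \<le> b" "a + b = 1"
      then have "a *\<^sub>R (t, z) + b *\<^sub>R (t, w) \<in> cball (0 :: real \<times> 'a) r"
        using convexD[OF convex_cball] by blast
      moreover have "a * t + b * t = t" using ab by (simp add: distrib_right[symmetric])
      ultimately show "a *\<^sub>R z + b *\<^sub>R w \<in> {z. (t, z) \<in> cball (0 :: real \<times> 'a) r}" by simp
    qed
    ultimately show ?thesis by (simp only:)
  qed
  show ?thesis
  proof (rule differentiable_bound[OF conv])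
    show "((\<lambda>x. f t x u) has_derivative frechet_derivative (\<lambda>x. f t x u) (at z)) (at z within (\<lambda>z. (t, z)) -` cball 0 r)" for z
      using der by (rule has_derivative_at_withinI)
    show "onorm (frechet_derivative (\<lambda>x. f t x u) (at z)) \<le> M" if "z \<in> (\<lambda>z. (t, z)) -` cball 0 r" for z
      using A2 t assms(3) that unfolding assumption_A2_def by auto
  qed (use assms in auto)
qed

lemma in_C_iff: "x \<in> C t \<longleftrightarrow> (\<forall>i\<in>{1..I}. \<psi> i t x \<le> 0)"
  by (simp add: moving_set_def)

lemma C_subset_Q: "t \<in> {0..T} \<Longrightarrow> x \<in> C t \<Longrightarrow> (t, x) \<in> Q"
proof -
  assume "t \<in> {0..T}" "x \<in> C t"
  then have "(t, x) \<in> interior (cball 0 r)" using A1 unfolding assumption_A1_def by blast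
  then show ?thesis using \<open>t \<in> {0..T}\<close> interior_subset by blast
qed

text \<open>The mean value theorem yields the gradient at an intermediate point, which lies in
  \<open>Q\<close> by convexity, and the Lipschitz bound replaces it by the gradient at
  \<open>x\<close>. If the constraint is active at \<open>x\<close> and \<open>y\<close> is
  feasible, the difference of values is at most 0: feasible points leave the tangent half-space at
  most quadratically.\<close>

lemma psi_second_order:
  obtains K where "K > 0" "\<And>i t x y. i \<in> {1..I} \<Longrightarrow> (t, x) \<in> Q \<Longrightarrow> (t, y) \<in> Q \<Longrightarrow>
    gr i t x \<bullet> (y - x) \<le> \<psi> i t y - \<psi> i t x + K * (norm (y - x))\<^sup>2"
proof (rule derivative_bounded_lipschitz)
  fix K :: real assume K0: "K > 0"
    and K: "\<And>i t x t' y. i \<in> {1..I} \<Longrightarrow> (t, x) \<in> Q \<Longrightarrow> (t', y) \<in> Q \<Longrightarrow> norm (gr i t x - gr i t' y) \<le> K * norm ((t, x) - (t', y))"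
  show thesis
  proof (rule that[OF K0])
    fix i t x y assume i: "i \<in> {1..I}" and Q: "(t, x) \<in> Q" "(t, y) \<in> Q"
    have t: "t \<in> {0..T}" using Q by auto
    define \<phi> where "\<phi> s = \<psi> i t (x + s *\<^sub>R (y - x))" for s
    have der: "(\<phi> has_real_derivative gr i t (x + s *\<^sub>R (y - x)) \<bullet> (y - x)) (at s)" for s
    proof -
      have "((\<lambda>s. x + s *\<^sub>R (y - x)) has_derivative (\<lambda>s. s *\<^sub>R (y - x))) (at s)"
        by (auto intro!: derivative_eq_intros)
      from diff_chain_at[OF this psi_space_derivative[OF i t]]
      show ?thesis
        by (simp add: comp_def \<phi>_def[abs_def] has_real_derivative_iff_has_vector_derivative has_vector_derivative_def)
    qed
    obtain s where s: "0 < s" "s < 1" "\<phi> 1 - \<phi> 0 = (1 - 0) * (gr i t (x + s *\<^sub>R (y - x)) \<bullet> (y - x))"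
      using MVT2[of 0 1 \<phi>, OF zero_less_one der] by blast
    define z where "z = x + s *\<^sub>R (y - x)"
    have "(1 - s) *\<^sub>R (t, x) + s *\<^sub>R (t, y) \<in> Q"
      using convexD[OF Q_convex Q, of "1 - s" s] s by simp
    moreover have "(1 - s) *\<^sub>R (t, x) + s *\<^sub>R (t, y) = (t, z)" by (simp add: z_def algebra_simps)
    ultimately have zQ: "(t, z) \<in> Q" by simp
    have "norm (gr i t x - gr i t z) \<le> K * norm (x - z)"
      using K[OF i Q(1) zQ] by (simp add: norm_Pair)
    also have "norm (x - z) = s * norm (y - x)" using s by (simp add: z_def)
    also have "K * (s * norm (y - x)) \<le> K * (1 * norm (y - x))"
      using K0 s by (intro mult_left_mono mult_right_mono) auto
    finally have n: "norm (gr i t x - gr i t z) \<le> K * norm (y - x)" by simp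
    have "gr i t x \<bullet> (y - x) - gr i t z \<bullet> (y - x) = (gr i t x - gr i t z) \<bullet> (y - x)"
      by (simp add: inner_diff_left)
    also have "\<dots> \<le> norm (gr i t x - gr i t z) * norm (y - x)" by (rule norm_cauchy_schwarz)
    also have "\<dots> \<le> K * norm (y - x) * norm (y - x)" using n by (rule mult_right_mono) simp
    finally show "gr i t x \<bullet> (y - x) \<le> \<psi> i t y - \<psi> i t x + K * (norm (y - x))\<^sup>2"
      using s(3) by (simp add: \<phi>_def z_def power2_eq_square mult.assoc)
  qed
qed

lemma psi_along_ray:
  assumes "i \<in> {1..I}" "t \<in> {0..T}"
  shows "((\<lambda>h. \<psi> i t (x + h *\<^sub>R q)) has_real_derivative gr i t x \<bullet> q) (at_right 0)"
proof -
  have 1: "((\<lambda>h. x + h *\<^sub>R q) has_derivative (\<lambda>h. h *\<^sub>R q)) (at_right 0)"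
    by (auto intro!: derivative_eq_intros)
  have 2: "(\<psi> i t has_derivative (\<lambda>h. gr i t x \<bullet> h)) (at (x + 0 *\<^sub>R q) within (\<lambda>h. x + h *\<^sub>R q) ` {0<..})"
    using has_derivative_at_withinI[OF psi_space_derivative[OF assms]] by simp
  show ?thesis using diff_chain_within[OF 1 2]
    by (simp add: comp_def has_real_derivative_iff_has_vector_derivative has_vector_derivative_def)
qed

text \<open>Where the value equals \<open>m\<close> the derivative decides; where it is strictly
  smaller, continuity suffices whatever the slope \<open>c\<close>.\<close>

lemma ray_eventually_less:
  assumes it: "i \<in> {1..I}" "t \<in> {0..T}" and le: "\<psi> i t x \<le> m"
    and der: "\<psi> i t x = m \<Longrightarrow> gr i t x \<bullet> q < c"
  shows "\<forall>\<^sub>F h in at_right 0. \<psi> i t (x + h *\<^sub>R q) < m + c * h"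
proof (cases "\<psi> i t x = m")
  case True
  then show ?thesis using eventually_less_of_derivative[OF psi_along_ray[OF it] der] by simp
next
  case False
  have "((\<lambda>h. \<psi> i t (x + h *\<^sub>R q) - c * h) \<longlongrightarrow> \<psi> i t (x + 0 *\<^sub>R q) - c * 0) (at_right 0)"
  proof (intro tendsto_intros)
    have "continuous (at_right 0) (\<lambda>h. \<psi> i t (x + h *\<^sub>R q))"
      using has_field_derivative_imp_has_derivative[OF psi_along_ray[OF it]] has_derivative_continuous by blast
    then show "((\<lambda>h. \<psi> i t (x + h *\<^sub>R q)) \<longlongrightarrow> \<psi> i t (x + 0 *\<^sub>R q)) (at_right 0)"
      by (simp add: continuous_within)
  qed
  then have "\<forall>\<^sub>F h in at_right 0. \<psi> i t (x + h *\<^sub>R q) - c * h < m"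
    by (rule order_tendstoD) (use False le in simp)
  then show ?thesis by eventually_elim simp
qed

text \<open>A minimizer \<open>y\<close> of \<open>max \<psi> + (2 \<delta> / \<epsilon>) norm (y - x)\<close> over the \<open>\<epsilon>\<close>-ball would be interior if the ball
  missed \<open>C t\<close>; there the sum of the normalized gradients of the maximal constraints is a direction
  of faster descent.\<close>

lemma sublevel_near_C:
  assumes t: "t \<in> {0..T}" and \<delta>: "\<delta> > 0" "\<delta> \<le> \<beta>" and \<epsilon>: "\<epsilon> > 0" "2 * \<delta> * real I < \<epsilon> * \<eta>"
    and x: "\<And>i. i \<in> {1..I} \<Longrightarrow> \<psi> i t x \<le> \<delta>"
  shows "\<exists>c\<in>C t. norm (x - c) \<le> \<epsilon>"
proof (rule ccontr)
  assume neg: "\<not> ?thesis"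
  have out: "\<exists>i\<in>{1..I}. \<psi> i t y > 0" if "y \<in> cball x \<epsilon>" for y
    
  proof -
    have "y \<notin> C t" using neg that by (auto simp: dist_norm)
    then show ?thesis by (auto simp: in_C_iff not_le)
  qed
  have ne: "{1..I} \<noteq> {}" using out[of x] \<epsilon> by auto
  define m where "m y = Max ((\<lambda>i. \<psi> i t y) ` {1..I})" for y
  have m_ge: "\<psi> i t y \<le> m y" if "i \<in> {1..I}" for i y using that by (simp add: m_def)
  have m_lt: "m y < a \<longleftrightarrow> (\<forall>i\<in>{1..I}. \<psi> i t y < a)" for y a using ne by (simp add: m_def)
  have m_le: "m y \<le> a \<longleftrightarrow> (\<forall>i\<in>{1..I}. \<psi> i t y \<le> a)" for y a using ne by (simp add: m_def)
  \<comment> \<open>The factor 2 keeps the minimizer within \<open>\<epsilon> / 2\<close> of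
    \<open>x\<close>, hence interior. The smallness of \<open>\<delta>\<close> makes
    \<open>k * real I\<close>, which bounds the growth rate of the distance term, smaller than the
    descent rate \<open>\<eta>\<close>.\<close>
  define k where "k = 2 * \<delta> / \<epsilon>"
  have k0: "k > 0" using \<delta> \<epsilon> by (simp add: k_def)
  have kI: "k * real I < \<eta>" using \<epsilon> by (simp add: k_def pos_divide_less_eq mult.commute)
  have cont: "continuous_on (cball x \<epsilon>) (\<lambda>y. m y + k * norm (y - x))"
    unfolding m_def
  proof (intro continuous_intros continuous_on_Max_image)
    fix i assume "i \<in> {1..I}"
    then show "continuous_on (cball x \<epsilon>) (\<psi> i t)"
      using psi_space_derivative t by (intro has_derivative_continuous_on[where f'="\<lambda>x h. gr i t x \<bullet> h"]) (blast intro: has_derivative_at_withinI)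
  qed (use ne in auto)
  have "cball x \<epsilon> \<noteq> {}" using \<epsilon>(1) by simp
  from continuous_attains_inf[OF compact_cball this cont]
  obtain y where y: "y \<in> cball x \<epsilon>" and ymin: "\<And>z. z \<in> cball x \<epsilon> \<Longrightarrow> m y + k * norm (y - x) \<le> m z + k * norm (z - x)"
    by blast
  have "m x \<le> \<delta>" using x by (simp add: m_le)
  then have 1: "m y + k * norm (y - x) \<le> \<delta>" using ymin[of x] \<epsilon> by simp
  have my: "m y > 0" using out[OF y] m_ge by (meson less_le_trans)
  have my\<beta>: "m y \<le> \<beta>" 
  proof -
    have "k * norm (y - x) \<ge> 0" using k0 by simp
    then show ?thesis using 1 \<delta> by linarith
  qed
  have "k * norm (y - x) < \<delta>" using 1 my by linarith
  then have yin: "norm (y - x) < \<epsilon>" using \<delta> \<epsilon> by (simp add: k_def field_simps)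
  define A where "A = {i\<in>{1..I}. \<psi> i t y = m y}"
  have A: "A \<subseteq> {1..I}" "finite A" by (auto simp: A_def)
  have big: "norm (gr i t y) > \<eta>" if "i \<in> A" for i
    using that my my\<beta> beta_pos by (intro grad_gt[OF t]) (auto simp: A_def)
  \<comment> \<open>After normalization the norm is at most \<open>real I\<close>, while along
    \<open>- e\<close> every maximal constraint still falls at a rate above
    \<open>\<eta>\<close>.\<close>
  define e where "e = (\<Sum>j\<in>A. (1 / norm (gr j t y)) *\<^sub>R gr j t y)"
  have ne: "norm e \<le> real I"
  proof -
    have "norm e \<le> (\<Sum>j\<in>A. norm ((1 / norm (gr j t y)) *\<^sub>R gr j t y))" unfolding e_def by (rule norm_sum)
    also have "\<dots> \<le> (\<Sum>j\<in>A. 1)" by (rule sum_mono) simp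
    also have "\<dots> \<le> real I" using card_mono[OF _ A(1)] by simp
    finally show ?thesis .
  qed
  have dir: "gr i t y \<bullet> (- e) < - \<eta>" if i: "i \<in> A" for i
  proof -
    have "gr i t y \<bullet> e \<ge> 1 / norm (gr i t y) * (norm (gr i t y))\<^sup>2"
      unfolding e_def by (rule grad_inner_sum_ge[OF t A(1) i]) (use my\<beta> in \<open>auto simp: A_def\<close>)
    moreover have "norm (gr i t y) > 0" using big[OF i] eta_pos by linarith
    ultimately show ?thesis using big[OF i] by (simp add: power2_eq_square)
  qed
  have "\<forall>\<^sub>F h in at_right 0. \<forall>i\<in>{1..I}. \<psi> i t (y + h *\<^sub>R (- e)) < m y + (- \<eta>) * h"
  proof (intro eventually_ball_finite ballI)
    fix i assume "i \<in> {1..I}"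
    then show "\<forall>\<^sub>F h in at_right 0. \<psi> i t (y + h *\<^sub>R (- e)) < m y + (- \<eta>) * h"
      using dir m_ge by (intro ray_eventually_less[OF _ t]) (auto simp: A_def)
  qed simp
  moreover have "\<forall>\<^sub>F h in at_right 0. y + h *\<^sub>R (- e) \<in> ball x \<epsilon>"
  proof -
    have "((\<lambda>h. y + h *\<^sub>R (- e)) \<longlongrightarrow> y + 0 *\<^sub>R (- e)) (at_right 0)" by (intro tendsto_intros)
    then show ?thesis using yin by (intro topological_tendstoD) (auto simp: dist_norm norm_minus_commute)
  qed
  moreover have "\<forall>\<^sub>F h in at_right (0::real). h > 0" by (rule eventually_at_right_less)
  ultimately have "\<forall>\<^sub>F h in at_right (0::real). False"
  proof eventually_elim
    case (elim h)
    have "m y + k * norm (y - x) \<le> m (y + h *\<^sub>R (- e)) + k * norm (y + h *\<^sub>R (- e) - x)"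
      by (rule ymin) (use elim in auto)
    moreover have "m (y + h *\<^sub>R (- e)) < m y - \<eta> * h" using elim(1) by (simp add: m_lt)
    moreover have "k * norm (y + h *\<^sub>R (- e) - x) \<le> k * (norm (y - x) + h * real I)"
    proof (rule mult_left_mono)
      have "norm (y + h *\<^sub>R (- e) - x) \<le> norm (y - x) + norm (h *\<^sub>R e)"
        using norm_triangle_ineq4[of "y - x" "h *\<^sub>R e"] by (simp add: algebra_simps)
      also have "norm (h *\<^sub>R e) \<le> h * real I" using elim(3) ne by (simp add: mult_left_mono)
      finally show "norm (y + h *\<^sub>R (- e) - x) \<le> norm (y - x) + h * real I" by simp
    qed (use k0 in simp)
    moreover have "(k * real I) * h < \<eta> * h" using kI elim(3) by (rule mult_strict_right_mono)
    ultimately show False by (simp add: algebra_simps)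
  qed
  then show False by simp
qed

text \<open>Below level \<open>\<delta>\<close> both local hypotheses are in force: the bounds on
  \<open>Q\<close> and, because of the distance at most 1 to \<open>C t\<close>, the bound by
  \<open>\<mu>\<close>. The compact graph keeps a positive distance from the outside of the ball,
  and points of low level are close to \<open>C t\<close>.\<close>

lemma sublevel_subset:
  obtains \<delta> where "\<delta> > 0" "\<delta> \<le> \<beta>"
    "\<And>t x. t \<in> {0..T} \<Longrightarrow> (\<And>i. i \<in> {1..I} \<Longrightarrow> \<psi> i t x \<le> \<delta>) \<Longrightarrow>
       (t, x) \<in> Q \<and> (\<exists>c\<in>C t. norm (x - c) \<le> 1)"
proof -
  let ?G = "Sigma {0..T} C"
  have cG: "compact ?G" and sG: "?G \<subseteq> interior (cball 0 r)" using A1 by (auto simp: assumption_A1_def)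
  obtain \<epsilon>0 where \<epsilon>0: "\<epsilon>0 > 0" "(\<Union>z\<in>?G. ball z \<epsilon>0) \<subseteq> interior (cball 0 r)"
  proof (cases "?G = {}")
    case True then show ?thesis using that[of 1] by simp
  next
    case False
    obtain e where e: "e > 0" "\<And>z. z \<in> ?G \<Longrightarrow> ball z e \<subseteq> interior (cball 0 r)"
      using Heine_Borel_lemma[OF cG, of "{interior (cball 0 r)}"] sG by auto
    then show ?thesis using that[of e] by blast
  qed
  define \<epsilon> where "\<epsilon> = min 1 (\<epsilon>0 / 2)"
  have \<epsilon>: "\<epsilon> > 0" "\<epsilon> \<le> 1" "\<epsilon> < \<epsilon>0" using \<epsilon>0 by (auto simp: \<epsilon>_def)
  \<comment> \<open>The denominator \<open>4 * real I + 1\<close> is positive for every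
    \<open>I\<close> and yields the strict inequality that \<open>sublevel_near_C\<close> asks
    for.\<close>
  define \<delta> where "\<delta> = min \<beta> (\<epsilon> * \<eta> / (4 * real I + 1))"
  have \<delta>: "\<delta> > 0" "\<delta> \<le> \<beta>" using \<epsilon> beta_pos eta_pos by (auto simp: \<delta>_def add_nonneg_pos)
  have "\<delta> * (4 * real I + 1) \<le> \<epsilon> * \<eta>"
    using \<delta>_def by (simp add: min_le_iff_disj pos_le_divide_eq[symmetric] add_nonneg_pos)
  moreover have "2 * \<delta> * real I < \<delta> * (4 * real I + 1)"
  proof -
    have "\<delta> * real I \<ge> 0" using \<delta> by simp
    then show ?thesis using \<delta> unfolding distrib_left by linarith
  qed
  ultimately have small: "2 * \<delta> * real I < \<epsilon> * \<eta>" by linarith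
  show thesis
  proof (rule that[OF \<delta>])
    fix t x assume t: "t \<in> {0..T}" and x: "\<And>i. i \<in> {1..I} \<Longrightarrow> \<psi> i t x \<le> \<delta>"
    obtain c where c: "c \<in> C t" "norm (x - c) \<le> \<epsilon>"
      using sublevel_near_C[OF t \<delta> \<epsilon>(1) small x] by blast
    have "(t, x) \<in> ball (t, c) \<epsilon>0" using c \<epsilon> by (simp add: dist_norm norm_Pair norm_minus_commute)
    moreover have "(t, c) \<in> ?G" using c t by simp
    ultimately have "(t, x) \<in> interior (cball 0 r)" using \<epsilon>0(2) by blast
    then have "(t, x) \<in> cball 0 r" using interior_subset by blast
    then show "(t, x) \<in> Q \<and> (\<exists>c\<in>C t. norm (x - c) \<le> 1)"
      using t c \<epsilon> by (intro conjI bexI[of _ c]) auto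
  qed
qed

section \<open>Inward directions and proximal normals\<close>

definition "active t x = {i\<in>{1..I}. \<psi> i t x = 0}"
text \<open>The sum is an ascent direction of every active constraint; it is its negative that
  points into \<open>C t\<close>, uniformly by \<open>inward_inner_ge\<close>.\<close>

definition "inward t x = (\<Sum>i\<in>active t x. gr i t x)"

lemma inward_inner_ge:
  assumes "t \<in> {0..T}" "i \<in> active t x"
  shows "gr i t x \<bullet> inward t x \<ge> \<eta>\<^sup>2"
proof -
  have "gr i t x \<bullet> (\<Sum>j\<in>active t x. 1 *\<^sub>R gr j t x) \<ge> 1 * (norm (gr i t x))\<^sup>2"
    by (rule grad_inner_sum_ge[OF assms(1) _ assms(2)]) (use beta_pos in \<open>auto simp: active_def\<close>)
  moreover have "norm (gr i t x) > \<eta>" using assms beta_pos by (intro grad_gt) (auto simp: active_def)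
  then have "(norm (gr i t x))\<^sup>2 \<ge> \<eta>\<^sup>2" using eta_pos by (intro power_mono) auto
  ultimately show ?thesis by (simp add: inward_def)
qed

lemma inward_norm_le:
  assumes G: "G > 0" "\<And>i t x. i \<in> {1..I} \<Longrightarrow> (t, x) \<in> Q \<Longrightarrow> norm (gr i t x) \<le> G" and tx: "(t, x) \<in> Q"
  shows "norm (inward t x) \<le> real I * G"
proof -
  have "norm (inward t x) \<le> (\<Sum>i\<in>active t x. norm (gr i t x))" unfolding inward_def by (rule norm_sum)
  also have "\<dots> \<le> (\<Sum>i\<in>active t x. G)" using G tx by (intro sum_mono) (auto simp: active_def)
  also have "\<dots> = real (card (active t x)) * G" by simp
  also have "\<dots> \<le> real I * G"
  proof (rule mult_right_mono)
    have "card (active t x) \<le> card {1..I}" by (rule card_mono) (auto simp: active_def)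
    then show "real (card (active t x)) \<le> real I" by simp
  qed (use G in simp)
  finally show ?thesis .
qed

lemma ray_eventually_interior:
  assumes t: "t \<in> {0..T}" and x: "x \<in> C t" and q: "\<And>i. i \<in> active t x \<Longrightarrow> gr i t x \<bullet> q < 0"
  shows "\<forall>\<^sub>F h in at_right 0. \<forall>i\<in>{1..I}. \<psi> i t (x + h *\<^sub>R q) < 0"
proof (intro eventually_ball_finite ballI)
  fix i assume i: "i \<in> {1..I}"
  have "\<forall>\<^sub>F h in at_right 0. \<psi> i t (x + h *\<^sub>R q) < 0 + 0 * h"
    using i x q by (intro ray_eventually_less[OF i t]) (auto simp: in_C_iff active_def)
  then show "\<forall>\<^sub>F h in at_right 0. \<psi> i t (x + h *\<^sub>R q) < 0" by simp
qed simp

text \<open>Tilting the segment from \<open>x\<close> to \<open>y\<close> at \<open>x\<close> against \<open>inward t x\<close>, by an angle of order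
  \<open>norm (y - x)\<close>, gives a ray that starts inside \<open>C t\<close>; a normal makes no acute angle with it.\<close>

lemma frechet_normal_prox:
  obtains c where "c > 0" "\<And>t x y v. t \<in> {0..T} \<Longrightarrow> y \<in> C t \<Longrightarrow> v \<in> frechet_normal_cone (C t) x \<Longrightarrow>
    v \<bullet> (y - x) \<le> c * norm v * (norm (y - x))\<^sup>2"
proof -
  obtain K where K: "K > 0" "\<And>i t x y. i \<in> {1..I} \<Longrightarrow> (t, x) \<in> Q \<Longrightarrow> (t, y) \<in> Q \<Longrightarrow>
    gr i t x \<bullet> (y - x) \<le> \<psi> i t y - \<psi> i t x + K * (norm (y - x))\<^sup>2"
    by (rule psi_second_order) blast
  obtain G where G: "G > 0" "\<And>i t x. i \<in> {1..I} \<Longrightarrow> (t, x) \<in> Q \<Longrightarrow> norm (gr i t x) \<le> G"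
    by (rule gr_bounded) blast
  \<comment> \<open>Chosen so that the tilt lowers the linearization of each active constraint by at
    least \<open>2 * K * d\<close>, twice the curvature error \<open>K * d\<close>.\<close>
  define \<kappa> where "\<kappa> = 2 * K / \<eta>\<^sup>2"
  have \<kappa>: "\<kappa> > 0" "\<kappa> * \<eta>\<^sup>2 = 2 * K" using K eta_pos by (auto simp: \<kappa>_def)
  show thesis
  proof (rule that[of "\<kappa> * (real I * G) + 1"])
    show "0 < \<kappa> * (real I * G) + 1" using \<kappa> G by (simp add: add_nonneg_pos)
    fix t x y v assume t: "t \<in> {0..T}" and y: "y \<in> C t" and v: "v \<in> frechet_normal_cone (C t) x"
    have x: "x \<in> C t" using v by (simp add: frechet_normal_cone_def)
    note xQ = C_subset_Q[OF t x] and yQ = C_subset_Q[OF t y]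
    show "v \<bullet> (y - x) \<le> (\<kappa> * (real I * G) + 1) * norm v * (norm (y - x))\<^sup>2"
    proof (cases "y = x")
      case False
      define d where "d = (norm (y - x))\<^sup>2"
      have d: "d > 0" using False by (simp add: d_def)
      define q where "q = y - x - (\<kappa> * d) *\<^sub>R inward t x"
      have neg: "gr i t x \<bullet> q < 0" if i: "i \<in> active t x" for i
      proof -
        have "gr i t x \<bullet> (y - x) \<le> \<psi> i t y - \<psi> i t x + K * d"
          unfolding d_def by (rule K(2)) (use i xQ yQ in \<open>auto simp: active_def\<close>)
        also have "\<dots> \<le> K * d" using i y by (auto simp: active_def in_C_iff)
        finally have 1: "gr i t x \<bullet> (y - x) \<le> K * d" .
        have "(\<kappa> * d) * \<eta>\<^sup>2 \<le> (\<kappa> * d) * (gr i t x \<bullet> inward t x)"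
          using inward_inner_ge[OF t i] \<kappa> d by (intro mult_left_mono) auto
        moreover have "(\<kappa> * d) * \<eta>\<^sup>2 = 2 * (K * d)" using \<kappa>(2) by (metis mult.assoc mult.commute)
        moreover have "K * d > 0" using K d by simp
        ultimately show ?thesis using 1 by (simp add: q_def inner_diff_right)
      qed
      have "\<forall>\<^sub>F h in at_right 0. \<forall>i\<in>{1..I}. \<psi> i t (x + h *\<^sub>R q) < 0"
        by (rule ray_eventually_interior[OF t x]) (rule neg)
      then have ev: "\<forall>\<^sub>F h in at_right 0. x + h *\<^sub>R q \<in> C t"
        by eventually_elim (auto simp: in_C_iff less_imp_le)
      \<comment> \<open>The definition of a Frechet normal is tested along the ray; dividing by
        \<open>h\<close> leaves an inequality in \<open>q\<close> alone.\<close>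
      have "v \<bullet> q \<le> \<epsilon> * norm q" if \<epsilon>: "\<epsilon> > 0" for \<epsilon>
      proof -
        obtain \<delta> where \<delta>: "\<delta> > 0" "\<And>y. y \<in> C t \<Longrightarrow> norm (y - x) < \<delta> \<Longrightarrow> v \<bullet> (y - x) \<le> \<epsilon> * norm (y - x)"
          using v \<epsilon> unfolding frechet_normal_cone_def by blast
        have "((\<lambda>h. x + h *\<^sub>R q) \<longlongrightarrow> x + 0 *\<^sub>R q) (at_right 0)" by (intro tendsto_intros)
        then have "\<forall>\<^sub>F h in at_right 0. dist (x + h *\<^sub>R q) (x + 0 *\<^sub>R q) < \<delta>" using \<delta>(1) by (rule tendstoD)
        moreover have "\<forall>\<^sub>F h in at_right (0::real). h > 0" by (rule eventually_at_right_less)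
        ultimately have "\<forall>\<^sub>F h in at_right (0::real). v \<bullet> q \<le> \<epsilon> * norm q" using ev
        proof eventually_elim
          case (elim h)
          have "v \<bullet> ((x + h *\<^sub>R q) - x) \<le> \<epsilon> * norm ((x + h *\<^sub>R q) - x)"
            using elim by (intro \<delta>(2)) (auto simp: dist_norm)
          then have "h * (v \<bullet> q) \<le> h * (\<epsilon> * norm q)" using elim(2) by (simp add: mult_ac)
          then show ?case using elim(2) by simp
        qed
        then show ?thesis by simp
      qed
      note le = this
      have "v \<bullet> q \<le> 0"
      proof (rule field_le_epsilon)
        fix e :: real assume e: "e > 0"
        then have e': "e / (norm q + 1) > 0" by (simp add: add_nonneg_pos)
        have "v \<bullet> q \<le> e / (norm q + 1) * norm q" by (rule le[OF e'])
        also have "\<dots> \<le> e / (norm q + 1) * (norm q + 1)" using e' by (intro mult_left_mono) auto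
        also have "\<dots> = e" using norm_ge_zero[of q] by (simp add: add_nonneg_eq_0_iff)
        finally show "v \<bullet> q \<le> 0 + e" by simp
      qed
      then have "v \<bullet> (y - x) \<le> (\<kappa> * d) * (v \<bullet> inward t x)" by (simp add: q_def inner_diff_right)
      also have "\<dots> \<le> (\<kappa> * d) * (norm v * (real I * G))"
      proof (rule mult_left_mono)
        have "v \<bullet> inward t x \<le> norm v * norm (inward t x)" by (rule norm_cauchy_schwarz)
        also have "\<dots> \<le> norm v * (real I * G)" by (intro mult_left_mono inward_norm_le[OF G xQ]) auto
        finally show "v \<bullet> inward t x \<le> norm v * (real I * G)" .
      qed (use \<kappa> d in simp)
      also have "\<dots> = (\<kappa> * (real I * G)) * norm v * d" by (simp add: mult_ac)
      also have "\<dots> \<le> (\<kappa> * (real I * G) + 1) * norm v * d"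
        using d by (intro mult_right_mono) auto
      finally show ?thesis by (simp add: d_def)
    qed simp
  qed
qed

text \<open>\<open>c\<close> does not depend on the base point, so the quadratic inequality survives
  the passage to the limit in base points and normals, with \<open>y\<close> fixed.\<close>

lemma limiting_normal_prox:
  obtains c where "c > 0" "\<And>t x y v. t \<in> {0..T} \<Longrightarrow> y \<in> C t \<Longrightarrow> v \<in> limiting_normal_cone (C t) x \<Longrightarrow>
    v \<bullet> (y - x) \<le> c * norm v * (norm (y - x))\<^sup>2"
proof (rule frechet_normal_prox)
  fix c :: real assume c: "c > 0"
    and prox: "\<And>t x y v. t \<in> {0..T} \<Longrightarrow> y \<in> C t \<Longrightarrow> v \<in> frechet_normal_cone (C t) x \<Longrightarrow>
      v \<bullet> (y - x) \<le> c * norm v * (norm (y - x))\<^sup>2"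
  show thesis
  proof (rule that[OF c])
    fix t x y v assume t: "t \<in> {0..T}" and y: "y \<in> C t" and v: "v \<in> limiting_normal_cone (C t) x"
    obtain p w where pw: "\<And>j::nat. w j \<in> frechet_normal_cone (C t) (p j)" "p \<longlonglongrightarrow> x" "w \<longlonglongrightarrow> v"
      using v unfolding limiting_normal_cone_def by blast
    show "v \<bullet> (y - x) \<le> c * norm v * (norm (y - x))\<^sup>2"
    proof (rule LIMSEQ_le)
      show "(\<lambda>j. w j \<bullet> (y - p j)) \<longlonglongrightarrow> v \<bullet> (y - x)" using pw by (intro tendsto_intros)
      show "(\<lambda>j. c * norm (w j) * (norm (y - p j))\<^sup>2) \<longlonglongrightarrow> c * norm v * (norm (y - x))\<^sup>2"
        using pw by (intro tendsto_intros)
      show "\<exists>N. \<forall>j\<ge>N. w j \<bullet> (y - p j) \<le> c * norm (w j) * (norm (y - p j))\<^sup>2"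
        using prox[OF t y pw(1)] by blast
    qed
  qed
qed

end

lemma frechet_normal_imp_limiting:
  assumes "v \<in> frechet_normal_cone X x"
  shows "v \<in> limiting_normal_cone X x"
proof -
  have "x \<in> X" using assms by (simp add: frechet_normal_cone_def)
  have "(\<forall>j::nat. x \<in> X \<and> v \<in> frechet_normal_cone X x) \<and> (\<lambda>j. x) \<longlonglongrightarrow> x \<and> (\<lambda>j. v) \<longlonglongrightarrow> v"
    using assms \<open>x \<in> X\<close> by simp
  then show ?thesis unfolding limiting_normal_cone_def using \<open>x \<in> X\<close> by (intro CollectI conjI exI[of _ "\<lambda>j. x"] exI[of _ "\<lambda>j. v"]) auto
qed

text \<open>Converse of the proximal inequality: a quadratic bound with any factor is below
  \<open>\<epsilon> * norm (y - x)\<close> near \<open>x\<close>, so \<open>v\<close> is already a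
  Frechet normal.\<close>

lemma limiting_normal_if_quadratic:
  assumes x: "x \<in> X" and b: "b \<ge> 0" and quad: "\<And>y. y \<in> X \<Longrightarrow> v \<bullet> (y - x) \<le> b * (norm (y - x))\<^sup>2"
  shows "v \<in> limiting_normal_cone X x"
proof (rule frechet_normal_imp_limiting)
  show "v \<in> frechet_normal_cone X x"
    unfolding frechet_normal_cone_def
  proof (intro CollectI conjI x allI impI)
    fix \<epsilon> :: real assume \<epsilon>: "\<epsilon> > 0"
    show "\<exists>\<delta>>0. \<forall>y\<in>X. norm (y - x) < \<delta> \<longrightarrow> v \<bullet> (y - x) \<le> \<epsilon> * norm (y - x)"
    proof (intro exI[of _ "\<epsilon> / (b + 1)"] conjI ballI impI)
      show "\<epsilon> / (b + 1) > 0" using \<epsilon> b by simp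
      fix y assume y: "y \<in> X" and n: "norm (y - x) < \<epsilon> / (b + 1)"
      have "norm (y - x) * (b + 1) < \<epsilon>" using n b by (simp add: pos_less_divide_eq)
      then have "b * norm (y - x) \<le> \<epsilon>" using norm_ge_zero[of "y - x"] unfolding distrib_left mult_1_right by (simp only: mult.commute[of b])
      then have "b * norm (y - x) * norm (y - x) \<le> \<epsilon> * norm (y - x)" by (rule mult_right_mono) simp
      then show "v \<bullet> (y - x) \<le> \<epsilon> * norm (y - x)"
        using quad[OF y] by (simp add: power2_eq_square mult.assoc)
    qed
  qed
qed

lemma limiting_normal_cone_memD: "v \<in> limiting_normal_cone X x \<Longrightarrow> x \<in> X"
  by (simp add: limiting_normal_cone_def)

context sweeping_data
begin

text \<open>Each active gradient satisfies a quadratic inequality by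
  \<open>psi_second_order\<close>, and nonnegative weights preserve it. Only this inclusion of cones
  is established; what is used about arbitrary normals comes from
  \<open>limiting_normal_prox\<close>.\<close>

lemma active_gradients_normal:
  assumes t: "t \<in> {0..T}" and x: "x \<in> C t" and l: "\<And>i. i \<in> {1..I} \<Longrightarrow> l i \<ge> 0"
    "\<And>i. i \<in> {1..I} \<Longrightarrow> \<psi> i t x < 0 \<Longrightarrow> l i = 0"
  shows "(\<Sum>i=1..I. l i *\<^sub>R gr i t x) \<in> limiting_normal_cone (C t) x"
proof (rule psi_second_order)
  fix K :: real assume K0: "K > 0" and K: "\<And>i t x y. i \<in> {1..I} \<Longrightarrow> (t, x) \<in> Q \<Longrightarrow> (t, y) \<in> Q \<Longrightarrow>
    gr i t x \<bullet> (y - x) \<le> \<psi> i t y - \<psi> i t x + K * (norm (y - x))\<^sup>2"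
  show ?thesis
  proof (rule limiting_normal_if_quadratic[OF x])
    show "(\<Sum>i=1..I. l i) * K \<ge> 0" using K0 l by (intro mult_nonneg_nonneg sum_nonneg) auto
    fix y assume y: "y \<in> C t"
    have "(\<Sum>i=1..I. l i *\<^sub>R gr i t x) \<bullet> (y - x) = (\<Sum>i=1..I. l i * (gr i t x \<bullet> (y - x)))"
      by (simp add: inner_sum_left)
    also have "\<dots> \<le> (\<Sum>i=1..I. l i * (K * (norm (y - x))\<^sup>2))"
    proof (rule sum_mono)
      fix i assume i: "i \<in> {1..I}"
      show "l i * (gr i t x \<bullet> (y - x)) \<le> l i * (K * (norm (y - x))\<^sup>2)"
      proof (cases "\<psi> i t x < 0")
        case True then show ?thesis using l(2)[OF i] by simp
      next
        case False
        then have "\<psi> i t y - \<psi> i t x \<le> 0" using i y in_C_iff[of y t] by fastforce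
        then have "gr i t x \<bullet> (y - x) \<le> K * (norm (y - x))\<^sup>2"
          using K[OF i C_subset_Q[OF t x] C_subset_Q[OF t y]] by linarith
        then show ?thesis using l(1)[OF i] by (rule mult_left_mono)
      qed
    qed
    also have "\<dots> = (\<Sum>i=1..I. l i) * K * (norm (y - x))\<^sup>2" by (simp add: sum_distrib_right mult.assoc)
    finally show "(\<Sum>i=1..I. l i *\<^sub>R gr i t x) \<bullet> (y - x) \<le> (\<Sum>i=1..I. l i) * K * (norm (y - x))\<^sup>2" .
  qed
qed

text \<open>A small step along \<open>- inward t x\<close> makes every constraint negative. Strictly
  feasible points stay feasible at nearby times, which is how limits in time are handled.\<close>

lemma strictly_feasible_near:
  assumes t: "t \<in> {0..T}" and x: "x \<in> C t" and e: "e > 0"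
  obtains y where "norm (y - x) < e" "\<And>i. i \<in> {1..I} \<Longrightarrow> \<psi> i t y < 0"
proof -
  have "gr i t x \<bullet> (- inward t x) < 0" if "i \<in> active t x" for i
    using inward_inner_ge[OF t that] zero_less_power[OF eta_pos, of 2] by (simp only: inner_minus_right)
  from ray_eventually_interior[OF t x this]
  have "\<forall>\<^sub>F h in at_right 0. \<forall>i\<in>{1..I}. \<psi> i t (x + h *\<^sub>R (- inward t x)) < 0" by simp
  moreover have "((\<lambda>h. x + h *\<^sub>R (- inward t x)) \<longlongrightarrow> x + 0 *\<^sub>R (- inward t x)) (at_right 0)" by (intro tendsto_intros)
  then have "\<forall>\<^sub>F h in at_right 0. dist (x + h *\<^sub>R (- inward t x)) (x + 0 *\<^sub>R (- inward t x)) < e" using e by (rule tendstoD)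
  ultimately have "\<forall>\<^sub>F h in at_right (0::real). \<exists>y. norm (y - x) < e \<and> (\<forall>i\<in>{1..I}. \<psi> i t y < 0)"
  proof eventually_elim
    case (elim h)
    then show ?case by (intro exI[of _ "x + h *\<^sub>R (- inward t x)"]) (auto simp: dist_norm)
  qed
  then have "\<exists>y. norm (y - x) < e \<and> (\<forall>i\<in>{1..I}. \<psi> i t y < 0)" by simp
  then show thesis using that by blast
qed

lemma closed_graph_C: "closed (Sigma {0..T} C)"
  using A1 unfolding assumption_A1_def by (blast intro: compact_imp_closed)

lemma psi_tendsto:
  assumes "i \<in> {1..I}" "\<And>n. t n \<in> {0..T}" "t \<longlonglongrightarrow> t'" "x \<longlonglongrightarrow> x'"
  shows "(\<lambda>n. \<psi> i (t n) (x n)) \<longlonglongrightarrow> \<psi> i t' x'"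
proof -
  have t': "t' \<in> {0..T}" by (rule closed_sequentially[OF _ _ assms(3)]) (use assms(2) in auto)
  have "(\<lambda>n. (\<lambda>(t, x). \<psi> i t x) (t n, x n)) \<longlonglongrightarrow> (\<lambda>(t, x). \<psi> i t x) (t', x')"
    by (rule continuous_on_tendsto_compose[OF continuous_on_psi[OF assms(1)]])
      (use assms t' in \<open>auto intro: tendsto_Pair\<close>)
  then show ?thesis by simp
qed

text \<open>Time varies too, so a point feasible at \<open>t'\<close> need not be feasible at
  \<open>t n\<close>. The proximal inequality is therefore passed to the limit at strictly feasible
  points, which are feasible for large \<open>n\<close>, then extended to all feasible points by
  density, and finally converted back into normality.\<close>

lemma normal_cone_closed_graph:
  assumes t: "\<And>n. t n \<in> {0..T}" "t \<longlonglongrightarrow> t'" and p: "p \<longlonglongrightarrow> p'" and v: "v \<longlonglongrightarrow> v'"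
    and mem: "\<And>n. v n \<in> limiting_normal_cone (C (t n)) (p n)"
  shows "v' \<in> limiting_normal_cone (C t') p'"
proof (rule limiting_normal_prox)
  fix c :: real assume c: "c > 0"
    and prox: "\<And>t x y v. t \<in> {0..T} \<Longrightarrow> y \<in> C t \<Longrightarrow> v \<in> limiting_normal_cone (C t) x \<Longrightarrow>
      v \<bullet> (y - x) \<le> c * norm v * (norm (y - x))\<^sup>2"
  have pn: "(t n, p n) \<in> Sigma {0..T} C" for n using t(1) limiting_normal_cone_memD[OF mem] by simp
  have "(t', p') \<in> Sigma {0..T} C"
    by (rule closed_sequentially[OF closed_graph_C pn]) (use t p in \<open>auto intro: tendsto_Pair\<close>)
  then have t': "t' \<in> {0..T}" and p': "p' \<in> C t'" by auto
  show ?thesis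
  proof (rule limiting_normal_if_quadratic[OF p'])
    show "c * norm v' \<ge> 0" using c by simp
    fix y assume y: "y \<in> C t'"
    have strict: "v' \<bullet> (z - p') \<le> c * norm v' * (norm (z - p'))\<^sup>2" if z: "\<And>i. i \<in> {1..I} \<Longrightarrow> \<psi> i t' z < 0" for z
    proof (rule tendsto_le[OF trivial_limit_sequentially])
      show "(\<lambda>n. v n \<bullet> (z - p n)) \<longlonglongrightarrow> v' \<bullet> (z - p')" using v p by (intro tendsto_intros)
      show "(\<lambda>n. c * norm (v n) * (norm (z - p n))\<^sup>2) \<longlonglongrightarrow> c * norm v' * (norm (z - p'))\<^sup>2"
        using v p by (intro tendsto_intros)
      have "\<forall>\<^sub>F n in sequentially. \<forall>i\<in>{1..I}. \<psi> i (t n) z < 0"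
        by (intro eventually_ball_finite ballI order_tendstoD(2)[OF psi_tendsto[OF _ t tendsto_const]] z) auto
      then show "\<forall>\<^sub>F n in sequentially. v n \<bullet> (z - p n) \<le> c * norm (v n) * (norm (z - p n))\<^sup>2"
        by eventually_elim (intro prox[OF t(1) _ mem], auto simp: in_C_iff less_imp_le)
    qed
    have "\<exists>z. norm (z - y) < 1 / real (Suc n) \<and> (\<forall>i\<in>{1..I}. \<psi> i t' z < 0)" for n
      by (rule strictly_feasible_near[OF t' y, of "1 / real (Suc n)"]) auto
    then obtain z where z: "\<And>n. norm (z n - y) < 1 / real (Suc n)" "\<And>n i. i \<in> {1..I} \<Longrightarrow> \<psi> i t' (z n) < 0"
      by metis
    have "(\<lambda>n. 1 / real (Suc n)) \<longlonglongrightarrow> 0" by (rule lim_1_over_n[THEN LIMSEQ_Suc])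
    then have "(\<lambda>n. z n - y) \<longlonglongrightarrow> 0"
      by (rule Lim_null_comparison[rotated]) (use z(1) in \<open>auto intro: less_imp_le always_eventually\<close>)
    then have zy: "z \<longlonglongrightarrow> y" by (simp add: LIM_zero_iff)
    show "v' \<bullet> (y - p') \<le> c * norm v' * (norm (y - p'))\<^sup>2"
    proof (rule LIMSEQ_le)
      show "(\<lambda>n. v' \<bullet> (z n - p')) \<longlonglongrightarrow> v' \<bullet> (y - p')" using zy by (intro tendsto_intros)
      show "(\<lambda>n. c * norm v' * (norm (z n - p'))\<^sup>2) \<longlonglongrightarrow> c * norm v' * (norm (y - p'))\<^sup>2" using zy by (intro tendsto_intros)
      show "\<exists>N. \<forall>n\<ge>N. v' \<bullet> (z n - p') \<le> c * norm v' * (norm (z n - p'))\<^sup>2"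
        using strict[OF z(2)] by blast
    qed
  qed
qed

end

section \<open>Uniqueness\<close>

text \<open>The weighted square \<open>exp (- (2 * K * t)) * (z t \<bullet> z t)\<close> is
  absolutely continuous and has nonpositive derivative almost everywhere, hence does not
  increase.\<close>

lemma gronwall_zero:
  fixes z :: "real \<Rightarrow> 'a::real_inner"
  assumes ac: "abs_cont_on 0 T z" and z0: "z 0 = 0" and N: "negligible N" and K: "K \<ge> 0"
    and der: "\<And>t. t \<in> {0..T} - N \<Longrightarrow> \<exists>d. (z has_vector_derivative d) (at t within {0..T}) \<and> z t \<bullet> d \<le> K * (norm (z t))\<^sup>2"
    and t: "t \<in> {0..T}"
  shows "z t = 0"
proof -
  define \<phi> where "\<phi> t = exp (- (2 * K * t)) * (z t \<bullet> z t)" for t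
  have "compact (z ` {0..T})"
    by (rule compact_continuous_image[OF abs_cont_on_imp_continuous_on[OF ac]]) simp
  from compact_imp_bounded[OF this]
  obtain B where "\<forall>y\<in>z ` {0..T}. norm y \<le> B" unfolding bounded_iff ..
  then have B: "norm (z t) \<le> B" if "t \<in> {0..T}" for t using that by (simp only: image_eqI)
  have B0: "B \<ge> 0" using B[OF t] norm_ge_zero[of "z t"] by linarith
  have E: "\<bar>exp (- (2 * K * t)) - exp (- (2 * K * s))\<bar> \<le> 2 * K * \<bar>t - s\<bar>" if "s \<in> {0..T}" "t \<in> {0..T}" for s t
  proof -
    have "norm (exp (- (2 * K * t)) - exp (- (2 * K * s))) \<le> 2 * K * norm (t - s)"
    proof (rule field_differentiable_bound[of "{0..T}" "\<lambda>t. exp (- (2 * K * t))" "\<lambda>t. - (2 * K) * exp (- (2 * K * t))"])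
      show "((\<lambda>t. exp (- (2 * K * t))) has_field_derivative - (2 * K) * exp (- (2 * K * t))) (at t within {0..T})" for t
        by (auto intro!: derivative_eq_intros)
      show "norm (- (2 * K) * exp (- (2 * K * t))) \<le> 2 * K" if "t \<in> {0..T}" for t
        using K that mult_left_le[of "exp (- (2 * K * t))" "2 * K"] by (simp add: abs_mult)
    qed (use that in auto)
    then show ?thesis by simp
  qed
  have "abs_cont_on 0 T \<phi>"
  proof (rule abs_cont_on_dominated[OF ac])
    show "2 * B + 2 * K * B\<^sup>2 \<ge> 0" using B0 K by simp
    fix s t assume st: "s \<in> {0..T}" "t \<in> {0..T}"
    have 1: "\<bar>z t \<bullet> z t - z s \<bullet> z s\<bar> \<le> 2 * B * norm (z t - z s)"
    proof -
      have "z t \<bullet> z t - z s \<bullet> z s = (z t + z s) \<bullet> (z t - z s)" by (simp add: algebra_simps inner_commute)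
      then have "\<bar>z t \<bullet> z t - z s \<bullet> z s\<bar> \<le> norm (z t + z s) * norm (z t - z s)" by (simp only: Cauchy_Schwarz_ineq2)
      also have "\<dots> \<le> (2 * B) * norm (z t - z s)"
        using B[OF st(1)] B[OF st(2)] norm_triangle_ineq[of "z t" "z s"] by (intro mult_right_mono) auto
      finally show ?thesis .
    qed
    have 2: "\<bar>z s \<bullet> z s\<bar> \<le> B\<^sup>2"
      using B[OF st(1)] by (simp add: power2_norm_eq_inner[symmetric] power_mono)
    have 3: "exp (- (2 * K * t)) \<le> 1" using K st by simp
    \<comment> \<open>The usual splitting of the increment of a product, with one bounded factor in
      each term.\<close>
    have "\<phi> t - \<phi> s = exp (- (2 * K * t)) * (z t \<bullet> z t - z s \<bullet> z s) + (z s \<bullet> z s) * (exp (- (2 * K * t)) - exp (- (2 * K * s)))"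
      by (simp add: \<phi>_def algebra_simps)
    then have "\<bar>\<phi> t - \<phi> s\<bar> \<le> exp (- (2 * K * t)) * \<bar>z t \<bullet> z t - z s \<bullet> z s\<bar> + \<bar>z s \<bullet> z s\<bar> * \<bar>exp (- (2 * K * t)) - exp (- (2 * K * s))\<bar>"
      by (metis abs_triangle_ineq abs_mult abs_exp_cancel)
    also have "\<dots> \<le> 1 * (2 * B * norm (z t - z s)) + B\<^sup>2 * (2 * K * \<bar>t - s\<bar>)"
      using 1 2 3 E[OF st] by (intro add_mono mult_mono) auto
    also have "\<dots> \<le> (2 * B + 2 * K * B\<^sup>2) * (\<bar>t - s\<bar> + norm (z t - z s))"
    proof -
      have "2 * B * \<bar>t - s\<bar> \<ge> 0" "2 * K * B\<^sup>2 * norm (z t - z s) \<ge> 0" using B0 K by simp_all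
      then show ?thesis by (simp add: algebra_simps)
    qed
    finally show "norm (\<phi> t - \<phi> s) \<le> (2 * B + 2 * K * B\<^sup>2) * (\<bar>t - s\<bar> + norm (z t - z s))" by simp
  qed
  then have ac\<phi>: "abs_cont_on 0 t \<phi>" using t by (intro abs_cont_on_subset[of 0 T \<phi> 0 t]) auto
  have "\<phi> t - \<phi> 0 \<le> 0 * (t - 0)"
  proof (rule abs_cont_on_growth_le[OF _ ac\<phi> N])
    show "0 \<le> t" using t by simp
    fix s assume s: "s \<in> {0..t} - N"
    then have "s \<in> {0..T} - N" using t by auto
    then obtain d where d: "(z has_vector_derivative d) (at s within {0..T})" "z s \<bullet> d \<le> K * (norm (z s))\<^sup>2"
      using der by blast
    have "((\<lambda>t. z t \<bullet> z t) has_vector_derivative (2 * (z s \<bullet> d))) (at s within {0..T})"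
      using d(1) unfolding has_vector_derivative_def
      by (auto intro!: derivative_eq_intros simp: inner_commute algebra_simps)
    then have "((\<lambda>t. z t \<bullet> z t) has_real_derivative (2 * (z s \<bullet> d))) (at s within {0..T})"
      by (simp add: has_real_derivative_iff_has_vector_derivative)
    then have "(\<phi> has_real_derivative (- (2 * K) * exp (- (2 * K * s))) * (z s \<bullet> z s) + exp (- (2 * K * s)) * (2 * (z s \<bullet> d))) (at s within {0..T})"
      unfolding \<phi>_def[abs_def] by (auto intro!: derivative_eq_intros)
    then have "(\<phi> has_real_derivative (- (2 * K) * exp (- (2 * K * s))) * (z s \<bullet> z s) + exp (- (2 * K * s)) * (2 * (z s \<bullet> d))) (at s within {0..t})"
      by (rule has_field_derivative_subset) (use t in auto)
    moreover have "(- (2 * K) * exp (- (2 * K * s))) * (z s \<bullet> z s) + exp (- (2 * K * s)) * (2 * (z s \<bullet> d)) \<le> 0"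
    proof -
      have "exp (- (2 * K * s)) * (2 * (z s \<bullet> d)) \<le> exp (- (2 * K * s)) * (2 * (K * (z s \<bullet> z s)))"
        using d(2) by (intro mult_left_mono) (auto simp: power2_norm_eq_inner)
      then show ?thesis by (simp add: algebra_simps)
    qed
    ultimately show "\<exists>d\<le>0. (\<phi> has_real_derivative d) (at s within {0..t})" by blast
  qed
  then have "exp (- (2 * K * t)) * (z t \<bullet> z t) \<le> 0" by (simp add: \<phi>_def z0)
  then have "z t \<bullet> z t \<le> 0" by (simp add: mult_le_0_iff not_le[symmetric])
  then have "z t \<bullet> z t = 0" using inner_ge_zero[of "z t"] by (rule order_antisym)
  then show ?thesis by (simp only: inner_eq_zero_iff)
qed

text \<open>By continuity a violation would persist on a nondegenerate interval, and such an
  interval is not negligible.\<close>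

lemma nonpos_on_interval_if_AE:
  fixes g :: "real \<Rightarrow> real"
  assumes T: "T > 0" and cont: "continuous_on {0..T} g" and N: "negligible N"
    and le: "\<And>t. t \<in> {0..T} - N \<Longrightarrow> g t \<le> c" and t: "t \<in> {0..T}"
  shows "g t \<le> c"
proof (rule ccontr)
  assume "\<not> g t \<le> c"
  then have gt: "g t > c" by simp
  then obtain d where d: "d > 0" "\<And>s. s \<in> {0..T} \<Longrightarrow> dist s t < d \<Longrightarrow> dist (g s) (g t) < g t - c"
    using cont t unfolding continuous_on_iff by (metis diff_gt_0_iff_gt)
  define a b where "a = max 0 (t - d / 2)" and "b = min T (t + d / 2)"
  have "a < b" using t d(1) T by (auto simp: a_def b_def)
  then obtain s where s: "s \<in> {a..b}" "s \<notin> N" using N by (rule interval_not_subset_negligible)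
  then have "s \<in> {0..T}" "dist s t < d" using t d(1) by (auto simp: a_def b_def dist_real_def)
  then have "g s > c" "g s \<le> c" using d(2)[of s] le[of s] s by (auto simp: dist_real_def)
  then show False by simp
qed

context sweeping_data
begin

text \<open>The normal cone is empty off \<open>C t\<close>, so the inclusion forces feasibility at
  almost every time; continuity then covers the remaining times.\<close>

lemma feasible_if_AE:
  assumes cont: "continuous_on {0..T} x" and N: "negligible N"
    and C: "\<And>t. t \<in> {0..T} - N \<Longrightarrow> x t \<in> C t" and t: "t \<in> {0..T}"
  shows "x t \<in> C t"
  unfolding in_C_iff
proof
  fix i assume i: "i \<in> {1..I}"
  have "continuous_on {0..T} (\<lambda>t. (\<lambda>(t, x). \<psi> i t x) (t, x t))"
    by (rule continuous_on_compose2[OF continuous_on_psi[OF i]]) (auto intro!: continuous_intros cont)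
  then have "continuous_on {0..T} (\<lambda>t. \<psi> i t (x t))" by simp
  then show "\<psi> i t (x t) \<le> 0"
    by (rule nonpos_on_interval_if_AE[OF T_pos _ N _ t]) (use C i in \<open>auto simp: in_C_iff\<close>)
qed

text \<open>Moving \<open>x (t - h)\<close> by \<open>- h \<kappa> e\<close> yields a point \<open>\<zeta> h\<close> of \<open>C t\<close>; testing the normal against
  it bounds the component of the velocity along the normal.\<close>

lemma normal_velocity_bound:
  obtains V where "V > 0"
    "\<And>x t d u v. (\<And>s. s \<in> {0..T} \<Longrightarrow> x s \<in> C s) \<Longrightarrow> t \<in> {0<..T} \<Longrightarrow> u \<in> U \<Longrightarrow>
       v \<in> limiting_normal_cone (C t) (x t) \<Longrightarrow>
       (x has_vector_derivative f t (x t) u - v) (at t within {0..T}) \<Longrightarrow> norm v \<le> V"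
proof -
  obtain c where c: "c > 0" and prox: "\<And>t x y v. t \<in> {0..T} \<Longrightarrow> y \<in> C t \<Longrightarrow> v \<in> limiting_normal_cone (C t) x \<Longrightarrow>
    v \<bullet> (y - x) \<le> c * norm v * (norm (y - x))\<^sup>2"
    by (rule limiting_normal_prox) blast
  obtain G where G: "G > 0" "\<And>i t x. i \<in> {1..I} \<Longrightarrow> (t, x) \<in> Q \<Longrightarrow> norm (gr i t x) \<le> G"
      "\<And>i t x. i \<in> {1..I} \<Longrightarrow> (t, x) \<in> Q \<Longrightarrow> \<bar>dt i t x\<bar> \<le> G"
    by (rule gr_bounded) blast
  \<comment> \<open>Compensates the motion of the constraints, whose time derivative is at most
    \<open>G\<close>, with 1 to spare.\<close>
  define \<kappa> where "\<kappa> = (G + 1) / \<eta>\<^sup>2"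
  have \<kappa>: "\<kappa> > 0" "\<kappa> * \<eta>\<^sup>2 = G + 1" using G eta_pos by (auto simp: \<kappa>_def)
  show thesis
  proof (rule that[of "M + \<kappa> * (real I * G)"])
    show "M + \<kappa> * (real I * G) > 0" using M_pos \<kappa> G by (simp add: add_pos_nonneg)
    fix x :: "real \<Rightarrow> 'a" and t u v
    assume xC: "\<And>s. s \<in> {0..T} \<Longrightarrow> x s \<in> C s" and t': "t \<in> {0<..T}" and u: "u \<in> U"
      and v: "v \<in> limiting_normal_cone (C t) (x t)"
      and der: "(x has_vector_derivative f t (x t) u - v) (at t within {0..T})"
    define d where "d = f t (x t) u - v"
    have t: "t \<in> {0..T}" "t > 0" using t' by auto
    define e where "e = inward t (x t)"
    define \<zeta> where "\<zeta> h = x (t - h) - (h * \<kappa>) *\<^sub>R e" for h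
    have at0: "at 0 within {0..t} = at_right (0::real)" using t(2) by (rule at_within_Icc_at_right)
    have tm: "((\<lambda>h. t - h) has_vector_derivative (-1)) (at 0 within {0..t})"
      by (auto intro!: derivative_eq_intros)
    have sub: "(\<lambda>h. t - h) ` {0..t} \<subseteq> {0..T}" using t by auto
    have y: "((\<lambda>h. x (t - h)) has_vector_derivative - d) (at_right 0)"
    proof -
      have "(x has_vector_derivative d) (at (t - 0) within (\<lambda>h. t - h) ` {0..t})"
        using has_vector_derivative_within_subset[OF der sub] by (simp add: d_def)
      from vector_diff_chain_within[OF tm this] show ?thesis by (simp add: comp_def at0)
    qed
    have \<zeta>d: "(\<zeta> has_vector_derivative (- d - \<kappa> *\<^sub>R e)) (at_right 0)"
      unfolding \<zeta>_def[abs_def] by (auto intro!: derivative_eq_intros y)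
    have \<zeta>0: "\<zeta> 0 = x t" by (simp add: \<zeta>_def)
    have \<zeta>c: "(\<zeta> \<longlongrightarrow> x t) (at_right 0)"
      using has_vector_derivative_continuous[OF \<zeta>d] \<zeta>0 by (simp add: continuous_within)
    have \<phi>1: "((\<lambda>h. \<psi> i t (\<zeta> h)) has_real_derivative gr i t (x t) \<bullet> (- d - \<kappa> *\<^sub>R e)) (at_right 0)" if i: "i \<in> {1..I}" for i
    proof -
      have "(\<psi> i t has_derivative (\<lambda>h. gr i t (x t) \<bullet> h)) (at (\<zeta> 0) within \<zeta> ` {0<..})"
        using has_derivative_at_withinI[OF psi_space_derivative[OF i t(1)]] \<zeta>0 by simp
      from diff_chain_within[OF \<zeta>d[unfolded has_vector_derivative_def] this]
      show ?thesis by (simp add: comp_def has_real_derivative_iff_has_vector_derivative has_vector_derivative_def)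
    qed
    have feas: "\<forall>\<^sub>F h in at_right 0. \<psi> i t (\<zeta> h) \<le> 0" if i: "i \<in> {1..I}" for i
    proof (cases "\<psi> i t (x t) = 0")
      case False
      then have neg: "\<psi> i t (x t) < 0" using xC[OF t(1)] i by (force simp: in_C_iff)
      have "((\<lambda>h. \<psi> i t (\<zeta> h)) \<longlongrightarrow> \<psi> i t (x t)) (at_right 0)"
        using DERIV_continuous[OF \<phi>1[OF i]] \<zeta>0 by (simp add: continuous_within)
      from order_tendstoD(2)[OF this neg]
      show ?thesis by eventually_elim simp
    next
      case True
      have act: "i \<in> active t (x t)" using True i by (simp add: active_def)
      have "((\<lambda>h. \<psi> i (t - h) (x (t - h))) has_real_derivative (dt i t (x t) + gr i t (x t) \<bullet> d) * (-1)) (at 0 within {0..t})"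
      proof -
        have "((\<lambda>s. \<psi> i s (x s)) has_real_derivative (dt i t (x t) + gr i t (x t) \<bullet> d)) (at (t - 0) within (\<lambda>h. t - h) ` {0..t})"
          using has_field_derivative_subset[OF psi_along_curve[OF i t(1) der] sub] by (simp add: d_def)
        moreover have "((\<lambda>h. t - h) has_real_derivative (-1)) (at 0 within {0..t})"
          by (auto intro!: derivative_eq_intros)
        ultimately show ?thesis by (rule DERIV_image_chain[unfolded comp_def])
      qed
      \<comment> \<open>The comparison is with the value at the earlier time, which is nonpositive
        by feasibility. In the difference the velocity \<open>d\<close> cancels, and the rate
        \<open>dt i t (x t) - \<kappa> * (gr i t (x t) \<bullet> e)\<close> is at most
        \<open>-1\<close>.\<close>
      then have "((\<lambda>h. \<psi> i t (\<zeta> h) - \<psi> i (t - h) (x (t - h))) has_real_derivative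
          gr i t (x t) \<bullet> (- d - \<kappa> *\<^sub>R e) - (dt i t (x t) + gr i t (x t) \<bullet> d) * (-1)) (at_right 0)"
        unfolding at0 by (intro DERIV_diff \<phi>1[OF i])
      moreover have "gr i t (x t) \<bullet> (- d - \<kappa> *\<^sub>R e) - (dt i t (x t) + gr i t (x t) \<bullet> d) * (-1) < 0"
      proof -
        have "\<kappa> * \<eta>\<^sup>2 \<le> \<kappa> * (gr i t (x t) \<bullet> e)"
          unfolding e_def using inward_inner_ge[OF t(1) act] \<kappa> by (intro mult_left_mono) auto
        moreover have "dt i t (x t) \<le> G" using G(3)[OF i C_subset_Q[OF t(1) xC[OF t(1)]]] by simp
        ultimately show ?thesis using \<kappa>(2) by (simp add: inner_diff_right)
      qed
      ultimately have "\<forall>\<^sub>F h in at_right 0. \<psi> i t (\<zeta> h) - \<psi> i (t - h) (x (t - h)) < (\<psi> i t (\<zeta> 0) - \<psi> i (t - 0) (x (t - 0))) + 0 * h"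
        by (rule eventually_less_of_derivative)
      moreover have "\<forall>\<^sub>F h in at_right 0. \<psi> i (t - h) (x (t - h)) \<le> 0"
        by (rule eventually_at_rightI[of 0 t]) (use t i xC in \<open>auto simp: in_C_iff\<close>)
      ultimately show ?thesis by eventually_elim (simp add: \<zeta>0)
    qed
    have "\<forall>\<^sub>F h in at_right 0. \<forall>i\<in>{1..I}. \<psi> i t (\<zeta> h) \<le> 0"
      by (intro eventually_ball_finite ballI feas) simp
    then have evC: "\<forall>\<^sub>F h in at_right 0. \<zeta> h \<in> C t" by eventually_elim (simp add: in_C_iff)
    have key: "v \<bullet> (- d - \<kappa> *\<^sub>R e) \<le> 0"
    proof (rule ccontr)
      assume "\<not> ?thesis"
      then have pos: "- (v \<bullet> (- d - \<kappa> *\<^sub>R e)) < 0" by simp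
      \<comment> \<open>The quadratic term has derivative zero at 0, so a negative derivative of
        \<open>\<xi>\<close> contradicts the proximal inequality, which says
        \<open>\<xi> h \<ge> 0\<close>.\<close>
      define \<xi> where "\<xi> h = c * norm v * ((\<zeta> h - x t) \<bullet> (\<zeta> h - x t)) - v \<bullet> (\<zeta> h - x t)" for h
      have "(\<xi> has_vector_derivative - (v \<bullet> (- d - \<kappa> *\<^sub>R e))) (at_right 0)"
        using \<zeta>d unfolding \<xi>_def[abs_def] has_vector_derivative_def
        by (auto intro!: derivative_eq_intros simp: \<zeta>0)
      then have "(\<xi> has_real_derivative - (v \<bullet> (- d - \<kappa> *\<^sub>R e))) (at_right 0)"
        by (simp add: has_real_derivative_iff_has_vector_derivative)
      from eventually_less_of_derivative[OF this pos]
      have "\<forall>\<^sub>F h in at_right (0::real). False" using evC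
      proof eventually_elim
        case (elim h)
        then show False using prox[OF t(1) elim(2) v] by (simp add: \<xi>_def \<zeta>0 power2_norm_eq_inner)
      qed
      then show False by simp
    qed
    have xQ: "(t, x t) \<in> Q" using C_subset_Q[OF t(1) xC[OF t(1)]] .
    \<comment> \<open>Since \<open>d\<close> is the drift minus \<open>v\<close>, the inequality
      \<open>key\<close> sets the square of \<open>norm v\<close> against terms that are linear in
      it.\<close>
    have "v \<bullet> v \<le> v \<bullet> f t (x t) u + \<kappa> * (v \<bullet> e)"
      using key by (simp add: d_def inner_diff_right inner_minus_right)
    also have "\<dots> \<le> norm v * M + \<kappa> * (norm v * (real I * G))"
    proof (intro add_mono mult_left_mono)
      show "v \<bullet> f t (x t) u \<le> norm v * M"
        using norm_cauchy_schwarz[of v "f t (x t) u"] mult_left_mono[OF f_bound[OF xQ u] norm_ge_zero[of v]] by linarith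
      have "norm e \<le> real I * G" unfolding e_def by (rule inward_norm_le[OF G(1,2) xQ])
      then show "v \<bullet> e \<le> norm v * (real I * G)"
        using norm_cauchy_schwarz[of v e] mult_left_mono[of "norm e" "real I * G" "norm v"] by simp
    qed (use \<kappa> in simp)
    finally have "norm v * norm v \<le> (M + \<kappa> * (real I * G)) * norm v"
      by (simp add: power2_norm_eq_inner[symmetric] power2_eq_square algebra_simps)
    then show "norm v \<le> M + \<kappa> * (real I * G)"
      using M_pos \<kappa> G by (cases "norm v = 0") (auto simp: mult_le_cancel_right add_nonneg_nonneg)
  qed
qed

lemma solves_inclusion_iff:
  "solves_inclusion T F a x \<longleftrightarrow> abs_cont_on 0 T x \<and> x 0 = a \<and>
    (\<exists>N. negligible N \<and> (\<forall>t\<in>{0..T} - N. \<exists>d\<in>F t (x t). (x has_vector_derivative d) (at t within {0..T})))"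
  unfolding solves_inclusion_def by (subst AE_lebesgue_on_iff_negligible) auto

lemma sweeping_solutionD:
  assumes sol: "solves_inclusion T (sweeping_rhs I \<psi> f u) a x"
    and u: "AE t in lebesgue_on {0..T}. u t \<in> U"
  obtains N where "negligible N" "\<And>t. t \<in> {0..T} - N \<Longrightarrow> t > 0 \<and> u t \<in> U \<and>
      (\<exists>v. v \<in> limiting_normal_cone (C t) (x t) \<and> (x has_vector_derivative f t (x t) (u t) - v) (at t within {0..T}))"
proof -
  obtain N1 where N1: "negligible N1" "\<forall>t\<in>{0..T} - N1. u t \<in> U"
    using u by (subst (asm) AE_lebesgue_on_iff_negligible) auto
  obtain N2 where N2: "negligible N2" "\<forall>t\<in>{0..T} - N2. \<exists>d\<in>sweeping_rhs I \<psi> f u t (x t). (x has_vector_derivative d) (at t within {0..T})"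
    using sol unfolding solves_inclusion_iff by blast
  show thesis
  \<comment> \<open>Time 0 is discarded because \<open>normal_velocity_bound\<close> looks back in
    time.\<close>
  proof (rule that[of "N1 \<union> N2 \<union> {0}"])
    show "negligible (N1 \<union> N2 \<union> {0})" using N1 N2 by simp
    fix t assume t: "t \<in> {0..T} - (N1 \<union> N2 \<union> {0})"
    then have "t \<in> {0..T} - N2" by blast
    then obtain d where d: "d \<in> sweeping_rhs I \<psi> f u t (x t)" "(x has_vector_derivative d) (at t within {0..T})"
      using N2(2) by blast
    then show "t > 0 \<and> u t \<in> U \<and>
      (\<exists>v. v \<in> limiting_normal_cone (C t) (x t) \<and> (x has_vector_derivative f t (x t) (u t) - v) (at t within {0..T}))"
      using t N1 by (auto simp: sweeping_rhs_def)
  qed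
qed

lemma sweeping_solution_unique:
  assumes u: "AE t in lebesgue_on {0..T}. u t \<in> U"
    and x: "solves_inclusion T (sweeping_rhs I \<psi> f u) a x"
    and y: "solves_inclusion T (sweeping_rhs I \<psi> f u) a y"
    and t: "t \<in> {0..T}"
  shows "x t = y t"
proof -
  obtain N1 where N1: "negligible N1" "\<And>t. t \<in> {0..T} - N1 \<Longrightarrow> t > 0 \<and> u t \<in> U \<and>
      (\<exists>v. v \<in> limiting_normal_cone (C t) (x t) \<and> (x has_vector_derivative f t (x t) (u t) - v) (at t within {0..T}))"
    by (rule sweeping_solutionD[OF x u]) blast
  obtain N2 where N2: "negligible N2" "\<And>t. t \<in> {0..T} - N2 \<Longrightarrow> t > 0 \<and> u t \<in> U \<and>
      (\<exists>v. v \<in> limiting_normal_cone (C t) (y t) \<and> (y has_vector_derivative f t (y t) (u t) - v) (at t within {0..T}))"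
    by (rule sweeping_solutionD[OF y u]) blast
  have acx: "abs_cont_on 0 T x" "x 0 = a" and acy: "abs_cont_on 0 T y" "y 0 = a"
    using x y by (simp_all add: solves_inclusion_def)
  have xC: "x s \<in> C s" if "s \<in> {0..T}" for s
    by (rule feasible_if_AE[OF abs_cont_on_imp_continuous_on[OF acx(1)] N1(1) _ that]) (use N1(2) limiting_normal_cone_memD in blast)
  have yC: "y s \<in> C s" if "s \<in> {0..T}" for s
    by (rule feasible_if_AE[OF abs_cont_on_imp_continuous_on[OF acy(1)] N2(1) _ that]) (use N2(2) limiting_normal_cone_memD in blast)
  obtain c where c: "c > 0" and prox: "\<And>t x y v. t \<in> {0..T} \<Longrightarrow> y \<in> C t \<Longrightarrow> v \<in> limiting_normal_cone (C t) x \<Longrightarrow>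
    v \<bullet> (y - x) \<le> c * norm v * (norm (y - x))\<^sup>2"
    by (rule limiting_normal_prox) blast
  obtain V where V: "V > 0"
    "\<And>x t d u v. (\<And>s. s \<in> {0..T} \<Longrightarrow> x s \<in> C s) \<Longrightarrow> t \<in> {0<..T} \<Longrightarrow> u \<in> U \<Longrightarrow>
       v \<in> limiting_normal_cone (C t) (x t) \<Longrightarrow>
       (x has_vector_derivative f t (x t) u - v) (at t within {0..T}) \<Longrightarrow> norm v \<le> V"
    by (rule normal_velocity_bound) blast
  \<comment> \<open>Bounded normals make both solutions Lipschitz, so that their difference is
    absolutely continuous.\<close>
  obtain B where lip: "B \<ge> 0" "B-lipschitz_on {0..T} x" "B-lipschitz_on {0..T} y"
  proof (rule that[of "M + V"])
    have *: "(M + V)-lipschitz_on {0..T} z" if zC: "\<And>s. s \<in> {0..T} \<Longrightarrow> z s \<in> C s" and ac: "abs_cont_on 0 T z" and N: "negligible N"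
      and d: "\<And>t. t \<in> {0..T} - N \<Longrightarrow> t > 0 \<and> u t \<in> U \<and>
      (\<exists>v. v \<in> limiting_normal_cone (C t) (z t) \<and> (z has_vector_derivative f t (z t) (u t) - v) (at t within {0..T}))" for z N
    proof (rule abs_cont_on_imp_lipschitz[OF ac N])
      show "M + V \<ge> 0" using M_pos V by simp
      fix t assume t: "t \<in> {0..T} - N"
      then obtain v where v: "t > 0" "u t \<in> U" "v \<in> limiting_normal_cone (C t) (z t)"
        "(z has_vector_derivative f t (z t) (u t) - v) (at t within {0..T})" using d by blast
      have "norm v \<le> V" by (rule V(2)[OF zC _ v(2,3,4)]) (use t v in auto)
      moreover have "norm (f t (z t) (u t)) \<le> M" using t zC by (intro f_bound C_subset_Q v) auto
      ultimately have "norm (f t (z t) (u t) - v) \<le> M + V" using norm_triangle_ineq4[of "f t (z t) (u t)" v] by linarith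
      then show "\<exists>d. norm d \<le> M + V \<and> (z has_vector_derivative d) (at t within {0..T})" using v(4) by blast
    qed
    show "(M + V)-lipschitz_on {0..T} x" by (rule *[OF xC acx(1) N1])
    show "(M + V)-lipschitz_on {0..T} y" by (rule *[OF yC acy(1) N2])
  qed (use M_pos V in simp)
  have "(\<lambda>s. x s - y s) t = 0"
  proof (rule gronwall_zero[OF _ _ _ _ _ t])
    show "abs_cont_on 0 T (\<lambda>s. x s - y s)"
      by (rule lipschitz_imp_abs_cont_on[OF lipschitz_on_diff[OF lip(2,3)]])
    show "x 0 - y 0 = 0" using acx acy by simp
    show "negligible (N1 \<union> N2)" using N1 N2 by simp
    \<comment> \<open>\<open>M\<close> comes from the Lipschitz bound on \<open>f\<close>, and
      \<open>c * V\<close> from each of the two normals, tested at the other solution.\<close>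
    show "M + 2 * c * V \<ge> 0" using M_pos c V by simp
    fix s assume s: "s \<in> {0..T} - (N1 \<union> N2)"
    then have sT: "s \<in> {0..T}" by simp
    obtain v where v: "s > 0" "u s \<in> U" "v \<in> limiting_normal_cone (C s) (x s)"
        "(x has_vector_derivative f s (x s) (u s) - v) (at s within {0..T})" using N1(2)[of s] s by blast
    obtain w where w: "w \<in> limiting_normal_cone (C s) (y s)"
        "(y has_vector_derivative f s (y s) (u s) - w) (at s within {0..T})" using N2(2)[of s] s by blast
    have nv: "norm v \<le> V" by (rule V(2)[OF xC _ v(2,3,4)]) (use s v in auto)
    have nw: "norm w \<le> V" by (rule V(2)[OF yC _ v(2) w]) (use s v in auto)
    define z where "z = x s - y s"
    have "((\<lambda>s. x s - y s) has_vector_derivative (f s (x s) (u s) - v) - (f s (y s) (u s) - w)) (at s within {0..T})"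
      by (rule has_vector_derivative_diff[OF v(4) w(2)])
    moreover have "z \<bullet> ((f s (x s) (u s) - v) - (f s (y s) (u s) - w)) \<le> (M + 2 * c * V) * (norm z)\<^sup>2"
    proof -
      have "z \<bullet> (f s (x s) (u s) - f s (y s) (u s)) \<le> norm z * (M * norm z)"
        using norm_cauchy_schwarz[of z "f s (x s) (u s) - f s (y s) (u s)"]
          mult_left_mono[OF f_lipschitz[OF C_subset_Q[OF sT xC[OF sT]] C_subset_Q[OF sT yC[OF sT]] v(2)] norm_ge_zero[of z]]
        by (simp add: z_def)
      moreover have "v \<bullet> (y s - x s) \<le> c * V * (norm z)\<^sup>2"
      proof -
        have "v \<bullet> (y s - x s) \<le> c * norm v * (norm (y s - x s))\<^sup>2" by (rule prox[OF sT yC[OF sT] v(3)])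
        also have "\<dots> \<le> c * V * (norm (y s - x s))\<^sup>2" using c nv by (intro mult_right_mono mult_left_mono) auto
        finally show ?thesis by (simp add: z_def norm_minus_commute)
      qed
      moreover have "w \<bullet> (x s - y s) \<le> c * V * (norm z)\<^sup>2"
      proof -
        have "w \<bullet> (x s - y s) \<le> c * norm w * (norm (x s - y s))\<^sup>2" by (rule prox[OF sT xC[OF sT] w(1)])
        also have "\<dots> \<le> c * V * (norm (x s - y s))\<^sup>2" using c nw by (intro mult_right_mono mult_left_mono) auto
        finally show ?thesis by (simp add: z_def)
      qed
      moreover have "z \<bullet> ((f s (x s) (u s) - v) - (f s (y s) (u s) - w)) =
          z \<bullet> (f s (x s) (u s) - f s (y s) (u s)) + v \<bullet> (y s - x s) + w \<bullet> (x s - y s)"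
        by (simp add: z_def algebra_simps inner_commute)
      ultimately show ?thesis by (simp add: power2_eq_square algebra_simps)
    qed
    ultimately show "\<exists>d. ((\<lambda>s. x s - y s) has_vector_derivative d) (at s within {0..T}) \<and> (x s - y s) \<bullet> d \<le> (M + 2 * c * V) * (norm (x s - y s))\<^sup>2"
      unfolding z_def by blast
  qed
  then show ?thesis by simp
qed

end

section \<open>Invariance and passage to the limit\<close>

text \<open>A zonotope: the Minkowski sum of segments, built up one segment at a time.\<close>

lemma box_combinations_compact_convex:
  fixes g :: "'i \<Rightarrow> 'a::euclidean_space"
  assumes "finite J"
  shows "compact {\<Sum>i\<in>J. l i *\<^sub>R g i |l. \<forall>i\<in>J. 0 \<le> l i \<and> l i \<le> b i}
    \<and> convex {\<Sum>i\<in>J. l i *\<^sub>R g i |l. \<forall>i\<in>J. 0 \<le> l i \<and> l i \<le> b i}"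
  using assms
proof (induction J)
  case empty
  have "{\<Sum>i\<in>{}. l i *\<^sub>R g i |l. \<forall>i\<in>{}. 0 \<le> l i \<and> l i \<le> b i} = {0}" by auto
  then show ?case by simp
next
  case (insert j J)
  let ?P = "{\<Sum>i\<in>J. l i *\<^sub>R g i |l. \<forall>i\<in>J. 0 \<le> l i \<and> l i \<le> b i}"
  let ?L = "(\<lambda>c. c *\<^sub>R g j) ` {0..b j}"
  have "{\<Sum>i\<in>insert j J. l i *\<^sub>R g i |l. \<forall>i\<in>insert j J. 0 \<le> l i \<and> l i \<le> b i} = {x + y |x y. x \<in> ?L \<and> y \<in> ?P}"
    (is "?A = ?B")
  proof (intro equalityI subsetI)
    fix z assume "z \<in> ?A"
    then obtain l where l: "z = (\<Sum>i\<in>insert j J. l i *\<^sub>R g i)" "\<forall>i\<in>insert j J. 0 \<le> l i \<and> l i \<le> b i" by blast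
    have "l j *\<^sub>R g j \<in> ?L" using l(2) by auto
    moreover have "(\<Sum>i\<in>J. l i *\<^sub>R g i) \<in> ?P" using l(2) by blast
    moreover have "z = l j *\<^sub>R g j + (\<Sum>i\<in>J. l i *\<^sub>R g i)" using l(1) insert by simp
    ultimately show "z \<in> ?B" by blast
  next
    fix z assume "z \<in> ?B"
    then obtain c l where cl: "z = c *\<^sub>R g j + (\<Sum>i\<in>J. l i *\<^sub>R g i)" "0 \<le> c" "c \<le> b j" "\<forall>i\<in>J. 0 \<le> l i \<and> l i \<le> b i" by auto
    define l' where "l' = l(j := c)"
    have "(\<Sum>i\<in>J. l' i *\<^sub>R g i) = (\<Sum>i\<in>J. l i *\<^sub>R g i)"
      using insert(2) by (intro sum.cong) (auto simp: l'_def)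
    then have "z = (\<Sum>i\<in>insert j J. l' i *\<^sub>R g i)" using insert cl(1) by (simp add: l'_def)
    moreover have "\<forall>i\<in>insert j J. 0 \<le> l' i \<and> l' i \<le> b i" using cl by (auto simp: l'_def)
    ultimately show "z \<in> ?A" by blast
  qed
  moreover have "compact ?L" by (intro compact_continuous_image continuous_intros) simp
  moreover have "convex ?L"
    by (rule convex_linear_image) (auto intro: bounded_linear.linear bounded_linear_scaleR_left)
  moreover have "?B = (\<Union>x\<in>?L. \<Union>y\<in>?P. {x + y})" by blast
  ultimately show ?case
    using insert.IH compact_sums[of ?L ?P] convex_sums[of ?L ?P] by (simp only:)
qed

text \<open>Large index and nearby time taken together; \<open>nhds\<close> rather than
  \<open>at\<close> lets the time equal \<open>t\<close>. An estimate in this filter holds on a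
  neighbourhood of \<open>t\<close> common to all large indices, and there the growth bound can be
  applied for each index.\<close>

abbreviation "joint_at t X \<equiv> sequentially \<times>\<^sub>F inf (nhds t) (principal X)"

lemma eventually_prod_at_within_sequentially:
  assumes "\<forall>\<^sub>F (k, s) in joint_at t X. P k s"
  obtains K \<delta> where "\<delta> > 0" "\<And>k s. k \<ge> K \<Longrightarrow> s \<in> X \<Longrightarrow> dist s t < \<delta> \<Longrightarrow> P k s"
proof -
  obtain P1 P2 where P: "eventually P1 sequentially" "eventually P2 (inf (nhds t) (principal X))"
    "\<And>k s. P1 k \<Longrightarrow> P2 s \<Longrightarrow> P k s"
    using assms unfolding eventually_prod_filter by auto
  obtain K where K: "\<And>k. k \<ge> K \<Longrightarrow> P1 k" using P(1) unfolding eventually_sequentially by blast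
  obtain \<delta> where \<delta>: "\<delta> > 0" "\<And>s. dist s t < \<delta> \<Longrightarrow> s \<in> X \<Longrightarrow> P2 s"
    using P(2) unfolding eventually_inf_principal eventually_nhds_metric by blast
  show thesis by (rule that[OF \<delta>(1)]) (use K \<delta> P(3) in blast)
qed

lemma tendsto_uniform_limit_joint:
  fixes x :: "real \<Rightarrow> 'a::real_normed_vector"
  assumes unif: "uniform_limit X xk x sequentially" and cont: "continuous_on X x" and t: "t \<in> X"
  shows "((\<lambda>(k, s). xk k s) \<longlongrightarrow> x t) (joint_at t X)"
proof (rule tendstoI)
  fix e :: real assume "e > 0"
  then have e: "e / 2 > 0" by simp
  have "\<forall>\<^sub>F k in sequentially. \<forall>s\<in>X. dist (xk k s) (x s) < e / 2" using unif e by (rule uniform_limitD)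
  moreover obtain d where d: "d > 0" "\<And>s. s \<in> X \<Longrightarrow> dist s t < d \<Longrightarrow> dist (x s) (x t) < e / 2"
    using cont t e unfolding continuous_on_iff by blast
  have "\<forall>\<^sub>F s in inf (nhds t) (principal X). s \<in> X \<and> dist (x s) (x t) < e / 2"
    unfolding eventually_inf_principal eventually_nhds_metric using d by blast
  ultimately have "\<forall>\<^sub>F z in joint_at t X.
      (\<forall>s\<in>X. dist (xk (fst z) s) (x s) < e / 2) \<and> (snd z \<in> X \<and> dist (x (snd z)) (x t) < e / 2)"
    by (rule eventually_prodI)
  then show "\<forall>\<^sub>F z in joint_at t X. dist (case z of (k, s) \<Rightarrow> xk k s) (x t) < e"
  proof eventually_elim
    case (elim z)
    then have "dist (xk (fst z) (snd z)) (x (snd z)) < e / 2" "dist (x (snd z)) (x t) < e / 2" by auto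
    then have "dist (xk (fst z) (snd z)) (x t) < e"
      using dist_triangle[of "xk (fst z) (snd z)" "x t" "x (snd z)"] by linarith
    then show ?case by (simp add: split_beta)
  qed
qed

lemma tendsto_graph_joint:
  fixes x :: "real \<Rightarrow> 'a::real_normed_vector"
  assumes "uniform_limit X xk x sequentially" "continuous_on X x" "t \<in> X"
  shows "((\<lambda>(k, s). (s, xk k s)) \<longlongrightarrow> (t, x t)) (joint_at t X)"
    (is "(_ \<longlongrightarrow> _) ?F")
proof -
  have "(snd \<longlongrightarrow> t) ?F"
    by (rule filterlim_compose[OF _ filterlim_snd]) (rule filterlim_mono[OF filterlim_ident, OF order_refl inf_le1])
  then have "((\<lambda>z. (snd z, (\<lambda>(k, s). xk k s) z)) \<longlongrightarrow> (t, x t)) ?F"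
    by (intro tendsto_Pair tendsto_uniform_limit_joint[OF assms])
  then show ?thesis by (simp add: case_prod_unfold)
qed

lemma eventually_joint_in:
  "\<forall>\<^sub>F (k, s) in joint_at t X. s \<in> X"
proof -
  have "\<forall>\<^sub>F s in inf (nhds t) (principal X). s \<in> X" by (simp add: eventually_inf_principal)
  from eventually_prodI[OF eventually_True this] show ?thesis by (simp add: case_prod_unfold)
qed

section \<open>Invariance of the relaxed sets\<close>

context sweeping_data
begin

definition "pen \<sigma> \<gamma> i t x = \<gamma> * exp (\<gamma> * (\<psi> i t x - \<sigma>))"

lemma pen_pos: "\<gamma> > 0 \<Longrightarrow> pen \<sigma> \<gamma> i t x > 0"
  by (simp add: pen_def)

abbreviation "penalty \<sigma> \<gamma> t x \<equiv> \<Sum>i=1..I. pen \<sigma> \<gamma> i t x *\<^sub>R gr i t x"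

lemma penalized_rhs_eq:
  "penalized_rhs I \<psi> f \<sigma> \<gamma> u t x = f t x (u t) - (penalty \<sigma> \<gamma> t x)"
  by (simp add: penalized_rhs_def pen_def)

lemma mu_boundD:
  assumes "t \<in> {0..T}" "w \<in> U" "c \<in> C t" "norm (x - c) \<le> 1" "i \<in> {1..I}"
  shows "norm (gr i t x) * norm (f t x w) + \<bar>dt i t x\<bar> + 1 \<le> \<mu>"
proof -
  have "x = c + (x - c)" by simp
  moreover have "x - c \<in> cball 0 1" using assms(4) by simp
  ultimately have "x \<in> {c + e |c e. c \<in> C t \<and> e \<in> cball 0 1}" using assms(3) by blast
  then show ?thesis using mu assms(1,2,5) unfolding mu_bound_def by blast
qed

text \<open>The bootstrap step: while all constraints stay at most \<open>\<delta>\<close>, where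
  the bound by \<open>\<mu>\<close> is available, they are in fact at most
  \<open>\<sigma> + m\<close>. The velocity hypothesis is restricted in the same way, so that the
  lemma also serves equations that agree with the penalized one only at such points.\<close>

lemma penalty_barrier_step:
  assumes \<delta>: "\<delta> \<le> \<beta>"
    and sub: "\<And>t x. t \<in> {0..T} \<Longrightarrow> (\<And>i. i \<in> {1..I} \<Longrightarrow> \<psi> i t x \<le> \<delta>) \<Longrightarrow> (t, x) \<in> Q \<and> (\<exists>c\<in>C t. norm (x - c) \<le> 1)"
    and \<gamma>: "\<gamma> > 0" "\<gamma> * exp (\<gamma> * m) = \<mu> / \<eta>\<^sup>2" and small: "- \<beta> \<le> \<sigma> + m"
    and ac: "abs_cont_on 0 T x" and N: "negligible N"
    and der: "\<And>t. t \<in> {0..T} - N \<Longrightarrow> (\<And>i. i \<in> {1..I} \<Longrightarrow> \<psi> i t (x t) \<le> \<delta>) \<Longrightarrow>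
      \<exists>w\<in>U. (x has_vector_derivative f t (x t) w - penalty \<sigma> \<gamma> t (x t)) (at t within {0..T})"
    and init: "\<And>i. i \<in> {1..I} \<Longrightarrow> \<psi> i 0 (x 0) \<le> \<sigma> + m"
    and t1: "t1 \<in> {0..T}" and below: "\<And>t i. t \<in> {0..t1} \<Longrightarrow> i \<in> {1..I} \<Longrightarrow> \<psi> i t (x t) \<le> \<delta>" and i: "i \<in> {1..I}"
  shows "\<psi> i t1 (x t1) \<le> \<sigma> + m"
proof (rule ccontr)
  assume "\<not> ?thesis"
  then have gt: "\<psi> i t1 (x t1) > \<sigma> + m" by simp
  define g where "g t = \<psi> i t (x t)" for t
  have sub1: "{0..t1} \<subseteq> {0..T}" using t1 by auto
  have cx: "continuous_on {0..t1} x" using abs_cont_on_imp_continuous_on[OF ac] sub1 by (rule continuous_on_subset)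
  have "continuous_on {0..t1} (\<lambda>t. (\<lambda>(t, x). \<psi> i t x) (t, x t))"
    by (rule continuous_on_compose2[OF continuous_on_psi[OF i]]) (use sub1 in \<open>auto intro!: continuous_intros cx\<close>)
  then have cg: "continuous_on {0..t1} g" by (simp add: g_def)
  have "closed ({0..t1} \<inter> g -` {..\<sigma> + m})"
    by (rule continuous_closed_preimage[OF cg]) auto
  then have comp: "compact ({0..t1} \<inter> g -` {..\<sigma> + m})"
    by (simp add: compact_Int_closed[of "{0..t1}" "{0..t1} \<inter> g -` {..\<sigma> + m}", simplified Int_assoc[symmetric] Int_absorb, OF compact_Icc])
  have "0 \<in> {0..t1} \<inter> g -` {..\<sigma> + m}" using init[OF i] t1 by (simp add: g_def)
  then have "{0..t1} \<inter> g -` {..\<sigma> + m} \<noteq> {}" by blast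
  \<comment> \<open>\<open>s0\<close> is the last time up to \<open>t1\<close> at which the level is
    not exceeded; after it the penalty acts with full strength.\<close>
  from compact_attains_sup[OF comp this]
  obtain s0 where "s0 \<in> {0..t1} \<inter> g -` {..\<sigma> + m}" "\<forall>s\<in>{0..t1} \<inter> g -` {..\<sigma> + m}. s \<le> s0" ..
  then have s0: "s0 \<in> {0..t1}" "g s0 \<le> \<sigma> + m" and s0max: "\<And>s. s \<in> {0..t1} \<Longrightarrow> g s \<le> \<sigma> + m \<Longrightarrow> s \<le> s0"
    by blast+
  have QQ: "(t, x t) \<in> Q" if "t \<in> {0..t1}" for t
    using sub[of t "x t"] below that sub1 by blast
  obtain K where K: "K > 0" "\<And>i z w. i \<in> {1..I} \<Longrightarrow> z \<in> Q \<Longrightarrow> w \<in> Q \<Longrightarrow> \<bar>(case z of (t, x) \<Rightarrow> \<psi> i t x) - (case w of (t, x) \<Rightarrow> \<psi> i t x)\<bar> \<le> K * norm (z - w)"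
    by (rule derivative_bounded_lipschitz) blast
  have "g t1 - g s0 \<le> 0 * (t1 - s0)"
  proof (rule abs_cont_on_growth_le)
    show "s0 \<le> t1" using s0 by simp
    \<comment> \<open>At \<open>s0\<close> itself the level is not exceeded, so this time joins the
      exceptional set.\<close>
    show "negligible (N \<union> {s0})" using N by simp
    show "abs_cont_on s0 t1 g"
    proof (rule abs_cont_on_dominated)
      show "abs_cont_on s0 t1 x" by (rule abs_cont_on_subset[OF ac]) (use s0 t1 in auto)
      show "K \<ge> 0" using K by simp
      fix s t assume st: "s \<in> {s0..t1}" "t \<in> {s0..t1}"
      have "\<bar>g t - g s\<bar> \<le> K * norm ((t, x t) - (s, x s))"
        using K(2)[OF i QQ QQ, of t s] st s0 by (simp add: g_def)
      also have "\<dots> \<le> K * (\<bar>t - s\<bar> + norm (x t - x s))"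
        using K(1) norm_Pair_le[of "t - s" "x t - x s"] by (intro mult_left_mono) auto
      finally show "norm (g t - g s) \<le> K * (\<bar>t - s\<bar> + norm (x t - x s))" by simp
    qed
    fix t assume t: "t \<in> {s0..t1} - (N \<union> {s0})"
    then have t01: "t \<in> {0..t1}" and tT: "t \<in> {0..T}" "t \<in> {0..T} - N" using s0 sub1 by auto
    have gt: "g t > \<sigma> + m"
    proof (rule ccontr)
      assume "\<not> ?thesis"
      then have "t \<le> s0" using s0max[OF t01] by simp
      then show False using t by auto
    qed
    obtain w where w: "w \<in> U" "(x has_vector_derivative f t (x t) w - penalty \<sigma> \<gamma> t (x t)) (at t within {0..T})"
      using der[OF tT(2) below[OF t01]] by blast
    obtain c where c: "c \<in> C t" "norm (x t - c) \<le> 1" using sub[OF tT(1) below[OF t01]] by blast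
    have \<mu>b: "norm (gr i t (x t)) * norm (f t (x t) w) + \<bar>dt i t (x t)\<bar> + 1 \<le> \<mu>"
      by (rule mu_boundD[OF tT(1) w(1) c i])
    have \<mu>0: "\<mu> \<ge> 0" using \<mu>b by (smt (verit) mult_nonneg_nonneg norm_ge_zero)
    have gle: "\<psi> i t (x t) \<le> \<beta>" using below[OF t01 i] \<delta> by linarith
    have gn: "norm (gr i t (x t)) > \<eta>" using gt small gle by (intro grad_gt[OF tT(1) i]) (auto simp: g_def)
    have "gr i t (x t) \<bullet> (\<Sum>j\<in>{1..I}. pen \<sigma> \<gamma> j t (x t) *\<^sub>R gr j t (x t)) \<ge> pen \<sigma> \<gamma> i t (x t) * (norm (gr i t (x t)))\<^sup>2"
    proof (rule grad_inner_sum_ge[OF tT(1) subset_refl i])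
      fix j assume j: "j \<in> {1..I}"
      show "\<psi> j t (x t) \<le> \<beta>" using below[OF t01 j] \<delta> by linarith
      show "pen \<sigma> \<gamma> j t (x t) \<ge> 0" using pen_pos[OF \<gamma>(1)] less_imp_le by blast
    qed
    moreover have "pen \<sigma> \<gamma> i t (x t) * (norm (gr i t (x t)))\<^sup>2 \<ge> \<mu>"
    proof -
      \<comment> \<open>Above the level the multiplier is at least its value at the level, which is
        \<open>\<mu> / \<eta>\<^sup>2\<close> by the choice of \<open>m\<close>.\<close>
      have "\<mu> / \<eta>\<^sup>2 \<le> pen \<sigma> \<gamma> i t (x t)"
        unfolding pen_def \<gamma>(2)[symmetric] using \<gamma>(1) gt by (simp add: g_def)
      moreover have "\<eta>\<^sup>2 \<le> (norm (gr i t (x t)))\<^sup>2" using gn eta_pos by (intro power_mono) auto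
      ultimately have "\<mu> / \<eta>\<^sup>2 * \<eta>\<^sup>2 \<le> pen \<sigma> \<gamma> i t (x t) * (norm (gr i t (x t)))\<^sup>2"
        using pen_pos[OF \<gamma>(1), of \<sigma> i t "x t"] by (intro mult_mono) auto
      then show ?thesis using eta_pos by simp
    qed
    moreover have "gr i t (x t) \<bullet> f t (x t) w \<le> norm (gr i t (x t)) * norm (f t (x t) w)" by (rule norm_cauchy_schwarz)
    ultimately have "dt i t (x t) + gr i t (x t) \<bullet> (f t (x t) w - penalty \<sigma> \<gamma> t (x t)) \<le> 0"
      using \<mu>b unfolding inner_diff_right by linarith
    moreover have "(g has_real_derivative (dt i t (x t) + gr i t (x t) \<bullet> (f t (x t) w - penalty \<sigma> \<gamma> t (x t)))) (at t within {s0..t1})"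
      unfolding g_def[abs_def] using psi_along_curve[OF i tT(1) w(2)]
      by (rule has_field_derivative_subset) (use s0 t1 in auto)
    ultimately show "\<exists>d\<le>0. (g has_real_derivative d) (at t within {s0..t1})" by blast
  qed
  then show False using gt s0(2) by (simp add: g_def)
qed

text \<open>Closes the bootstrap. Up to the first time at which some constraint reaches
  \<open>\<delta>\<close>, all of them are at most \<open>\<delta>\<close>; the step then puts them
  at most at \<open>\<sigma> + m < \<delta>\<close> at that very time.\<close>

lemma penalized_invariant:
  assumes \<delta>: "\<delta> \<le> \<beta>"
    and sub: "\<And>t x. t \<in> {0..T} \<Longrightarrow> (\<And>i. i \<in> {1..I} \<Longrightarrow> \<psi> i t x \<le> \<delta>) \<Longrightarrow> (t, x) \<in> Q \<and> (\<exists>c\<in>C t. norm (x - c) \<le> 1)"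
    and \<gamma>: "\<gamma> > 0" "\<gamma> * exp (\<gamma> * m) = \<mu> / \<eta>\<^sup>2" and small: "- \<beta> \<le> \<sigma> + m" "\<sigma> + m < \<delta>"
    and ac: "abs_cont_on 0 T x" and N: "negligible N"
    and der: "\<And>t. t \<in> {0..T} - N \<Longrightarrow> (\<And>i. i \<in> {1..I} \<Longrightarrow> \<psi> i t (x t) \<le> \<delta>) \<Longrightarrow>
      \<exists>w\<in>U. (x has_vector_derivative f t (x t) w - penalty \<sigma> \<gamma> t (x t)) (at t within {0..T})"
    and init: "\<And>i. i \<in> {1..I} \<Longrightarrow> \<psi> i 0 (x 0) \<le> \<sigma> + m"
    and t: "t \<in> {0..T}" and i: "i \<in> {1..I}"
  shows "\<psi> i t (x t) \<le> \<sigma> + m"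
proof -
  have step: "\<psi> i t1 (x t1) \<le> \<sigma> + m"
    if "t1 \<in> {0..T}" "\<And>t i. t \<in> {0..t1} \<Longrightarrow> i \<in> {1..I} \<Longrightarrow> \<psi> i t (x t) \<le> \<delta>" "i \<in> {1..I}" for t1 i
    using \<delta> sub \<gamma> small(1) ac N der init that by (rule penalty_barrier_step)
  have cg: "continuous_on {0..T} (\<lambda>t. \<psi> j t (x t))" if j: "j \<in> {1..I}" for j
  proof -
    have "continuous_on {0..T} (\<lambda>t. (\<lambda>(t, x). \<psi> j t x) (t, x t))"
      by (rule continuous_on_compose2[OF continuous_on_psi[OF j]])
        (auto intro!: continuous_intros abs_cont_on_imp_continuous_on[OF ac])
    then show ?thesis by simp
  qed
  have below: "\<psi> j s (x s) \<le> \<delta>" if s: "s \<in> {0..T}" and j: "j \<in> {1..I}" for s j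
  proof (rule ccontr)
    assume ng: "\<not> \<psi> j s (x s) \<le> \<delta>"
    define A where "A = (\<Union>j\<in>{1..I}. {0..T} \<inter> (\<lambda>t. \<psi> j t (x t)) -` {\<delta>..})"
    have "closed A" unfolding A_def
      by (intro closed_UN ballI continuous_closed_preimage[OF cg]) auto
    moreover have "A \<subseteq> {0..T}" by (auto simp: A_def)
    ultimately have cA: "compact A" using compact_Icc bounded_subset compact_eq_bounded_closed by blast
    have "s \<in> A" unfolding A_def using ng s by (intro UN_I[OF j]) auto
    then have "A \<noteq> {}" by blast
    then obtain tA where tA: "tA \<in> A" "\<And>t. t \<in> A \<Longrightarrow> tA \<le> t" using compact_attains_inf[OF cA] by blast
    have tAT: "tA \<in> {0..T}" using tA(1) \<open>A \<subseteq> {0..T}\<close> by blast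
    have lt: "\<psi> l t (x t) < \<delta>" if "t \<in> {0..T}" "t < tA" "l \<in> {1..I}" for t l
      using tA(2)[of t] that by (force simp: A_def)
    have le: "\<psi> l t (x t) \<le> \<delta>" if tl: "t \<in> {0..tA}" "l \<in> {1..I}" for t l
    \<comment> \<open>At \<open>tA\<close> itself the inequality follows from earlier times by
      continuity; for \<open>tA = 0\<close> there are none, and the initial condition is
      used.\<close>
    proof (cases "tA = 0")
      case True
      then show ?thesis using init[OF tl(2)] small(2) tl by simp
    next
      case False
      show ?thesis
      proof (rule nonpos_on_interval_if_AE[of tA "\<lambda>t. \<psi> l t (x t)" "{tA}"])
        show "tA > 0" using False tAT by simp
        show "continuous_on {0..tA} (\<lambda>t. \<psi> l t (x t))" by (rule continuous_on_subset[OF cg[OF tl(2)]]) (use tAT in auto)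
        show "\<And>t. t \<in> {0..tA} - {tA} \<Longrightarrow> \<psi> l t (x t) \<le> \<delta>" using lt tl(2) tAT by (auto intro: less_imp_le)
      qed (use tl in auto)
    qed
    have "\<psi> l tA (x tA) \<le> \<sigma> + m" if l: "l \<in> {1..I}" for l
      by (rule step[OF tAT le l])
    then show False using tA(1) small(2) by (force simp: A_def)
  qed
  show ?thesis by (rule step[OF t _ i]) (use below t in auto)
qed

section \<open>Velocities of the limit curve\<close>

lemma pen_tendsto_0:
  fixes \<gamma> :: "'k \<Rightarrow> real"
  assumes \<gamma>: "\<And>k. \<gamma> k > 0" "filterlim \<gamma> at_top F" and c: "c > 0"
  shows "((\<lambda>k. \<gamma> k * exp (- (\<gamma> k * c))) \<longlongrightarrow> 0) F"
proof -
  have "((\<lambda>x::real. x ^ 1 / exp x) \<longlongrightarrow> 0) at_top" by (rule tendsto_power_div_exp_0)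
  then have 1: "((\<lambda>x::real. x * exp (- x)) \<longlongrightarrow> 0) at_top" by (simp add: exp_minus divide_inverse)
  have "filterlim (\<lambda>k. \<gamma> k * c) at_top F"
    by (rule filterlim_at_top_mult_tendsto_pos[OF tendsto_const[of c] c \<gamma>(2)])
  from filterlim_compose[OF 1 this]
  have "((\<lambda>k. (\<gamma> k * c) * exp (- (\<gamma> k * c)) / c) \<longlongrightarrow> 0 / c) F"
    by (intro tendsto_divide tendsto_const) (use c in auto)
  then show ?thesis using c by simp
qed

text \<open>Stated for general curves \<open>qk\<close> and drifts \<open>\<phi>\<close> so as to
  serve twice: with \<open>qk\<close> equal to \<open>xk\<close> and \<open>A\<close> the image of
  \<open>U\<close> under \<open>f t (x t)\<close>, and with a primitive subtracted from
  \<open>xk\<close> and \<open>A = {0}\<close>. Of \<open>qk\<close> pointwise convergence is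
  enough, because it enters only through increments.\<close>

lemma limit_velocity:
  fixes xk qk \<phi> :: "nat \<Rightarrow> real \<Rightarrow> 'a"
  assumes t: "t \<in> {0..<T}"
    and \<gamma>: "\<And>k. \<gamma> k > 0" "filterlim \<gamma> at_top sequentially" and \<sigma>: "\<sigma> \<longlonglongrightarrow> 0"
    and unif: "uniform_limit {0..T} xk x sequentially" and cont: "continuous_on {0..T} x"
    and xC: "x t \<in> C t"
    and pen_le: "\<And>k s i. s \<in> {0..T} \<Longrightarrow> i \<in> {1..I} \<Longrightarrow> pen (\<sigma> k) (\<gamma> k) i s (xk k s) \<le> \<Lambda>"
    and ac: "\<And>k. abs_cont_on 0 T (qk k)" and N: "\<And>k. negligible (N k)"
    and qder: "\<And>k s. s \<in> {0..T} - N k \<Longrightarrow> (qk k has_vector_derivative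
        \<phi> k s - (penalty (\<sigma> k) (\<gamma> k) s (xk k s))) (at s within {0..T})"
    and qlim: "\<And>s. s \<in> {0..T} \<Longrightarrow> (\<lambda>k. qk k s) \<longlonglongrightarrow> q s"
    and der: "(q has_vector_derivative d) (at t)"
    and near: "\<And>e. e > 0 \<Longrightarrow> \<forall>\<^sub>F (k, s) in joint_at t {0..T}.
        s \<notin> N k \<longrightarrow> (\<exists>a\<in>A. norm (\<phi> k s - a) \<le> e)"
    and A: "compact A" "convex A"
  obtains a where "a \<in> A" "a - d \<in> limiting_normal_cone (C t) (x t)"
proof -
  \<comment> \<open>Every lower bound in direction \<open>v\<close> for the candidate set is one for
    \<open>v \<bullet> d\<close>.\<close>
  have support: "b \<le> v \<bullet> d"
    if sup: "\<And>a l. a \<in> A \<Longrightarrow> (\<And>i. i \<in> {1..I} \<Longrightarrow> 0 \<le> l i \<and> l i \<le> (if \<psi> i t (x t) = 0 then \<Lambda> else 0)) \<Longrightarrow>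
        b \<le> v \<bullet> (a - (\<Sum>i=1..I. l i *\<^sub>R gr i t (x t)))" for v b
  proof (rule field_le_epsilon)
    fix e :: real assume e: "e > 0"
    have tT: "t \<in> {0..T}" using t by auto
    let ?F = "joint_at t {0..T}"
    define p where "p i z = (case z of (k, s) \<Rightarrow> pen (\<sigma> k) (\<gamma> k) i s (xk k s))" for i z
    define G where "G i z = (case z of (k, s) \<Rightarrow> gr i s (xk k s))" for i z
    have evT: "\<forall>\<^sub>F (k, s) in ?F. s \<in> {0..T}" by (rule eventually_joint_in)
    have fstF: "filterlim fst sequentially ?F" by (rule filterlim_fst)
    note pair = tendsto_graph_joint[OF unif cont tT]
    have evS: "\<forall>\<^sub>F z in ?F. (\<lambda>(k, s). (s, xk k s)) z \<in> S" using evT by eventually_elim auto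
    have comp: "((\<lambda>(k, s). h (s, xk k s)) \<longlongrightarrow> h (t, x t)) ?F" if h: "continuous_on S h" for h :: "real \<times> 'a \<Rightarrow> 'c::topological_space"
      using continuous_on_tendsto_compose[OF h pair _ evS] tT by (simp add: case_prod_unfold)
    have G: "(G i \<longlongrightarrow> gr i t (x t)) ?F" if i: "i \<in> {1..I}" for i
      using comp[OF continuous_on_gr(1)[OF i]] by (simp add: G_def[abs_def])
    have pnn: "p i z \<ge> 0" for i z using pen_pos[OF \<gamma>(1)] by (cases z) (simp add: p_def less_imp_le)
    have p0: "(p i \<longlongrightarrow> 0) ?F" if i: "i \<in> {1..I}" and inact: "\<psi> i t (x t) \<noteq> 0" for i
    proof -
      define c where "c = - \<psi> i t (x t) / 2"
      have c: "c > 0" using xC i inact by (force simp: c_def in_C_iff)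
      have "((\<lambda>(k, s). \<psi> i s (xk k s)) \<longlongrightarrow> \<psi> i t (x t)) ?F"
        using comp[OF continuous_on_psi[OF i]] by simp
      moreover have "((\<lambda>z. \<sigma> (fst z)) \<longlongrightarrow> 0) ?F" by (rule filterlim_compose[OF \<sigma> fstF])
      ultimately have "((\<lambda>z. (\<lambda>(k, s). \<psi> i s (xk k s)) z - \<sigma> (fst z)) \<longlongrightarrow> \<psi> i t (x t) - 0) ?F" by (rule tendsto_diff)
      then have ev: "\<forall>\<^sub>F z in ?F. (\<lambda>(k, s). \<psi> i s (xk k s)) z - \<sigma> (fst z) < - c"
        by (rule order_tendstoD) (use c in \<open>simp add: c_def\<close>)
      have lim: "((\<lambda>z. \<gamma> (fst z) * exp (- (\<gamma> (fst z) * c))) \<longlongrightarrow> 0) ?F"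
        by (rule filterlim_compose[OF pen_tendsto_0[OF \<gamma> c] fstF])
      show ?thesis
      proof (rule tendsto_sandwich[OF _ _ tendsto_const lim])
        show "\<forall>\<^sub>F z in ?F. 0 \<le> p i z" using pnn by simp
        show "\<forall>\<^sub>F z in ?F. p i z \<le> \<gamma> (fst z) * exp (- (\<gamma> (fst z) * c))"
          using ev
        proof eventually_elim
          case (elim z)
          have "\<gamma> (fst z) * ((\<lambda>(k, s). \<psi> i s (xk k s)) z - \<sigma> (fst z)) \<le> \<gamma> (fst z) * (- c)"
            using elim \<gamma>(1)[of "fst z"] by (intro mult_left_mono) auto
          then show ?case using \<gamma>(1)[of "fst z"] by (cases z) (simp add: p_def pen_def)
        qed
      qed
    qed
    \<comment> \<open>Multipliers of inactive constraints tend to 0 by \<open>p0\<close> and are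
      dropped, which puts the weights into the box of the candidate set.\<close>
    define l where "l i z = (if \<psi> i t (x t) = 0 then p i z else 0)" for i z
    have diff0: "((\<lambda>z. p i z *\<^sub>R G i z - l i z *\<^sub>R gr i t (x t)) \<longlongrightarrow> 0) ?F" if i: "i \<in> {1..I}" for i
    proof (cases "\<psi> i t (x t) = 0")
      case True
      have "((\<lambda>z. G i z - gr i t (x t)) \<longlongrightarrow> 0) ?F" using G[OF i] by (simp add: LIM_zero)
      then have 1: "((\<lambda>z. \<Lambda> * norm (G i z - gr i t (x t))) \<longlongrightarrow> \<Lambda> * 0) ?F"
        by (intro tendsto_mult tendsto_const tendsto_norm_zero)
      have le: "\<forall>\<^sub>F z in ?F. norm (p i z *\<^sub>R (G i z - gr i t (x t))) \<le> \<Lambda> * norm (G i z - gr i t (x t))"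
        using evT
      proof eventually_elim
        case (elim z)
        have "p i z \<le> \<Lambda>" using elim pen_le i by (cases z) (auto simp: p_def)
        then show ?case using pnn[of i z] by (auto intro!: mult_right_mono)
      qed
      have "((\<lambda>z. p i z *\<^sub>R (G i z - gr i t (x t))) \<longlongrightarrow> 0) ?F"
        using le 1[unfolded mult_zero_right] by (rule Lim_null_comparison)
      then show ?thesis using True by (simp add: l_def scaleR_diff_right)
    next
      case False
      have "((\<lambda>z. p i z *\<^sub>R G i z) \<longlongrightarrow> 0 *\<^sub>R gr i t (x t)) ?F" by (rule tendsto_scaleR[OF p0[OF i False] G[OF i]])
      then show ?thesis using False by (simp add: l_def)
    qed
    have "((\<lambda>z. \<Sum>i=1..I. p i z *\<^sub>R G i z - l i z *\<^sub>R gr i t (x t)) \<longlongrightarrow> (\<Sum>i=1..I. 0)) ?F"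
      by (intro tendsto_sum diff0)
    then have err0: "((\<lambda>z. \<Sum>i=1..I. p i z *\<^sub>R G i z - l i z *\<^sub>R gr i t (x t)) \<longlongrightarrow> 0) ?F" by simp
    \<comment> \<open>One share for the drift, one for the penalty; the added 1 covers
      \<open>v = 0\<close>.\<close>
    define e' where "e' = e / (norm v + 1) / 2"
    have vp: "norm v + 1 > 0" by (simp add: add_nonneg_pos)
    have e': "e' > 0" using e vp by (simp add: e'_def)
    have ve: "norm v * (e' + e') \<le> e"
    proof -
      have "norm v * (e' + e') \<le> (norm v + 1) * (e' + e')" using e' by (intro mult_right_mono) auto
      also have "\<dots> = e"
      proof -
        have "e' + e' = e / (norm v + 1)" unfolding e'_def by (rule field_sum_of_halves)
        then show ?thesis using vp by simp
      qed
      finally show ?thesis .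
    qed
    have "\<forall>\<^sub>F z in ?F. dist (\<Sum>i=1..I. p i z *\<^sub>R G i z - l i z *\<^sub>R gr i t (x t)) 0 < e'"
      using err0 e' by (rule tendstoD)
    with near[OF e'] evT have "\<forall>\<^sub>F (k, s) in ?F. s \<notin> N k \<longrightarrow>
        b - e \<le> v \<bullet> (\<phi> k s - (penalty (\<sigma> k) (\<gamma> k) s (xk k s)))"
    proof eventually_elim
      case (elim z)
      obtain k s where z: "z = (k, s)" by (cases z)
      show ?case unfolding z prod.case
      proof
        assume "s \<notin> N k"
        then obtain a where a: "a \<in> A" "norm (\<phi> k s - a) \<le> e'" using elim(1) by (auto simp: z)
        define y where "y = (\<Sum>i=1..I. l i z *\<^sub>R gr i t (x t))"
        define w where "w = (penalty (\<sigma> k) (\<gamma> k) s (xk k s))"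
        have wy: "norm (w - y) \<le> e'"
          using elim(3) by (simp add: w_def y_def z p_def G_def sum_subtractf)
        have "0 \<le> l i z \<and> l i z \<le> (if \<psi> i t (x t) = 0 then \<Lambda> else 0)" if i: "i \<in> {1..I}" for i
          using pnn[of i z] pen_le[OF _ i] elim(2) by (auto simp: l_def p_def z)
        then have 1: "b \<le> v \<bullet> (a - y)" unfolding y_def by (rule sup[OF a(1)])
        have "v \<bullet> ((a - y) - (\<phi> k s - w)) \<le> norm v * norm ((a - y) - (\<phi> k s - w))" by (rule norm_cauchy_schwarz)
        also have "norm ((a - y) - (\<phi> k s - w)) \<le> e' + e'"
        proof -
          have eq: "(a - y) - (\<phi> k s - w) = (w - y) - (\<phi> k s - a)" by simp
          show ?thesis unfolding eq using norm_triangle_ineq4[of "w - y" "\<phi> k s - a"] a(2) wy by linarith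
        qed
        then have "norm v * norm ((a - y) - (\<phi> k s - w)) \<le> norm v * (e' + e')" by (rule mult_left_mono) simp
        finally show "b - e \<le> v \<bullet> (\<phi> k s - w)" using 1 ve unfolding inner_diff_right by linarith
      qed
    qed
    then obtain K \<delta> where \<delta>: "\<delta> > 0" and K: "\<And>k s. k \<ge> K \<Longrightarrow> s \<in> {0..T} \<Longrightarrow> dist s t < \<delta> \<Longrightarrow> s \<notin> N k \<Longrightarrow>
        b - e \<le> v \<bullet> (\<phi> k s - (penalty (\<sigma> k) (\<gamma> k) s (xk k s)))"
      by (rule eventually_prod_at_within_sequentially) blast
    \<comment> \<open>For each large \<open>k\<close> the velocity bound becomes a bound on the
      increment over \<open>{t..t + h}\<close>, with \<open>h\<close> independent of
      \<open>k\<close>; then \<open>k\<close> tends to infinity. The sign of \<open>v\<close> is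
      reversed inside because the growth bound is an upper one.\<close>
    have incr: "(b - e) * h \<le> v \<bullet> (q (t + h) - q t)" if h: "h > 0" "h < \<delta>" "t + h \<le> T" for h
    proof (rule LIMSEQ_le_const)
      have "t + h \<in> {0..T}" using h t by auto
      then show "(\<lambda>k. v \<bullet> (qk k (t + h) - qk k t)) \<longlonglongrightarrow> v \<bullet> (q (t + h) - q t)"
        by (intro tendsto_intros qlim tT)
      have "(b - e) * h \<le> v \<bullet> (qk k (t + h) - qk k t)" if k: "k \<ge> K" for k
      proof -
        have "qk k (t + h) \<bullet> (- v) - qk k t \<bullet> (- v) \<le> - (b - e) * (t + h - t)"
        proof (rule abs_cont_on_growth_le[OF _ _ N[of k]])
          show "t \<le> t + h" using h by simp
          show "abs_cont_on t (t + h) (\<lambda>s. qk k s \<bullet> (- v))"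
            by (rule abs_cont_on_inner_left, rule abs_cont_on_subset[OF ac]) (use h t in auto)
          fix s assume s: "s \<in> {t..t + h} - N k"
          then have sT: "s \<in> {0..T}" "s \<in> {0..T} - N k" "dist s t < \<delta>" using h t by (auto simp: dist_real_def)
          let ?d = "\<phi> k s - (penalty (\<sigma> k) (\<gamma> k) s (xk k s))"
          have "((\<lambda>s. qk k s \<bullet> (- v)) has_vector_derivative ?d \<bullet> (- v)) (at s within {0..T})"
            by (rule bounded_linear.has_vector_derivative[OF bounded_linear_inner_left qder[OF sT(2)]])
          then have "((\<lambda>s. qk k s \<bullet> (- v)) has_real_derivative ?d \<bullet> (- v)) (at s within {t..t + h})"
            unfolding has_real_derivative_iff_has_vector_derivative
            by (rule has_vector_derivative_within_subset) (use h t in auto)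
          moreover have "?d \<bullet> (- v) \<le> - (b - e)" using K[OF k sT(1,3)] s by (simp add: inner_commute)
          ultimately show "\<exists>d\<le>- (b - e). ((\<lambda>s. qk k s \<bullet> (- v)) has_real_derivative d) (at s within {t..t + h})" by blast
        qed
        then show ?thesis by (simp add: inner_diff_right inner_commute algebra_simps)
      qed
      then show "\<exists>N. \<forall>k\<ge>N. (b - e) * h \<le> v \<bullet> (qk k (t + h) - qk k t)" by blast
    qed
    show "b \<le> v \<bullet> d + e"
    proof (rule ccontr)
      assume "\<not> ?thesis"
      then have lt: "v \<bullet> d < b - e" by simp
      have "((\<lambda>h. t + h) has_vector_derivative 1) (at_right 0)" by (auto intro!: derivative_eq_intros)
      moreover have "(q has_vector_derivative d) (at (t + 0) within (\<lambda>h. t + h) ` {0<..})"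
        using der has_vector_derivative_at_within by auto
      ultimately have "((\<lambda>h. q (t + h)) has_vector_derivative d) (at_right 0)"
        using vector_diff_chain_within[of "\<lambda>h. t + h" 1 0 "{0<..}" q d] by (simp add: comp_def)
      then have "((\<lambda>h. v \<bullet> q (t + h)) has_vector_derivative v \<bullet> d) (at_right 0)"
        by (rule bounded_linear.has_vector_derivative[OF bounded_linear_inner_right])
      then have "((\<lambda>h. v \<bullet> q (t + h)) has_real_derivative v \<bullet> d) (at_right 0)"
        by (simp add: has_real_derivative_iff_has_vector_derivative)
      from eventually_less_of_derivative[OF this lt]
      have "\<forall>\<^sub>F h in at_right 0. v \<bullet> q (t + h) < v \<bullet> q t + (b - e) * h" by simp
      moreover have "\<forall>\<^sub>F h in at_right 0. h > 0 \<and> h < \<delta> \<and> t + h \<le> T"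
        by (rule eventually_at_rightI[of 0 "min \<delta> (T - t)"]) (use \<delta> t in auto)
      ultimately have "\<forall>\<^sub>F h in at_right (0::real). False"
      proof eventually_elim
        case (elim h)
        then show False using incr[of h] by (simp add: inner_diff_right)
      qed
      then show False by simp
    qed
  qed
  let ?bd = "\<lambda>i. if \<psi> i t (x t) = 0 then \<Lambda> else 0"
  let ?P = "{\<Sum>i\<in>{1..I}. l i *\<^sub>R gr i t (x t) |l. \<forall>i\<in>{1..I}. 0 \<le> l i \<and> l i \<le> ?bd i}"
  let ?S = "{a - y |a y. a \<in> A \<and> y \<in> ?P}"
  have P: "compact ?P" "convex ?P"
    using box_combinations_compact_convex[where J="{1..I}" and b="?bd" and g="\<lambda>i. gr i t (x t)"] by auto
  have cS: "compact ?S" using A(1) P(1) by (rule compact_differences)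
  have "convex (\<Union>a\<in>A. \<Union>y\<in>?P. {a - y})" using A(2) P(2) by (rule convex_differences)
  moreover have "(\<Union>a\<in>A. \<Union>y\<in>?P. {a - y}) = ?S" by blast
  ultimately have vS: "convex ?S" by (simp only:)
  have "d \<in> ?S"
  proof (rule ccontr)
    assume "d \<notin> ?S"
    from separating_hyperplane_closed_point[OF vS compact_imp_closed[OF cS] this]
    obtain v b where sep: "v \<bullet> d < b \<and> (\<forall>y\<in>?S. b < v \<bullet> y)" by (elim exE)
    have vb: "v \<bullet> d < b" "\<And>y. y \<in> ?S \<Longrightarrow> b < v \<bullet> y"
      by (rule conjunct1[OF sep], rule bspec[OF conjunct2[OF sep]])
    have "b \<le> v \<bullet> d"
    proof (rule support)
      fix a l assume a: "a \<in> A" and l: "\<And>i. i \<in> {1..I} \<Longrightarrow> 0 \<le> l i \<and> l i \<le> ?bd i"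
      have "(\<Sum>i\<in>{1..I}. l i *\<^sub>R gr i t (x t)) \<in> ?P" using l by blast
      then have "a - (\<Sum>i\<in>{1..I}. l i *\<^sub>R gr i t (x t)) \<in> ?S" using a by blast
      then show "b \<le> v \<bullet> (a - (\<Sum>i=1..I. l i *\<^sub>R gr i t (x t)))" by (rule less_imp_le[OF vb(2)])
    qed
    then show False using vb(1) by simp
  qed
  then obtain a l where al: "a \<in> A" "d = a - (\<Sum>i\<in>{1..I}. l i *\<^sub>R gr i t (x t))" "\<forall>i\<in>{1..I}. 0 \<le> l i \<and> l i \<le> ?bd i"
    by blast
  have "(\<Sum>i=1..I. l i *\<^sub>R gr i t (x t)) \<in> limiting_normal_cone (C t) (x t)"
    by (rule active_gradients_normal) (use t xC al(3) in \<open>force+\<close>)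
  then show thesis using al(1,2) by (intro that[of a]) auto
qed

end

section \<open>Caratheodory solutions and measurable selections\<close>

lemma bounded_measurable_primitive:
  fixes g :: "real \<Rightarrow> 'a::euclidean_space"
  assumes T: "T \<ge> 0" and g: "g \<in> borel_measurable (lebesgue_on {0..T})" and B: "\<And>s. s \<in> {0..T} \<Longrightarrow> norm (g s) \<le> B"
  shows "g integrable_on {0..T}"
    and "B-lipschitz_on {0..T} (\<lambda>t. integral {0..t} g)"
    and "\<exists>N. negligible N \<and> (\<forall>t\<in>{0..T} - N. ((\<lambda>t. integral {0..t} g) has_vector_derivative g t) (at t within {0..T}))"
proof -
  have B0: "B \<ge> 0" using B[of 0] T norm_ge_zero[of "g 0"] by (simp del: norm_ge_zero)
  show int: "g integrable_on {0..T}"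
    by (rule measurable_bounded_by_integrable_imp_integrable[OF g, of "\<lambda>_. B"]) (use B in auto)
  have sub: "g integrable_on {a..b}" if "0 \<le> a" "b \<le> T" for a b
    using integrable_on_subinterval[OF int, of a b] that by auto
  have comb: "integral {0..b} g - integral {0..a} g = integral {a..b} g" if "0 \<le> a" "a \<le> b" "b \<le> T" for a b
    using Henstock_Kurzweil_Integration.integral_combine[of 0 a b g] that sub[of 0 b] by (simp add: algebra_simps)
  have inc: "norm (integral {0..b} g - integral {0..a} g) \<le> B * (b - a)" if ab: "0 \<le> a" "a \<le> b" "b \<le> T" for a b
  proof -
    have "norm (integral {a..b} g) \<le> integral {a..b} (\<lambda>_. B)"
      by (rule integral_norm_bound_integral) (use sub[of a b] B ab in auto)
    then show ?thesis unfolding comb[OF ab] using ab by (simp add: mult.commute)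
  qed
  show "B-lipschitz_on {0..T} (\<lambda>t. integral {0..t} g)"
  proof (rule lipschitz_onI[OF _ B0])
    fix s t assume "s \<in> {0..T}" "t \<in> {0..T}"
    then show "dist (integral {0..s} g) (integral {0..t} g) \<le> B * dist s t"
      using inc[of s t] inc[of t s] by (cases "s \<le> t") (auto simp: dist_norm norm_minus_commute)
  qed
  \<comment> \<open>Extended by 0 to the line, and set to 0 also at time 0 so that it vanishes
    identically on the nonpositive half-line; a single point does not affect the integrals.\<close>
  define h where "h s = (if s \<in> {0<..T} then g s else 0)" for s
  have hg: "h s = g s" if "s \<in> {0..T} - {0}" for s using that by (auto simp: h_def)
  have hint0: "h integrable_on {0..T}"
    by (rule integrable_spike[OF int negligible_sing[of 0]]) (use hg in auto)
  have hint: "h integrable_on {a..b}" for a b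
  proof -
    have "(\<lambda>s. if s \<in> {0..T} then h s else 0) integrable_on UNIV"
      using hint0 by (simp only: integrable_restrict_UNIV)
    moreover have "(\<lambda>s. if s \<in> {0..T} then h s else 0) = h" by (auto simp: h_def)
    ultimately have "h integrable_on UNIV" by simp
    then show ?thesis using integrable_on_subcbox[of h UNIV a b] by simp
  qed
  have neg: "integral {a..b} h = 0" if "b \<le> 0" for a b
  proof -
    have "integral {a..b} h = integral {a..b} (\<lambda>_. 0)"
      by (rule integral_cong) (use that in \<open>auto simp: h_def\<close>)
    then show ?thesis by simp
  qed
  define F where "F t = integral {0..t} h" for t
  have "F b - F a = integral {a..b} h" if ab: "a \<le> b" for a b
  proof -
    consider "0 \<le> a" | "a < 0" "0 \<le> b" | "b < 0" by linarith
    then show ?thesis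
    proof cases
      case 1
      then show ?thesis
        using Henstock_Kurzweil_Integration.integral_combine[of 0 a b h] ab hint by (simp add: F_def algebra_simps)
    next
      case 2
      then show ?thesis
        using Henstock_Kurzweil_Integration.integral_combine[of a 0 b h] hint neg[of 0 a] by (simp add: F_def)
    next
      case 3
      then show ?thesis using neg[of b a] ab by (simp add: F_def)
    qed
  qed
  then obtain N where N: "negligible N" "\<And>t. t \<notin> N \<Longrightarrow> (F has_vector_derivative h t) (at t)"
    using indefinite_integral_has_vector_derivative_AE[OF hint, of F] by blast
  have FG: "F t = integral {0..t} g" if "t \<in> {0..T}" for t
    unfolding F_def by (rule integral_spike[OF negligible_sing[of 0]]) (use hg that in auto)
  show "\<exists>N. negligible N \<and> (\<forall>t\<in>{0..T} - N. ((\<lambda>t. integral {0..t} g) has_vector_derivative g t) (at t within {0..T}))"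
  proof (intro exI[of _ "N \<union> {0}"] conjI ballI)
    show "negligible (N \<union> {0})" using N by simp
    fix t assume t: "t \<in> {0..T} - (N \<union> {0})"
    then have "(F has_vector_derivative h t) (at t within {0..T})" using N(2) has_vector_derivative_at_within by blast
    then have "((\<lambda>t. integral {0..t} g) has_vector_derivative h t) (at t within {0..T})"
      by (rule has_vector_derivative_transform[rotated 2]) (use t FG in auto)
    then show "((\<lambda>t. integral {0..t} g) has_vector_derivative g t) (at t within {0..T})"
      using hg[of t] t by simp
  qed
qed

text \<open>The weight \<open>exp (- 2 K t)\<close> makes the integral operator a contraction on all of \<open>[0, T]\<close> at once.\<close>

lemma caratheodory_lipschitz_solution:
  fixes F :: "real \<Rightarrow> 'a::euclidean_space \<Rightarrow> 'a"
  assumes T: "T \<ge> 0" and K: "K \<ge> 0"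
    and lip: "\<And>s x y. s \<in> {0..T} \<Longrightarrow> norm (F s x - F s y) \<le> K * norm (x - y)"
    and bd: "\<And>s x. s \<in> {0..T} \<Longrightarrow> norm (F s x) \<le> B"
    and meas: "\<And>y. continuous_on {0..T} y \<Longrightarrow> (\<lambda>s. F s (y s)) \<in> borel_measurable (lebesgue_on {0..T})"
  obtains y N where "y 0 = b" "B-lipschitz_on {0..T} y" "negligible N"
    "\<And>t. t \<in> {0..T} - N \<Longrightarrow> (y has_vector_derivative F t (y t)) (at t within {0..T})"
proof -
  \<comment> \<open>Clamping the time makes the iterates bounded continuous functions on the whole
    line, elements of the complete space on which the fixed point theorem is applied.\<close>
  define c where "c t = max 0 (min T t)" for t
  have c: "c t \<in> {0..T}" for t using T by (auto simp: c_def)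
  have cc: "continuous_on UNIV c" unfolding c_def[abs_def] by (intro continuous_intros)
  \<comment> \<open>The unknown \<open>z\<close> is the weighted solution; the solution itself is
    recovered by the factor \<open>exp (2 * K * s)\<close>.\<close>
  define G where "G z s = F s (exp (2 * K * s) *\<^sub>R apply_bcontfun z s)" for z s
  have Gm: "G z \<in> borel_measurable (lebesgue_on {0..T})" for z
    unfolding G_def[abs_def] by (rule meas) (intro continuous_intros continuous_on_apply_bcontfun)
  have Gb: "norm (G z s) \<le> B" if "s \<in> {0..T}" for z s using bd that by (simp add: G_def)
  note prim = bounded_measurable_primitive[OF T Gm Gb]
  have Gint: "G z integrable_on {0..c t}" for z t
    by (rule integrable_on_subinterval[OF prim(1)]) (use c[of t] in auto)
  define \<Phi> where "\<Phi> z t = exp (- (2 * K * c t)) *\<^sub>R (b + integral {0..c t} (G z))" for z t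
  have B0: "B \<ge> 0"
  proof -
    have "norm (F 0 0) \<le> B" using bd T by simp
    then show ?thesis using norm_ge_zero[of "F 0 0"] by linarith
  qed
  have "\<Phi> z \<in> bcontfun" for z
  proof -
    have "continuous_on UNIV (\<lambda>t. integral {0..c t} (G z))"
      by (rule continuous_on_compose2[OF lipschitz_on_continuous_on[OF prim(2)] cc]) (use c in auto)
    then have "continuous_on UNIV (\<Phi> z)"
      unfolding \<Phi>_def[abs_def] by (intro continuous_intros cc)
    moreover have "bounded (range (\<Phi> z))"
      unfolding bounded_iff
    proof (intro exI ballI)
      fix v assume "v \<in> range (\<Phi> z)"
      then obtain t where v: "v = \<Phi> z t" by blast
      have "norm (integral {0..c t} (G z)) \<le> B * T"
      proof -
        have "norm (integral {0..c t} (G z) - integral {0..0} (G z)) \<le> B * \<bar>c t - 0\<bar>"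
          using lipschitz_onD[OF prim(2), of "c t" 0] c[of t] T by (simp add: dist_norm)
        also have "\<dots> \<le> B * T" using c[of t] B0 by (intro mult_left_mono) auto
        finally show ?thesis by simp
      qed
      then have 1: "norm (b + integral {0..c t} (G z)) \<le> norm b + B * T"
        using norm_triangle_ineq[of b "integral {0..c t} (G z)"] by linarith
      have "exp (- (2 * K * c t)) \<le> 1" using K c[of t] by simp
      then have "exp (- (2 * K * c t)) * norm (b + integral {0..c t} (G z)) \<le> 1 * (norm b + B * T)"
        using 1 by (intro mult_mono) auto
      then show "norm v \<le> norm b + B * T" by (simp add: v \<Phi>_def)
    qed
    ultimately show ?thesis by (simp add: bcontfun_def)
  qed
  then have ap: "apply_bcontfun (Bcontfun (\<Phi> z)) = \<Phi> z" for z by (simp add: Bcontfun_inverse)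
  have contr: "dist (Bcontfun (\<Phi> z)) (Bcontfun (\<Phi> w)) \<le> 1 / 2 * dist z w" for z w
  proof (rule dist_bound)
    fix t
    define D where "D = dist z w"
    have D: "norm (apply_bcontfun z s - apply_bcontfun w s) \<le> D" for s
      using dist_bounded[of z s w] by (simp add: D_def dist_norm)
    have D0: "D \<ge> 0" by (simp add: D_def)
    \<comment> \<open>Integration divides the weight by \<open>2 * K\<close>, which cancels the
      Lipschitz constant and leaves the contraction factor 1/2.\<close>
    have I: "((\<lambda>s. K * exp (2 * K * s) * D) has_integral (D / 2 * exp (2 * K * c t) - D / 2 * exp (2 * K * 0))) {0..c t}"
      by (rule fundamental_theorem_of_calculus)
        (use c[of t] in \<open>auto intro!: derivative_eq_intros simp flip: has_real_derivative_iff_has_vector_derivative\<close>)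
    have "norm (integral {0..c t} (\<lambda>s. G z s - G w s)) \<le> integral {0..c t} (\<lambda>s. K * exp (2 * K * s) * D)"
    proof (rule integral_norm_bound_integral)
      show "(\<lambda>s. G z s - G w s) integrable_on {0..c t}" by (intro integrable_diff Gint)
      show "(\<lambda>s. K * exp (2 * K * s) * D) integrable_on {0..c t}" using I by blast
      fix s assume "s \<in> {0..c t}"
      then have s: "s \<in> {0..T}" using c[of t] by auto
      have "norm (G z s - G w s) \<le> K * norm (exp (2 * K * s) *\<^sub>R apply_bcontfun z s - exp (2 * K * s) *\<^sub>R apply_bcontfun w s)"
        unfolding G_def by (rule lip[OF s])
      also have "\<dots> = K * exp (2 * K * s) * norm (apply_bcontfun z s - apply_bcontfun w s)"
        by (simp add: scaleR_diff_right[symmetric])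
      also have "\<dots> \<le> K * exp (2 * K * s) * D" using D K by (intro mult_left_mono) auto
      finally show "norm (G z s - G w s) \<le> K * exp (2 * K * s) * D" .
    qed
    also have "\<dots> = D / 2 * exp (2 * K * c t) - D / 2" using integral_unique[OF I] by simp
    finally have 1: "norm (integral {0..c t} (\<lambda>s. G z s - G w s)) \<le> D / 2 * exp (2 * K * c t)" using D0 by simp
    have "\<Phi> z t - \<Phi> w t = exp (- (2 * K * c t)) *\<^sub>R integral {0..c t} (\<lambda>s. G z s - G w s)"
      using Henstock_Kurzweil_Integration.integral_diff[OF Gint[of z t] Gint[of w t]] by (simp add: \<Phi>_def scaleR_diff_right[symmetric])
    then have "norm (\<Phi> z t - \<Phi> w t) = exp (- (2 * K * c t)) * norm (integral {0..c t} (\<lambda>s. G z s - G w s))" by simp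
    also have "\<dots> \<le> exp (- (2 * K * c t)) * (D / 2 * exp (2 * K * c t))" using 1 by (intro mult_left_mono) auto
    also have "\<dots> = D / 2 * (exp (- (2 * K * c t)) * exp (2 * K * c t))" by (simp only: mult_ac)
    also have "exp (- (2 * K * c t)) * exp (2 * K * c t) = 1" by (simp add: exp_minus)
    finally show "dist (apply_bcontfun (Bcontfun (\<Phi> z)) t) (apply_bcontfun (Bcontfun (\<Phi> w)) t) \<le> 1 / 2 * dist z w"
      by (simp add: ap dist_norm D_def)
  qed
  obtain z where z: "Bcontfun (\<Phi> z) = z"
    using banach_fix_type[of "1 / 2" "\<lambda>z. Bcontfun (\<Phi> z)"] contr by auto
  have zt: "apply_bcontfun z t = \<Phi> z t" for t using ap[of z] z by simp
  define y where "y t = exp (2 * K * t) *\<^sub>R apply_bcontfun z t" for t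
  have Gy: "G z = (\<lambda>s. F s (y s))" by (simp add: G_def[abs_def] y_def)
  have y: "y t = b + integral {0..t} (G z)" if "t \<in> {0..T}" for t
  proof -
    have ct: "c t = t" using that by (auto simp: c_def)
    have "y t = (exp (2 * K * t) * exp (- (2 * K * t))) *\<^sub>R (b + integral {0..t} (G z))"
      by (simp only: y_def zt \<Phi>_def ct scaleR_scaleR)
    also have "exp (2 * K * t) * exp (- (2 * K * t)) = 1" by (simp add: exp_minus)
    finally show ?thesis by simp
  qed
  obtain N where N: "negligible N" "\<forall>t\<in>{0..T} - N. ((\<lambda>t. integral {0..t} (G z)) has_vector_derivative G z t) (at t within {0..T})"
    using prim(3)[of z] by blast
  show thesis
  proof (rule that)
    show "y 0 = b" using y[of 0] T by simp
    show "B-lipschitz_on {0..T} y"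
      by (rule lipschitz_on_transform[where f="\<lambda>t. b + integral {0..t} (G z)"])
        (use lipschitz_on_add[OF lipschitz_on_constant prim(2)] y in auto)
    show "negligible N" by (fact N(1))
    fix t assume t: "t \<in> {0..T} - N"
    have "((\<lambda>t. b + integral {0..t} (G z)) has_vector_derivative 0 + G z t) (at t within {0..T})"
      using N(2) t by (intro has_vector_derivative_add has_vector_derivative_const) blast
    then have "(y has_vector_derivative 0 + G z t) (at t within {0..T})"
      by (rule has_vector_derivative_transform[rotated 2]) (use t y in auto)
    then show "(y has_vector_derivative F t (y t)) (at t within {0..T})" by (simp add: Gy)
  qed
qed

text \<open>Selecting successively the minimizers of the coordinates leaves a single point. Each step
  preserves the measurability of the hitting sets of compact sets, because the minimum over
  \<open>\<Gamma> t \<inter> K\<close> equals the minimum over \<open>\<Gamma> t\<close> iff every rational sublevel set that meets \<open>\<Gamma> t\<close>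
  also meets \<open>\<Gamma> t \<inter> K\<close>.\<close>

lemma measurable_selection_compact:
  fixes \<Gamma> :: "'t \<Rightarrow> 'b::euclidean_space set"
  assumes comp: "\<And>t. t \<in> space M \<Longrightarrow> compact (\<Gamma> t) \<and> \<Gamma> t \<noteq> {}"
    and U: "compact U" "\<And>t. t \<in> space M \<Longrightarrow> \<Gamma> t \<subseteq> U"
    and hit: "\<And>K. compact K \<Longrightarrow> {t \<in> space M. \<Gamma> t \<inter> K \<noteq> {}} \<in> sets M"
  obtains u where "u \<in> borel_measurable M" "\<And>t. t \<in> space M \<Longrightarrow> u t \<in> \<Gamma> t"
proof -
  \<comment> \<open>The last clause says that the coordinates in \<open>B\<close> are already
    determined; the induction enlarges this set \<open>B\<close>.\<close>
  define P where "P B \<Gamma>' \<longleftrightarrow> (\<forall>t\<in>space M. compact (\<Gamma>' t) \<and> \<Gamma>' t \<noteq> {} \<and> \<Gamma>' t \<subseteq> \<Gamma> t) \<and>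
      (\<forall>K. compact K \<longrightarrow> {t \<in> space M. \<Gamma>' t \<inter> K \<noteq> {}} \<in> sets M) \<and>
      (\<forall>t\<in>space M. \<forall>b\<in>B. \<forall>x\<in>\<Gamma>' t. \<forall>y\<in>\<Gamma>' t. x \<bullet> b = y \<bullet> b)" for B \<Gamma>'
  have ex: "\<exists>\<Gamma>'. P B \<Gamma>'" if "finite B" for B :: "'b set"
    using that
  proof (induction B)
    case empty
    show ?case using comp hit by (intro exI[of _ \<Gamma>]) (simp add: P_def)
  next
    case (insert b B)
    then obtain \<Gamma>' where "P B \<Gamma>'" by blast
    note P = this[unfolded P_def]
    have 1: "\<And>t. t \<in> space M \<Longrightarrow> compact (\<Gamma>' t)" "\<And>t. t \<in> space M \<Longrightarrow> \<Gamma>' t \<noteq> {}" "\<And>t. t \<in> space M \<Longrightarrow> \<Gamma>' t \<subseteq> \<Gamma> t"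
      and 2: "\<And>K. compact K \<Longrightarrow> {t \<in> space M. \<Gamma>' t \<inter> K \<noteq> {}} \<in> sets M"
      and 3: "\<And>t b x y. t \<in> space M \<Longrightarrow> b \<in> B \<Longrightarrow> x \<in> \<Gamma>' t \<Longrightarrow> y \<in> \<Gamma>' t \<Longrightarrow> x \<bullet> b = y \<bullet> b"
      using conjunct1[OF P] conjunct1[OF conjunct2[OF P]] conjunct2[OF conjunct2[OF P]] by blast+
    define \<Delta> where "\<Delta> t = {x \<in> \<Gamma>' t. \<forall>y\<in>\<Gamma>' t. x \<bullet> b \<le> y \<bullet> b}" for t
    have min: "\<exists>x\<in>K. \<forall>y\<in>K. x \<bullet> b \<le> y \<bullet> b" if "compact K" "K \<noteq> {}" for K
      by (rule continuous_attains_inf[OF that]) (intro continuous_intros)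
    have ne: "\<Delta> t \<noteq> {}" if "t \<in> space M" for t
      using min[OF 1(1,2)[OF that]] by (auto simp: \<Delta>_def)
    have cp: "compact (\<Delta> t)" if t: "t \<in> space M" for t
    proof -
      obtain x where x: "x \<in> \<Delta> t" using ne[OF t] by blast
      have "\<Delta> t = \<Gamma>' t \<inter> {y. y \<bullet> b \<le> x \<bullet> b}" using x by (auto simp: \<Delta>_def intro: order_trans)
      moreover have "closed {y. y \<bullet> b \<le> x \<bullet> b}" by (intro closed_Collect_le continuous_intros)
      ultimately show ?thesis using 1(1)[OF t] by (simp add: compact_Int_closed)
    qed
    have "{t \<in> space M. \<Delta> t \<inter> K \<noteq> {}} \<in> sets M" if K: "compact K" for K
    proof -
      \<comment> \<open>Half-spaces are intersected with \<open>U\<close> or \<open>K\<close>, since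
        measurability is available for hitting sets of compact sets.\<close>
      define H where "H q = {y. y \<bullet> b \<le> q}" for q
      have clH: "closed (H q)" for q unfolding H_def by (intro closed_Collect_le continuous_intros)
      have "\<Delta> t \<inter> K \<noteq> {} \<longleftrightarrow> \<Gamma>' t \<inter> K \<noteq> {} \<and> (\<forall>q\<in>\<rat>. \<Gamma>' t \<inter> (U \<inter> H q) \<noteq> {} \<longrightarrow> \<Gamma>' t \<inter> (K \<inter> H q) \<noteq> {})"
        if t: "t \<in> space M" for t
      proof
        assume "\<Delta> t \<inter> K \<noteq> {}"
        then obtain x where "x \<in> \<Delta> t" "x \<in> K" by blast
        then show "\<Gamma>' t \<inter> K \<noteq> {} \<and> (\<forall>q\<in>\<rat>. \<Gamma>' t \<inter> (U \<inter> H q) \<noteq> {} \<longrightarrow> \<Gamma>' t \<inter> (K \<inter> H q) \<noteq> {})"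
          by (fastforce simp: \<Delta>_def H_def)
      next
        assume R: "\<Gamma>' t \<inter> K \<noteq> {} \<and> (\<forall>q\<in>\<rat>. \<Gamma>' t \<inter> (U \<inter> H q) \<noteq> {} \<longrightarrow> \<Gamma>' t \<inter> (K \<inter> H q) \<noteq> {})"
        have "compact (\<Gamma>' t \<inter> K)" using 1(1)[OF t] K by (simp add: compact_Int)
        then obtain x where x: "x \<in> \<Gamma>' t" "x \<in> K" "\<And>y. y \<in> \<Gamma>' t \<inter> K \<Longrightarrow> x \<bullet> b \<le> y \<bullet> b"
          using min[of "\<Gamma>' t \<inter> K"] R by auto
        have "x \<bullet> b \<le> y \<bullet> b" if y: "y \<in> \<Gamma>' t" for y
        proof (rule ccontr)
          assume "\<not> x \<bullet> b \<le> y \<bullet> b"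
          then obtain q where q: "q \<in> \<rat>" "y \<bullet> b < q" "q < x \<bullet> b" using Rats_dense_in_real by (meson not_le)
          have "y \<in> \<Gamma>' t \<inter> (U \<inter> H q)" using y q 1(3)[OF t] U(2)[OF t] by (auto simp: H_def)
          then obtain z where "z \<in> \<Gamma>' t \<inter> (K \<inter> H q)" using R q(1) by blast
          then show False using x(3)[of z] q(3) by (auto simp: H_def)
        qed
        then show "\<Delta> t \<inter> K \<noteq> {}" using x by (auto simp: \<Delta>_def)
      qed
      then have "{t \<in> space M. \<Delta> t \<inter> K \<noteq> {}} = {t \<in> space M. \<Gamma>' t \<inter> K \<noteq> {}} \<inter>
          {t \<in> space M. \<forall>q\<in>\<rat>. (\<Gamma>' t \<inter> (U \<inter> H q) \<noteq> {} \<longrightarrow> \<Gamma>' t \<inter> (K \<inter> H q) \<noteq> {})}" by blast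
      moreover have "{t \<in> space M. \<forall>q\<in>\<rat>. (\<Gamma>' t \<inter> (U \<inter> H q) \<noteq> {} \<longrightarrow> \<Gamma>' t \<inter> (K \<inter> H q) \<noteq> {})} \<in> sets M"
      proof (rule sets.sets_Collect_countable_All'[OF _ countable_rat])
        fix q :: real
        have "{t \<in> space M. \<Gamma>' t \<inter> (U \<inter> H q) \<noteq> {}} \<in> sets M" "{t \<in> space M. \<Gamma>' t \<inter> (K \<inter> H q) \<noteq> {}} \<in> sets M"
          using U(1) K clH by (auto intro!: 2 compact_Int_closed)
        then show "{t \<in> space M. \<Gamma>' t \<inter> (U \<inter> H q) \<noteq> {} \<longrightarrow> \<Gamma>' t \<inter> (K \<inter> H q) \<noteq> {}} \<in> sets M"
          by (intro sets.sets_Collect_imp)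
      qed
      ultimately show ?thesis using 2[OF K] by (simp add: sets.Int)
    qed
    then have a2: "\<forall>K. compact K \<longrightarrow> {t \<in> space M. \<Delta> t \<inter> K \<noteq> {}} \<in> sets M" by simp
    have "\<Delta> t \<subseteq> \<Gamma> t" if "t \<in> space M" for t using 1(3)[OF that] by (auto simp: \<Delta>_def)
    with cp ne have a1: "\<forall>t\<in>space M. compact (\<Delta> t) \<and> \<Delta> t \<noteq> {} \<and> \<Delta> t \<subseteq> \<Gamma> t" by simp
    have "x \<bullet> b' = y \<bullet> b'"
      if "t \<in> space M" "b' \<in> insert b B" "x \<in> \<Delta> t" "y \<in> \<Delta> t" for t b' x y
      using that 3[of t b' x y] by (auto simp: \<Delta>_def intro: order_antisym)
    then have a3: "\<forall>t\<in>space M. \<forall>b\<in>insert b B. \<forall>x\<in>\<Delta> t. \<forall>y\<in>\<Delta> t. x \<bullet> b = y \<bullet> b"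
      by (intro ballI)
    show ?case unfolding P_def by (intro exI[of _ \<Delta>] conjI a1 a2 a3)
  qed
  obtain \<Gamma>' where "P Basis \<Gamma>'" using ex[OF finite_Basis] by blast
  note P = this[unfolded P_def]
  have 1: "\<And>t. t \<in> space M \<Longrightarrow> \<Gamma>' t \<noteq> {}" "\<And>t. t \<in> space M \<Longrightarrow> \<Gamma>' t \<subseteq> \<Gamma> t"
      and 2: "\<And>K. compact K \<Longrightarrow> {t \<in> space M. \<Gamma>' t \<inter> K \<noteq> {}} \<in> sets M"
      and 3: "\<And>t b x y. t \<in> space M \<Longrightarrow> b \<in> Basis \<Longrightarrow> x \<in> \<Gamma>' t \<Longrightarrow> y \<in> \<Gamma>' t \<Longrightarrow> x \<bullet> b = y \<bullet> b"
    using conjunct1[OF P] conjunct1[OF conjunct2[OF P]] conjunct2[OF conjunct2[OF P]] by blast+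
  define u where "u t = (SOME x. x \<in> \<Gamma>' t)" for t
  have u: "u t \<in> \<Gamma>' t" if "t \<in> space M" for t using 1(1)[OF that] unfolding u_def by (simp add: some_in_eq)
  \<comment> \<open>Once all coordinates are determined the sets are singletons, so the arbitrary
    choice is forced and its sublevel sets are hitting sets.\<close>
  have single: "x = u t" if "t \<in> space M" "x \<in> \<Gamma>' t" for t x
    using 3[OF that(1) _ that(2) u[OF that(1)]] by (rule euclidean_eqI)
  have "u \<in> borel_measurable M"
  proof (rule borel_measurable_euclidean_space[THEN iffD2], intro ballI)
    fix b :: 'b assume "b \<in> Basis"
    show "(\<lambda>t. u t \<bullet> b) \<in> borel_measurable M"
      unfolding borel_measurable_iff_le
    proof
      fix q
      have "closed {y. y \<bullet> b \<le> q}" by (intro closed_Collect_le continuous_intros)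
      then have "{t \<in> space M. \<Gamma>' t \<inter> (U \<inter> {y. y \<bullet> b \<le> q}) \<noteq> {}} \<in> sets M"
        using U(1) by (intro 2 compact_Int_closed)
      moreover have "{t \<in> space M. \<Gamma>' t \<inter> (U \<inter> {y. y \<bullet> b \<le> q}) \<noteq> {}} = {t \<in> space M. u t \<bullet> b \<le> q}"
        using u single 1(2) U(2) by (blast dest: subsetD)
      ultimately show "{t \<in> space M. u t \<bullet> b \<le> q} \<in> sets M" by simp
    qed
  qed
  then show thesis using that[of u] u 1(2) by blast
qed

section \<open>Convergence of the penalized solutions\<close>

lemma mu_fun_tendsto_0:
  assumes \<gamma>: "\<And>k. \<gamma> k > 0" "filterlim \<gamma> at_top F" and \<eta>: "\<eta> > 0"
  shows "((\<lambda>k. mu_fun \<mu> \<eta> (\<gamma> k)) \<longlongrightarrow> 0) F"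
proof (cases "\<mu> = 0")
  case True
  then show ?thesis by (simp add: mu_fun_def)
next
  case False
  \<comment> \<open>\<open>ln\<close> takes the same value at \<open>x\<close> and
    \<open>- x\<close>, so the limit holds for either sign of \<open>\<mu>\<close>.\<close>
  have ln_abs: "ln x = ln \<bar>x\<bar>" for x :: real by (cases "x \<ge> 0") (simp_all add: ln_minus)
  have eq: "mu_fun \<mu> \<eta> (\<gamma> k) = ln (\<bar>\<mu>\<bar> / \<eta>\<^sup>2) * inverse (\<gamma> k) - ln (\<gamma> k) / \<gamma> k" for k
  proof -
    have "ln (\<mu> / (\<eta>\<^sup>2 * \<gamma> k)) = ln \<bar>\<mu> / (\<eta>\<^sup>2 * \<gamma> k)\<bar>" by (rule ln_abs)
    also have "\<bar>\<mu> / (\<eta>\<^sup>2 * \<gamma> k)\<bar> = (\<bar>\<mu>\<bar> / \<eta>\<^sup>2) / \<gamma> k" using \<gamma>(1)[of k] \<eta> by (simp add: abs_mult)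
    also have "ln \<dots> = ln (\<bar>\<mu>\<bar> / \<eta>\<^sup>2) - ln (\<gamma> k)" by (rule ln_divide_pos) (use \<gamma>(1)[of k] \<eta> False in auto)
    finally have "ln (\<mu> / (\<eta>\<^sup>2 * \<gamma> k)) = ln (\<bar>\<mu>\<bar> / \<eta>\<^sup>2) - ln (\<gamma> k)" .
    then show ?thesis by (simp only: mu_fun_def right_diff_distrib divide_inverse mult_1_left mult.commute)
  qed
  have "((\<lambda>k. ln (\<bar>\<mu>\<bar> / \<eta>\<^sup>2) * inverse (\<gamma> k) - ln (\<gamma> k) / \<gamma> k) \<longlongrightarrow> ln (\<bar>\<mu>\<bar> / \<eta>\<^sup>2) * 0 - 0) F"
    by (intro tendsto_diff tendsto_mult tendsto_const filterlim_compose[OF tendsto_inverse_0_at_top \<gamma>(2)]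
        tendsto_inverse_0_at_top \<gamma>(2) filterlim_compose[OF ln_x_over_x_tendsto_0 \<gamma>(2)])
  then show ?thesis by (simp add: eq)
qed

lemma exp_mu_fun:
  assumes "\<gamma> > 0" "\<mu> > 0" "\<eta> > 0"
  shows "\<gamma> * exp (\<gamma> * mu_fun \<mu> \<eta> \<gamma>) = \<mu> / \<eta>\<^sup>2"
  using assms by (simp add: mu_fun_def)

lemma lipschitz_convergent_subsequence:
  fixes xs :: "nat \<Rightarrow> real \<Rightarrow> 'a::euclidean_space"
  assumes lip: "\<And>k. L-lipschitz_on {0..T} (xs k)" and bd: "\<And>k t. t \<in> {0..T} \<Longrightarrow> norm (xs k t) \<le> B"
  obtains s x where "strict_mono s" "uniform_limit {0..T} (\<lambda>k. xs (s k)) x sequentially"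
proof -
  have L: "L \<ge> 0" using lip by (rule lipschitz_on_nonneg)
  have eq: "\<exists>d>0. \<forall>n y. y \<in> {0..T} \<and> norm (x - y) < d \<longrightarrow> norm (xs n x - xs n y) < e" if "x \<in> {0..T}" "e > 0" for x e
  proof (intro exI[of _ "e / (L + 1)"] conjI allI impI)
    show "e / (L + 1) > 0" using that L by simp
    fix n y assume y: "y \<in> {0..T} \<and> norm (x - y) < e / (L + 1)"
    have "norm (xs n x - xs n y) \<le> L * norm (x - y)"
      using lipschitz_onD[OF lip that(1), of y n] y by (simp add: dist_norm)
    also have "\<dots> \<le> (L + 1) * norm (x - y)" by (intro mult_right_mono) auto
    also have "\<dots> < e" using y L by (simp add: pos_less_divide_eq mult.commute)
    finally show "norm (xs n x - xs n y) < e" .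
  qed
  obtain g and k :: "nat \<Rightarrow> nat" where gk: "strict_mono k" "\<And>e. 0 < e \<Longrightarrow> \<exists>N. \<forall>n x. n \<ge> N \<and> x \<in> {0..T} \<longrightarrow> norm (xs (k n) x - g x) < e"
    by (rule Arzela_Ascoli[OF compact_Icc bd eq]) (assumption | rule that)+
  have "uniform_limit {0..T} (\<lambda>n. xs (k n)) g sequentially"
    unfolding uniform_limit_iff eventually_sequentially dist_norm using gk(2) by blast
  then show thesis using gk(1) that by blast
qed

section \<open>Estimates uniform in the penalty parameters\<close>

context sweeping_data
begin

definition "safe \<delta> \<longleftrightarrow> \<delta> > 0 \<and> \<delta> \<le> \<beta> \<and> (\<forall>t\<in>{0..T}. \<forall>x. (\<forall>i\<in>{1..I}. \<psi> i t x \<le> \<delta>) \<longrightarrow>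
  (t, x) \<in> Q \<and> (\<exists>c\<in>C t. norm (x - c) \<le> 1))"

text \<open>The level \<open>\<sigma> + mu_fun \<mu> \<eta> \<gamma>\<close> may be negative. From
  \<open>- \<beta>\<close> on the lower bound for the gradients applies, and below
  \<open>\<delta>\<close> the bootstrap closes; both conditions hold for all large indices.\<close>

definition "tame \<delta> \<sigma> \<gamma> \<longleftrightarrow> \<gamma> > 0 \<and> - \<beta> \<le> \<sigma> + mu_fun \<mu> \<eta> \<gamma> \<and> \<sigma> + mu_fun \<mu> \<eta> \<gamma> < \<delta>"

text \<open>What the limit has to know about one penalized solution. \<open>L\<close> is meant to be
  chosen before \<open>\<sigma>\<close> and \<open>\<gamma>\<close>, which gives
  equicontinuity.\<close>

definition "pen_facts L \<sigma> \<gamma> u x N \<longleftrightarrow> L-lipschitz_on {0..T} x \<and> negligible N \<and>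
  (\<forall>t\<in>{0..T}. (t, x t) \<in> Q) \<and>
  (\<forall>t\<in>{0..T}. \<forall>i\<in>{1..I}. \<psi> i t (x t) \<le> \<sigma> + mu_fun \<mu> \<eta> \<gamma>) \<and>
  (\<forall>t\<in>{0..T}. \<forall>i\<in>{1..I}. pen \<sigma> \<gamma> i t (x t) \<le> \<mu> / \<eta>\<^sup>2) \<and>
  (\<forall>t\<in>{0..T} - N. u t \<in> U \<and>
     (x has_vector_derivative f t (x t) (u t) - penalty \<sigma> \<gamma> t (x t)) (at t within {0..T}))"

lemma safe_exists: obtains \<delta> where "safe \<delta>"
  unfolding safe_def by (rule sublevel_subset) blast

lemma eventually_tame:
  assumes "safe \<delta>" "\<And>k. \<gamma> k > 0" "filterlim \<gamma> at_top sequentially" "\<sigma> \<longlonglongrightarrow> 0"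
  shows "\<forall>\<^sub>F k in sequentially. tame \<delta> (\<sigma> k) (\<gamma> k)"
proof -
  have "(\<lambda>k. \<sigma> k + mu_fun \<mu> \<eta> (\<gamma> k)) \<longlonglongrightarrow> 0 + 0"
    by (intro tendsto_add assms(4) mu_fun_tendsto_0 assms(2,3) eta_pos)
  then have lim: "(\<lambda>k. \<sigma> k + mu_fun \<mu> \<eta> (\<gamma> k)) \<longlonglongrightarrow> 0" by simp
  have "\<forall>\<^sub>F k in sequentially. - \<beta> < \<sigma> k + mu_fun \<mu> \<eta> (\<gamma> k)"
    by (rule order_tendstoD(1)[OF lim]) (use beta_pos in simp)
  moreover have "\<forall>\<^sub>F k in sequentially. \<sigma> k + mu_fun \<mu> \<eta> (\<gamma> k) < \<delta>"
    by (rule order_tendstoD(2)[OF lim]) (use assms(1) in \<open>simp add: safe_def\<close>)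
  ultimately show ?thesis by eventually_elim (simp add: tame_def assms(2))
qed

text \<open>\<open>mu_bound\<close> is vacuous without a feasible point or a control, so positivity
  of \<open>\<mu>\<close> has to be drawn from one of each.\<close>

lemma mu_ge_1:
  assumes "I \<ge> 1" "t \<in> {0..T}" "c \<in> C t" "w \<in> U"
  shows "\<mu> \<ge> 1"
proof -
  have "norm (gr 1 t c) * norm (f t c w) + \<bar>dt 1 t c\<bar> + 1 \<le> \<mu>"
    by (rule mu_boundD[OF assms(2,4,3)]) (use assms(1) in auto)
  moreover have "norm (gr 1 t c) * norm (f t c w) \<ge> 0" by simp
  ultimately show ?thesis by linarith
qed

lemma admissible_controlD:
  assumes "admissible_control T U u"
  obtains N where "negligible N" "\<And>t. t \<in> {0..T} - N \<Longrightarrow> u t \<in> U"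
proof -
  have "AE t in lebesgue_on {0..T}. u t \<in> U" using assms by (simp add: admissible_control_def)
  then show thesis using that by (subst (asm) AE_lebesgue_on_iff_negligible) auto
qed

lemma admissible_control_nonempty:
  assumes "admissible_control T U u" shows "U \<noteq> {}"
proof -
  obtain N where N: "negligible N" "\<And>t. t \<in> {0..T} - N \<Longrightarrow> u t \<in> U"
    using assms by (rule admissible_controlD) blast
  obtain t where "t \<in> {0..T}" "t \<notin> N" using interval_not_subset_negligible[OF T_pos N(1)] by blast
  then show ?thesis using N(2)[of t] by auto
qed

text \<open>The multipliers are at most \<open>\<mu> / \<eta>\<^sup>2\<close> whatever
  \<open>\<sigma>\<close> and \<open>\<gamma>\<close> are, hence one constant \<open>L\<close>. The
  equation is assumed only while the curve is in \<open>Q\<close>, so the result covers solutions of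
  an equation modified outside \<open>Q\<close>, on which the existence proof relies.\<close>

lemma penalized_solution_facts:
  obtains L where "\<And>\<delta> \<sigma> \<gamma> u x N. \<lbrakk>safe \<delta>; tame \<delta> \<sigma> \<gamma>; \<mu> > 0; abs_cont_on 0 T x; negligible N;
    \<And>i. i \<in> {1..I} \<Longrightarrow> \<psi> i 0 (x 0) \<le> \<sigma> + mu_fun \<mu> \<eta> \<gamma>;
    \<And>t. t \<in> {0..T} - N \<Longrightarrow> u t \<in> U \<and> ((t, x t) \<in> Q \<longrightarrow>
      (x has_vector_derivative f t (x t) (u t) - penalty \<sigma> \<gamma> t (x t)) (at t within {0..T}))\<rbrakk>
    \<Longrightarrow> pen_facts L \<sigma> \<gamma> u x N"
proof -
  obtain G where G: "G > 0" "\<And>i t x. i \<in> {1..I} \<Longrightarrow> (t, x) \<in> Q \<Longrightarrow> norm (gr i t x) \<le> G"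
    by (rule gr_bounded) blast
  show thesis
  proof (rule that)
    fix \<delta> \<sigma> \<gamma> u x N
    assume safe: "safe \<delta>" and tame: "tame \<delta> \<sigma> \<gamma>" and \<mu>: "\<mu> > 0" and ac: "abs_cont_on 0 T x" and N: "negligible N"
      and init: "\<And>i. i \<in> {1..I} \<Longrightarrow> \<psi> i 0 (x 0) \<le> \<sigma> + mu_fun \<mu> \<eta> \<gamma>"
      and der: "\<And>t. t \<in> {0..T} - N \<Longrightarrow> u t \<in> U \<and> ((t, x t) \<in> Q \<longrightarrow>
      (x has_vector_derivative f t (x t) (u t) - penalty \<sigma> \<gamma> t (x t)) (at t within {0..T}))"
    have sub: "(t, x) \<in> Q \<and> (\<exists>c\<in>C t. norm (x - c) \<le> 1)" if "t \<in> {0..T}" "\<And>i. i \<in> {1..I} \<Longrightarrow> \<psi> i t x \<le> \<delta>" for t x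
      using safe that unfolding safe_def by blast
    have g: "\<gamma> > 0" "- \<beta> \<le> \<sigma> + mu_fun \<mu> \<eta> \<gamma>" "\<sigma> + mu_fun \<mu> \<eta> \<gamma> < \<delta>" using tame by (auto simp: tame_def)
    have inv: "\<psi> i t (x t) \<le> \<sigma> + mu_fun \<mu> \<eta> \<gamma>" if t: "t \<in> {0..T}" and i: "i \<in> {1..I}" for t i
    proof (rule penalized_invariant[OF _ sub g(1) exp_mu_fun[OF g(1) \<mu> eta_pos] g(2,3) ac N _ init t i])
      show "\<delta> \<le> \<beta>" using safe by (simp add: safe_def)
      fix t assume t: "t \<in> {0..T} - N" and le: "\<And>i. i \<in> {1..I} \<Longrightarrow> \<psi> i t (x t) \<le> \<delta>"
      have "(t, x t) \<in> Q" using sub[of t "x t"] t le by blast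
      then show "\<exists>w\<in>U. (x has_vector_derivative f t (x t) w - penalty \<sigma> \<gamma> t (x t)) (at t within {0..T})"
        using der[OF t] by blast
    qed
    have Q: "(t, x t) \<in> Q" if "t \<in> {0..T}" for t
      using sub[of t "x t"] that inv[OF that] g(3) by force
    have pen: "pen \<sigma> \<gamma> i t (x t) \<le> \<mu> / \<eta>\<^sup>2" if t: "t \<in> {0..T}" and i: "i \<in> {1..I}" for t i
      unfolding pen_def exp_mu_fun[OF g(1) \<mu> eta_pos, symmetric] using inv[OF t i] g(1) by simp
    have "(M + real I * (\<mu> / \<eta>\<^sup>2 * G))-lipschitz_on {0..T} x"
    proof (rule abs_cont_on_imp_lipschitz[OF ac N])
      show "M + real I * (\<mu> / \<eta>\<^sup>2 * G) \<ge> 0" using M_pos \<mu> G by simp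
      fix t assume t: "t \<in> {0..T} - N"
      then have tT: "t \<in> {0..T}" by simp
      have "norm (penalty \<sigma> \<gamma> t (x t)) \<le> (\<Sum>i=1..I. \<mu> / \<eta>\<^sup>2 * G)"
      proof (rule order_trans[OF norm_sum sum_mono])
        fix i assume i: "i \<in> {1..I}"
        show "norm (pen \<sigma> \<gamma> i t (x t) *\<^sub>R gr i t (x t)) \<le> \<mu> / \<eta>\<^sup>2 * G"
        proof -
          have "pen \<sigma> \<gamma> i t (x t) * norm (gr i t (x t)) \<le> \<mu> / \<eta>\<^sup>2 * G"
            by (rule mult_mono[OF pen[OF tT i] G(2)[OF i Q[OF tT]]]) (use \<mu> in auto)
          then show ?thesis using pen_pos[OF g(1), of \<sigma> i t "x t"] by simp
        qed
      qed
      also have "\<dots> = real I * (\<mu> / \<eta>\<^sup>2 * G)" by simp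
      finally have "norm (f t (x t) (u t) - penalty \<sigma> \<gamma> t (x t)) \<le> M + real I * (\<mu> / \<eta>\<^sup>2 * G)"
        using f_bound[OF Q[OF tT], of "u t"] der[OF t]
          norm_triangle_ineq4[of "f t (x t) (u t)" "\<Sum>i=1..I. pen \<sigma> \<gamma> i t (x t) *\<^sub>R gr i t (x t)"] by linarith
      then show "\<exists>d. norm d \<le> M + real I * (\<mu> / \<eta>\<^sup>2 * G) \<and> (x has_vector_derivative d) (at t within {0..T})"
        using der[OF t] Q[OF tT] by blast
    qed
    then show "pen_facts (M + real I * (\<mu> / \<eta>\<^sup>2 * G)) \<sigma> \<gamma> u x N"
      unfolding pen_facts_def using N Q inv pen der by blast
  qed
qed

lemma penalized_solutionD:
  assumes u: "admissible_control T U u" and sol: "penalized_solution T I \<psi> f \<sigma> \<gamma> m u b x"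
  obtains N where "abs_cont_on 0 T x" "x 0 = b" "\<And>i. i \<in> {1..I} \<Longrightarrow> \<psi> i 0 b \<le> \<sigma> + m" "negligible N"
    "\<And>t. t \<in> {0..T} - N \<Longrightarrow> u t \<in> U \<and>
      (x has_vector_derivative f t (x t) (u t) - penalty \<sigma> \<gamma> t (x t)) (at t within {0..T})"
proof -
  obtain N1 where N1: "negligible N1" "\<And>t. t \<in> {0..T} - N1 \<Longrightarrow> u t \<in> U"
    using u by (rule admissible_controlD) blast
  have b: "b \<in> relaxed_moving_set I \<psi> \<sigma> m 0" and ac: "abs_cont_on 0 T x" "x 0 = b"
    and "\<exists>N. negligible N \<and> (\<forall>t\<in>{0..T} - N. \<exists>d\<in>{penalized_rhs I \<psi> f \<sigma> \<gamma> u t (x t)}. (x has_vector_derivative d) (at t within {0..T}))"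
    using sol unfolding penalized_solution_def solves_inclusion_iff by blast+
  then obtain N2 where N2: "negligible N2"
    "\<And>t. t \<in> {0..T} - N2 \<Longrightarrow> (x has_vector_derivative penalized_rhs I \<psi> f \<sigma> \<gamma> u t (x t)) (at t within {0..T})"
    by blast
  show thesis
  proof (rule that[OF ac])
    show "negligible (N1 \<union> N2)" using N1 N2 by simp
    show "\<psi> i 0 b \<le> \<sigma> + m" if "i \<in> {1..I}" for i using b that by (force simp: relaxed_moving_set_def)
    show "u t \<in> U \<and> (x has_vector_derivative f t (x t) (u t) - penalty \<sigma> \<gamma> t (x t)) (at t within {0..T})"
      if "t \<in> {0..T} - (N1 \<union> N2)" for t
      using N1(2)[of t] N2(2)[of t] that by (simp add: penalized_rhs_eq)
  qed
qed

text \<open>Clamping the time makes \<open>f\<close> continuous on the whole product space, hence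
  Borel; it is then composed with a measurable map.\<close>

lemma f_measurable:
  assumes y: "continuous_on {0..T} y" and u: "u \<in> borel_measurable (lebesgue_on {0..T})"
  shows "(\<lambda>s. f s (y s) (u s)) \<in> borel_measurable (lebesgue_on {0..T})"
proof -
  define c where "c t = max 0 (min T t)" for t
  have c: "c t \<in> {0..T}" for t using T_pos by (auto simp: c_def)
  have "continuous_on ({0..T} \<times> UNIV \<times> UNIV) (\<lambda>(t, x, u). f t x u)" using A2 by (simp add: assumption_A2_def)
  then have "continuous_on UNIV (\<lambda>z. (\<lambda>(t, x, u). f t x u) (c (fst z), fst (snd z), snd (snd z)))"
    by (rule continuous_on_compose2) (use c in \<open>auto simp: c_def intro!: continuous_intros\<close>)
  then have "(\<lambda>z. f (c (fst z)) (fst (snd z)) (snd (snd z))) \<in> borel_measurable borel"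
    by (simp add: borel_measurable_continuous_onI case_prod_unfold)
  moreover have "(\<lambda>s. (s, y s, u s)) \<in> borel_measurable (lebesgue_on {0..T})"
    by (intro borel_measurable_Pair u continuous_imp_measurable_on_sets_lebesgue y continuous_on_id) auto
  ultimately have "(\<lambda>s. f (c s) (y s) (u s)) \<in> borel_measurable (lebesgue_on {0..T})"
    using measurable_compose[of "\<lambda>s. (s, y s, u s)" "lebesgue_on {0..T}" borel "\<lambda>z. f (c (fst z)) (fst (snd z)) (snd (snd z))" borel] by simp
  then show ?thesis
    by (rule measurable_cong[THEN iffD1, rotated]) (simp add: c_def)
qed

text \<open>A version of the control with all its values in \<open>U\<close>, so that the bounds on
  \<open>f\<close> hold at every time and not just almost everywhere.\<close>

lemma control_representative:
  assumes u: "admissible_control T U u"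
  obtains v where "v \<in> borel_measurable (lebesgue_on {0..T})" "\<And>t. v t \<in> U" "\<And>t. u t \<in> U \<Longrightarrow> v t = u t"
proof -
  obtain u0 where u0: "u0 \<in> U" using admissible_control_nonempty[OF u] by blast
  define v where "v t = (if u t \<in> U then u t else u0)" for t
  have um: "u \<in> borel_measurable (lebesgue_on {0..T})" using u by (simp add: admissible_control_def)
  have "U \<in> sets borel" using A4 by (simp add: assumption_A4_def compact_imp_closed borel_closed)
  then have "v \<in> borel_measurable (lebesgue_on {0..T})"
    unfolding v_def[abs_def] using um by measurable
  then show thesis using u0 by (intro that[of v]) (auto simp: v_def)
qed

lemma penalized_limit:
  fixes xs :: "nat \<Rightarrow> real \<Rightarrow> 'a"
  assumes \<gamma>: "\<And>k. \<gamma> k > 0" "filterlim \<gamma> at_top sequentially" and \<sigma>: "\<sigma> \<longlonglongrightarrow> 0"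
    and facts: "\<And>k. pen_facts L (\<sigma> k) (\<gamma> k) (us k) (xs k) (N k)"
    and init: "(\<lambda>k. xs k 0) \<longlonglongrightarrow> x\<^sub>0"
    and unif: "uniform_limit {0..T} xs x sequentially"
  shows "solves_inclusion T (sweeping_inclusion_rhs I \<psi> f U) x\<^sub>0 x"
    and "\<And>u. admissible_control T U u \<Longrightarrow> (\<And>k t. t \<in> {0..T} \<Longrightarrow> us k t = u t) \<Longrightarrow>
      solves_inclusion T (sweeping_rhs I \<psi> f u) x\<^sub>0 x"
proof -
  have lipk: "L-lipschitz_on {0..T} (xs k)" and N: "negligible (N k)" for k
    using facts[of k] by (auto simp: pen_facts_def)
  have Qk: "(s, xs k s) \<in> Q" if "s \<in> {0..T}" for k s using facts[of k] that unfolding pen_facts_def by blast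
  have le: "\<psi> i s (xs k s) \<le> \<sigma> k + mu_fun \<mu> \<eta> (\<gamma> k)" and pen_le: "pen (\<sigma> k) (\<gamma> k) i s (xs k s) \<le> \<mu> / \<eta>\<^sup>2"
    if "s \<in> {0..T}" "i \<in> {1..I}" for k s i using facts[of k] that unfolding pen_facts_def by blast+
  have der: "us k s \<in> U" "(xs k has_vector_derivative f s (xs k s) (us k s) - (penalty (\<sigma> k) (\<gamma> k) s (xs k s))) (at s within {0..T})"
    if "s \<in> {0..T} - N k" for k s using facts[of k] that unfolding pen_facts_def by blast+
  have lim: "(\<lambda>k. xs k s) \<longlonglongrightarrow> x s" if "s \<in> {0..T}" for s
    by (rule tendsto_uniform_limitI[OF unif that])
  have lipx: "L-lipschitz_on {0..T} x"
  proof (rule lipschitz_onI)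
    show "L \<ge> 0" using lipk by (rule lipschitz_on_nonneg)
    fix s t assume st: "s \<in> {0..T}" "t \<in> {0..T}"
    show "dist (x s) (x t) \<le> L * dist s t"
      by (rule LIMSEQ_le_const2[OF tendsto_dist[OF lim[OF st(1)] lim[OF st(2)]]])
        (use lipschitz_onD[OF lipk st] in blast)
  qed
  have contx: "continuous_on {0..T} x" by (rule lipschitz_on_continuous_on[OF lipx])
  have x0: "x 0 = x\<^sub>0" using LIMSEQ_unique[OF lim init] T_pos by simp
  have xC: "x t \<in> C t" if t: "t \<in> {0..T}" for t
    unfolding in_C_iff
  proof
    fix i assume i: "i \<in> {1..I}"
    have "(\<lambda>k. \<psi> i t (xs k t)) \<longlonglongrightarrow> \<psi> i t (x t)"
      using psi_tendsto[OF i, of "\<lambda>_. t"] t lim[OF t] by simp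
    moreover have "(\<lambda>k. \<sigma> k + mu_fun \<mu> \<eta> (\<gamma> k)) \<longlonglongrightarrow> 0 + 0"
      by (intro tendsto_add \<sigma> mu_fun_tendsto_0 \<gamma> eta_pos)
    ultimately have "\<psi> i t (x t) \<le> 0 + 0" by (rule LIMSEQ_le) (use le[OF t i] in blast)
    then show "\<psi> i t (x t) \<le> 0" by simp
  qed
  have xQ: "(t, x t) \<in> Q" if "t \<in> {0..T}" for t using C_subset_Q[OF that xC[OF that]] .
  obtain N' where N': "negligible N'" "\<And>t. t \<in> {0<..<T} - N' \<Longrightarrow> \<exists>d. (x has_vector_derivative d) (at t)"
    by (rule lipschitz_on_differentiable_AE[OF lipx]) blast
  have acx: "abs_cont_on 0 T x" by (rule lipschitz_imp_abs_cont_on[OF lipx])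
  have cU: "compact U" using A4 by (simp add: assumption_A4_def)
  have cf: "continuous_on ({0..T} \<times> UNIV \<times> UNIV) (\<lambda>(t, x, u). f t x u)" using A2 by (simp add: assumption_A2_def)
  show "solves_inclusion T (sweeping_inclusion_rhs I \<psi> f U) x\<^sub>0 x"
    unfolding solves_inclusion_iff
  proof (intro conjI acx x0 exI[of _ "N' \<union> {0, T}"] ballI)
    show "negligible (N' \<union> {0, T})" using N' by simp
    fix t assume t: "t \<in> {0..T} - (N' \<union> {0, T})"
    then have t': "t \<in> {0<..<T} - N'" and tT: "t \<in> {0..T}" and tI: "t \<in> {0..<T}" by auto
    obtain d where d: "(x has_vector_derivative d) (at t)" using N'(2)[OF t'] by blast
    have cont1: "continuous_on U (f t (x t))"
    proof -
      have "continuous_on U (\<lambda>w. (\<lambda>(t, x, u). f t x u) (t, x t, w))"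
        by (rule continuous_on_compose2[OF cf]) (use tT in \<open>auto intro!: continuous_intros\<close>)
      then show ?thesis by simp
    qed
    obtain a where a: "a \<in> f t (x t) ` U" "a - d \<in> limiting_normal_cone (C t) (x t)"
    proof (rule limit_velocity[OF tI \<gamma> \<sigma> unif contx xC[OF tT] pen_le _ N der(2) lim d])
      show "abs_cont_on 0 T (xs k)" for k by (rule lipschitz_imp_abs_cont_on[OF lipk])
      show "compact (f t (x t) ` U)" by (rule compact_continuous_image[OF cont1 cU])
      show "convex (f t (x t) ` U)" using A3 tT by (simp add: assumption_A3_def)
      fix e :: real assume e: "e > 0"
      \<comment> \<open>The controls \<open>us k s\<close> do not converge, so \<open>f\<close> must
        be compared at nearby points uniformly in the control; hence uniform continuity on a compact
        set.\<close>
      let ?K = "(\<lambda>z. (fst (fst z), snd (fst z), snd z)) ` (Q \<times> U)"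
      have memK: "(s, y, w) \<in> ?K" if "(s, y) \<in> Q" "w \<in> U" for s y w
        by (rule image_eqI[of _ _ "((s, y), w)"]) (use that in auto)
      have "compact ?K"
        by (intro compact_continuous_image compact_Times Q_compact cU continuous_intros)
      moreover have "continuous_on ?K (\<lambda>(t, x, u). f t x u)"
        by (rule continuous_on_subset[OF cf]) auto
      ultimately have "uniformly_continuous_on ?K (\<lambda>(t, x, u). f t x u)" by (rule compact_uniformly_continuous[rotated])
      note uc = this
      have "\<exists>d>0. \<forall>z\<in>?K. \<forall>z'\<in>?K. dist z' z < d \<longrightarrow>
          dist ((\<lambda>(t, x, u). f t x u) z') ((\<lambda>(t, x, u). f t x u) z) < e"
        by (rule uc[unfolded uniformly_continuous_on_def, THEN spec, THEN mp, OF e])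
      then obtain d where d: "d > 0" and "\<forall>z\<in>?K. \<forall>z'\<in>?K. dist z' z < d \<longrightarrow>
          dist ((\<lambda>(t, x, u). f t x u) z') ((\<lambda>(t, x, u). f t x u) z) < e"
        by (elim exE conjE)
      note d2 = this(2)[THEN bspec, THEN bspec, THEN mp]
      have "\<forall>\<^sub>F z in joint_at t {0..T}. dist ((\<lambda>(k, s). (s, xs k s)) z) (t, x t) < d"
        by (rule tendstoD[OF tendsto_graph_joint[OF unif contx tT] d])
      with eventually_joint_in[of "{0..T}" t]
      show "\<forall>\<^sub>F (k, s) in joint_at t {0..T}.
        s \<notin> N k \<longrightarrow> (\<exists>a\<in>f t (x t) ` U. norm (f s (xs k s) (us k s) - a) \<le> e)"
      proof eventually_elim
        case (elim z)
        obtain k s where z: "z = (k, s)" by (cases z)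
        have sT: "s \<in> {0..T}" and close: "dist (s, xs k s) (t, x t) < d" using elim by (auto simp: z)
        show ?case unfolding z prod.case
        proof
          assume "s \<notin> N k"
          then have w: "us k s \<in> U" using der(1)[of s k] sT by blast
          have "dist (s, xs k s, us k s) (t, x t, us k s) < d" using close by (simp add: dist_Pair_Pair)
          from d2[OF memK[OF xQ[OF tT] w] memK[OF Qk[OF sT] w] this]
          have "dist (f s (xs k s) (us k s)) (f t (x t) (us k s)) < e" by simp
          then show "\<exists>a\<in>f t (x t) ` U. norm (f s (xs k s) (us k s) - a) \<le> e"
            using w by (auto simp: dist_norm intro!: bexI[of _ "us k s"])
        qed
      qed
    qed (assumption | blast)+
    then obtain w where "w \<in> U" "a = f t (x t) w" by blast
    moreover have "d = a - (a - d)" by simp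
    ultimately have "d \<in> sweeping_inclusion_rhs I \<psi> f U t (x t)"
      using a(2) unfolding sweeping_inclusion_rhs_def by blast
    then show "\<exists>d\<in>sweeping_inclusion_rhs I \<psi> f U t (x t). (x has_vector_derivative d) (at t within {0..T})"
      using has_vector_derivative_at_within[OF d] by blast
  qed
  fix u assume adm: "admissible_control T U u" and us: "\<And>k t. t \<in> {0..T} \<Longrightarrow> us k t = u t"
  obtain v where v: "v \<in> borel_measurable (lebesgue_on {0..T})" "\<And>t. v t \<in> U" "\<And>t. u t \<in> U \<Longrightarrow> v t = u t"
    using adm by (rule control_representative) blast
  define g where "g s = f s (x s) (v s)" for s
  have gm: "g \<in> borel_measurable (lebesgue_on {0..T})"
    unfolding g_def[abs_def] by (rule f_measurable[OF contx v(1)])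
  have gb: "norm (g s) \<le> M" if "s \<in> {0..T}" for s unfolding g_def by (rule f_bound[OF xQ[OF that] v(2)])
  define W where "W t = integral {0..t} g" for t
  have lipW: "M-lipschitz_on {0..T} W"
    unfolding W_def[abs_def] by (rule bounded_measurable_primitive(2)[OF less_imp_le[OF T_pos] gm gb])
  obtain NW where NW: "negligible NW" "\<And>t. t \<in> {0..T} - NW \<Longrightarrow> (W has_vector_derivative g t) (at t within {0..T})"
    using bounded_measurable_primitive(3)[OF less_imp_le[OF T_pos] gm gb] unfolding W_def[abs_def] by blast
  show "solves_inclusion T (sweeping_rhs I \<psi> f u) x\<^sub>0 x"
    unfolding solves_inclusion_iff
  \<comment> \<open>\<open>N 0\<close> is discarded because outside it \<open>us 0 t\<close>, and
    hence \<open>u t\<close>, lies in \<open>U\<close>.\<close>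
  proof (intro conjI acx x0 exI[of _ "N' \<union> NW \<union> N 0 \<union> {0, T}"] ballI)
    show "negligible (N' \<union> NW \<union> N 0 \<union> {0, T})" using N' NW N by simp
    fix t assume t: "t \<in> {0..T} - (N' \<union> NW \<union> N 0 \<union> {0, T})"
    then have t': "t \<in> {0<..<T} - N'" and tT: "t \<in> {0..T}" and tI: "t \<in> {0..<T}" by auto
    obtain d where d: "(x has_vector_derivative d) (at t)" using N'(2)[OF t'] by blast
    have vt: "v t = u t"
    proof (rule v(3))
      have "t \<in> {0..T} - N 0" using t by blast
      from der(1)[OF this] show "u t \<in> U" using us[OF tT] by simp
    qed
    have "(W has_vector_derivative g t) (at t)"
    proof -
      have "t \<in> {0..T} - NW" using t by blast
      from NW(2)[OF this] show ?thesis using t' by (simp add: at_within_Icc_at)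
    qed
    then have dq: "((\<lambda>s. x s - W s) has_vector_derivative d - g t) (at t)" by (rule has_vector_derivative_diff[OF d])
    \<comment> \<open>The drift left after subtraction compares \<open>f\<close> at
      \<open>xs k s\<close> and at \<open>x s\<close> under the same control. It is at most
      \<open>M\<close> times the uniform distance, so the roughness of the control in time cancels
      and \<open>A = {0}\<close> suffices.\<close>
    obtain a where a: "a \<in> {0}" "a - (d - g t) \<in> limiting_normal_cone (C t) (x t)"
    proof (rule limit_velocity[OF tI \<gamma> \<sigma> unif contx xC[OF tT] pen_le, where qk = "\<lambda>k s. xs k s - W s" and N = "\<lambda>k. N k \<union> NW"
          and q = "\<lambda>s. x s - W s" and d = "d - g t" and A = "{0}" and \<phi> = "\<lambda>k s. f s (xs k s) (us k s) - g s"])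
      show "abs_cont_on 0 T (\<lambda>s. xs k s - W s)" for k
        by (rule lipschitz_imp_abs_cont_on[OF lipschitz_on_diff[OF lipk lipW]])
      show "negligible (N k \<union> NW)" for k using N NW by simp
      show "((\<lambda>s. xs k s - W s) has_vector_derivative f s (xs k s) (us k s) - g s - (penalty (\<sigma> k) (\<gamma> k) s (xs k s))) (at s within {0..T})"
        if s: "s \<in> {0..T} - (N k \<union> NW)" for k s
      proof -
        have "s \<in> {0..T} - N k" "s \<in> {0..T} - NW" using s by auto
        from has_vector_derivative_diff[OF der(2)[OF this(1)] NW(2)[OF this(2)]]
        show ?thesis by (simp add: algebra_simps)
      qed
      show "(\<lambda>k. xs k s - W s) \<longlonglongrightarrow> x s - W s" if "s \<in> {0..T}" for s
        by (intro tendsto_intros lim that)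
      fix e :: real assume e: "e > 0"
      then have e': "e / M > 0" using M_pos by simp
      have "\<forall>\<^sub>F k in sequentially. \<forall>s\<in>{0..T}. dist (xs k s) (x s) < e / M" using unif e' by (rule uniform_limitD)
      from eventually_prodI[OF this eventually_True[of "inf (nhds t) (principal {0..T})"]] eventually_joint_in[of "{0..T}" t]
      show "\<forall>\<^sub>F (k, s) in joint_at t {0..T}.
        s \<notin> N k \<union> NW \<longrightarrow> (\<exists>a\<in>{0}. norm (f s (xs k s) (us k s) - g s - a) \<le> e)"
      proof eventually_elim
        case (elim z)
        obtain k s where z: "z = (k, s)" by (cases z)
        have sT: "s \<in> {0..T}" using elim(2) by (simp add: z)
        have close: "norm (xs k s - x s) < e / M" using elim(1) sT by (auto simp: z dist_norm)
        show ?case unfolding z prod.case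
        proof
          assume "s \<notin> N k \<union> NW"
          then have w: "us k s \<in> U" using der(1)[of s k] sT by blast
          then have "v s = us k s" using v(3)[of s] us[OF sT, of k] by simp
          then have "norm (f s (xs k s) (us k s) - g s) \<le> M * norm (xs k s - x s)"
            unfolding g_def using f_lipschitz[OF Qk[OF sT] xQ[OF sT] w] by simp
          also have "\<dots> \<le> e" using close M_pos by (simp add: pos_less_divide_eq mult.commute)
          finally show "\<exists>a\<in>{0}. norm (f s (xs k s) (us k s) - g s - a) \<le> e" by simp
        qed
      qed
    qed (use dq in \<open>(assumption | simp | blast)+\<close>)
    then have "g t - d \<in> limiting_normal_cone (C t) (x t)" by simp
    moreover have "d = f t (x t) (u t) - (g t - d)" by (simp add: g_def vt)
    ultimately have "d \<in> sweeping_rhs I \<psi> f u t (x t)" unfolding sweeping_rhs_def by blast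
    then show "\<exists>d\<in>sweeping_rhs I \<psi> f u t (x t). (x has_vector_derivative d) (at t within {0..T})"
      using has_vector_derivative_at_within[OF d] by blast
  qed
qed

end

section \<open>Recovering a measurable control\<close>

lemma borel_measurable_lebesgue_onI:
  fixes g :: "'a::euclidean_space \<Rightarrow> 'b::euclidean_space"
  assumes "g \<in> borel_measurable borel"
  shows "g \<in> borel_measurable (lebesgue_on X)"
  using assms by (intro measurable_restrict_space1 measurable_completion) simp

text \<open>Exhibits the velocity as the limit of a sequence of difference quotients, from which its
  measurability is obtained.\<close>

lemma has_vector_derivative_quotient_tendsto:
  fixes x :: "real \<Rightarrow> 'a::real_normed_vector"
  assumes der: "(x has_vector_derivative d) (at t within {a..b})" and t: "t \<in> {a..<b}"
  shows "(\<lambda>n. real (Suc n) *\<^sub>R (x (t + 1 / real (Suc n)) - x t)) \<longlonglongrightarrow> d"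
proof (rule tendstoI)
  fix e :: real assume "e > 0"
  then have e: "e / 2 > 0" by simp
  obtain \<delta> where \<delta>: "\<delta> > 0" "\<And>y. y \<in> {a..b} \<Longrightarrow> norm (y - t) < \<delta> \<Longrightarrow> norm (x y - x t - (y - t) *\<^sub>R d) \<le> e / 2 * norm (y - t)"
    using der e unfolding has_vector_derivative_def has_derivative_within_alt by meson
  have "(\<lambda>n. 1 / real (Suc n)) \<longlonglongrightarrow> 0" by (rule lim_1_over_n[THEN LIMSEQ_Suc])
  then have "\<forall>\<^sub>F n in sequentially. 1 / real (Suc n) < min \<delta> (b - t)"
    by (rule order_tendstoD) (use \<delta>(1) t in auto)
  then show "\<forall>\<^sub>F n in sequentially. dist (real (Suc n) *\<^sub>R (x (t + 1 / real (Suc n)) - x t)) d < e"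
  proof eventually_elim
    case (elim n)
    define h where "h = 1 / real (Suc n)"
    have "h > 0" by (simp add: h_def)
    then have h: "h > 0" "h < \<delta>" "t + h \<in> {a..b}" using elim[folded h_def] t by auto
    have hn: "real (Suc n) * h = 1" by (simp add: h_def)
    have "norm (x (t + h) - x t - h *\<^sub>R d) \<le> e / 2 * h" using \<delta>(2)[OF h(3)] h by simp
    then have "real (Suc n) * norm (x (t + h) - x t - h *\<^sub>R d) \<le> real (Suc n) * (e / 2 * h)"
      by (rule mult_left_mono) simp
    also have "\<dots> = (real (Suc n) * h) * (e / 2)" by (simp only: mult_ac)
    also have "\<dots> = e / 2" by (simp only: hn mult_1_left)
    finally have "norm (real (Suc n) *\<^sub>R (x (t + h) - x t - h *\<^sub>R d)) \<le> e / 2" by simp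
    moreover have "real (Suc n) *\<^sub>R (x (t + h) - x t - h *\<^sub>R d) = real (Suc n) *\<^sub>R (x (t + h) - x t) - d"
      by (simp only: scaleR_diff_right scaleR_scaleR hn scaleR_one)
    ultimately have "norm (real (Suc n) *\<^sub>R (x (t + h) - x t) - d) \<le> e / 2" by (simp only:)
    then show ?case unfolding dist_norm h_def[symmetric] using \<open>e > 0\<close> by linarith
  qed
qed

context sweeping_data
begin

text \<open>The relation between a control \<open>w\<close> and the velocity \<open>z\<close> that
  it explains at \<open>(t, p)\<close>. The control stands first so that
  \<open>closed_compact_projection\<close> can eliminate it; closedness comes from continuity of
  \<open>f\<close> and \<open>normal_cone_closed_graph\<close>.\<close>

lemma closed_normal_control_graph:
  "closed {(w, t, p, z). t \<in> {0..T} \<and> w \<in> U \<and> f t p w - z \<in> limiting_normal_cone (C t) p}"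
    (is "closed ?R")
proof (rule closed_sequential_limits[THEN iffD2], intro allI impI, elim conjE)
  fix s l assume mem: "\<forall>n. s n \<in> ?R" and lim: "s \<longlonglongrightarrow> l"
  obtain w t p z where l: "l = (w, t, p, z)" by (cases l)
  define ws ts ps zs where "ws n = fst (s n)" and "ts n = fst (snd (s n))" and "ps n = fst (snd (snd (s n)))"
    and "zs n = snd (snd (snd (s n)))" for n
  have s: "s n = (ws n, ts n, ps n, zs n)" for n by (simp add: ws_def ts_def ps_def zs_def)
  have m: "ts n \<in> {0..T}" "ws n \<in> U" "f (ts n) (ps n) (ws n) - zs n \<in> limiting_normal_cone (C (ts n)) (ps n)" for n
    using mem[rule_format, of n] by (simp_all add: s)
  have lw: "ws \<longlonglongrightarrow> w" and lt: "ts \<longlonglongrightarrow> t" and lp: "ps \<longlonglongrightarrow> p" and lz: "zs \<longlonglongrightarrow> z"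
    unfolding ws_def[abs_def] ts_def[abs_def] ps_def[abs_def] zs_def[abs_def]
    using tendsto_fst[OF lim] tendsto_fst[OF tendsto_snd[OF lim]] tendsto_fst[OF tendsto_snd[OF tendsto_snd[OF lim]]]
      tendsto_snd[OF tendsto_snd[OF tendsto_snd[OF lim]]] by (simp_all add: l)
  have t: "t \<in> {0..T}" by (rule closed_sequentially[OF _ m(1) lt]) simp
  have w: "w \<in> U" by (rule closed_sequentially[OF _ m(2) lw]) (use A4 in \<open>simp add: assumption_A4_def compact_imp_closed\<close>)
  have cf: "continuous_on ({0..T} \<times> UNIV \<times> UNIV) (\<lambda>(t, x, u). f t x u)" using A2 by (simp add: assumption_A2_def)
  have "(\<lambda>n. (\<lambda>(t, x, u). f t x u) (ts n, ps n, ws n)) \<longlonglongrightarrow> (\<lambda>(t, x, u). f t x u) (t, p, w)"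
    by (rule continuous_on_tendsto_compose[OF cf]) (use t m(1) in \<open>auto intro!: tendsto_Pair lt lp lw\<close>)
  then have "(\<lambda>n. f (ts n) (ps n) (ws n)) \<longlonglongrightarrow> f t p w" by simp
  from normal_cone_closed_graph[OF m(1) lt lp tendsto_diff[OF this lz] m(3)]
  show "l \<in> ?R" using t w by (simp add: l)
qed

text \<open>A Filippov-type selection. The controls that explain the velocity at time
  \<open>t\<close> form a compact set and, apart from exceptional times, the times at which this set
  meets a compact \<open>K\<close> are the preimage of a closed projection under a measurable
  map.\<close>

lemma inclusion_solution_control:
  assumes sol: "solves_inclusion T (sweeping_inclusion_rhs I \<psi> f U) a x"
  obtains u where "admissible_control T U u" "solves_inclusion T (sweeping_rhs I \<psi> f u) a x"
proof -
  have ac: "abs_cont_on 0 T x" and x0: "x 0 = a" using sol by (simp_all add: solves_inclusion_def)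
  have "\<exists>N. negligible N \<and> (\<forall>t\<in>{0..T} - N. \<exists>d\<in>sweeping_inclusion_rhs I \<psi> f U t (x t). (x has_vector_derivative d) (at t within {0..T}))"
    using sol by (simp add: solves_inclusion_iff)
  then obtain N where N: "negligible N"
    and d: "\<And>t. t \<in> {0..T} - N \<Longrightarrow> \<exists>d\<in>sweeping_inclusion_rhs I \<psi> f U t (x t). (x has_vector_derivative d) (at t within {0..T})"
    by blast
  let ?R = "{(w, t, p, z). t \<in> {0..T} \<and> w \<in> U \<and> f t p w - z \<in> limiting_normal_cone (C t) p}"
  have cU: "compact U" using A4 by (simp add: assumption_A4_def)
  obtain t0 where "t0 \<in> {0..T}" "t0 \<notin> N" using interval_not_subset_negligible[OF T_pos N] by blast
  then have Une: "U \<noteq> {}" using d[of t0] by (auto simp: sweeping_inclusion_rhs_def)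
  define xc where "xc t = x (max 0 (min T t))" for t
  have xc: "xc t = x t" if "t \<in> {0..T}" for t using that by (simp add: xc_def)
  have cxc: "continuous_on UNIV xc" unfolding xc_def[abs_def]
    by (rule continuous_on_compose2[OF abs_cont_on_imp_continuous_on[OF ac]]) (use T_pos in \<open>auto intro!: continuous_intros\<close>)
  define v where "v t = lim (\<lambda>n. real (Suc n) *\<^sub>R (xc (t + 1 / real (Suc n)) - xc t))" for t
  have vm: "v \<in> borel_measurable borel" unfolding v_def[abs_def]
  proof (rule borel_measurable_lim_metric)
    fix n
    have "continuous_on UNIV (\<lambda>t. real (Suc n) *\<^sub>R (xc (t + 1 / real (Suc n)) - xc t))"
      by (intro continuous_intros continuous_on_compose2[OF cxc]) auto
    then show "(\<lambda>t. real (Suc n) *\<^sub>R (xc (t + 1 / real (Suc n)) - xc t)) \<in> borel_measurable borel"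
      by (rule borel_measurable_continuous_onI)
  qed
  have v: "v t = d" if "(x has_vector_derivative d) (at t within {0..T})" "t \<in> {0..<T}" for t d
  proof -
    have "(xc has_vector_derivative d) (at t within {0..T})"
      by (rule has_vector_derivative_transform[OF _ _ that(1)]) (use that(2) xc in auto)
    from has_vector_derivative_quotient_tendsto[OF this that(2)] show ?thesis unfolding v_def by (rule limI)
  qed
  \<comment> \<open>\<open>T\<close> is left out because the right-hand quotients there see only the
    clamped, constant part of the curve.\<close>
  define E where "E = {0..<T} - N"
  have Em: "E \<in> sets (lebesgue_on {0..T})"
  proof -
    have "E \<in> sets lebesgue" unfolding E_def using negligible_imp_sets[OF N] by (intro sets.Diff) auto
    moreover have "E \<subseteq> {0..T}" by (auto simp: E_def)
    ultimately show ?thesis by (simp add: sets_restrict_space_iff)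
  qed
  \<comment> \<open>At exceptional times all of \<open>U\<close> is allowed, which keeps the values
    nonempty and compact.\<close>
  define \<Gamma> where "\<Gamma> t = (if t \<in> E then {w. (w, t, xc t, v t) \<in> ?R} else U)" for t
  have \<Gamma>U: "\<Gamma> t \<subseteq> U" for t by (auto simp: \<Gamma>_def)
  obtain u where u: "u \<in> borel_measurable (lebesgue_on {0..T})" "\<And>t. t \<in> space (lebesgue_on {0..T}) \<Longrightarrow> u t \<in> \<Gamma> t"
  proof (rule measurable_selection_compact[of "lebesgue_on {0..T}" \<Gamma> U])
    fix t assume "t \<in> space (lebesgue_on {0..T})"
    show "compact (\<Gamma> t) \<and> \<Gamma> t \<noteq> {}"
    proof (cases "t \<in> E")
      case True
      have "closed ((\<lambda>w. (w, t, xc t, v t)) -` ?R)"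
        by (intro closed_vimage closed_normal_control_graph continuous_intros)
      then have "compact (U \<inter> (\<lambda>w. (w, t, xc t, v t)) -` ?R)" by (rule compact_Int_closed[OF cU])
      moreover have "U \<inter> (\<lambda>w. (w, t, xc t, v t)) -` ?R = \<Gamma> t" using True by (auto simp: \<Gamma>_def)
      ultimately have "compact (\<Gamma> t)" by (simp only:)
      have tT: "t \<in> {0..T} - N" "t \<in> {0..<T}" using True by (auto simp: E_def)
      obtain e where e: "e \<in> sweeping_inclusion_rhs I \<psi> f U t (x t)" "(x has_vector_derivative e) (at t within {0..T})"
        using d[OF tT(1)] by blast
      obtain w n where wn: "w \<in> U" "n \<in> limiting_normal_cone (C t) (x t)" "e = f t (x t) w - n"
        using e(1) by (auto simp: sweeping_inclusion_rhs_def)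
      have "f t (x t) w - v t = n" using v[OF e(2) tT(2)] wn(3) by simp
      then have "w \<in> \<Gamma> t" using True tT(1) wn xc[of t] by (simp add: \<Gamma>_def)
      then show ?thesis using \<open>compact (\<Gamma> t)\<close> by blast
    qed (use cU Une in \<open>simp add: \<Gamma>_def\<close>)
  next
    fix K :: "'b set" assume K: "compact K"
    let ?P = "{y. \<exists>w. w \<in> K \<and> (w, y) \<in> ?R}"
    have "closed ?P" by (rule closed_compact_projection[OF K closed_normal_control_graph])
    then have Pm: "?P \<in> sets borel" by simp
    have "(\<lambda>t. (t, xc t, v t)) \<in> borel_measurable borel"
      by (intro borel_measurable_Pair vm borel_measurable_continuous_onI[OF cxc] borel_measurable_continuous_onI[OF continuous_on_id])
    then have "(\<lambda>t. (t, xc t, v t)) \<in> borel_measurable (lebesgue_on {0..T})" by (rule borel_measurable_lebesgue_onI)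
    from measurable_sets[OF this Pm]
    have Hm: "(\<lambda>t. (t, xc t, v t)) -` ?P \<inter> {0..T} \<in> sets (lebesgue_on {0..T})" by simp
    have tm: "{0..T} \<in> sets (lebesgue_on {0..T})" using sets.top[of "lebesgue_on {0..T}"] by simp
    have "{t \<in> space (lebesgue_on {0..T}). \<Gamma> t \<inter> K \<noteq> {}} =
      (E \<inter> ((\<lambda>t. (t, xc t, v t)) -` ?P \<inter> {0..T})) \<union> ({0..T} - E) \<inter> (if U \<inter> K = {} then {} else {0..T})"
      by (auto simp: \<Gamma>_def E_def split: if_splits)
    moreover have "\<dots> \<in> sets (lebesgue_on {0..T})"
      by (rule sets.Un[OF sets.Int[OF Em Hm] sets.Int[OF sets.Diff[OF tm Em]]]) (use tm in simp)
    ultimately show "{t \<in> space (lebesgue_on {0..T}). \<Gamma> t \<inter> K \<noteq> {}} \<in> sets (lebesgue_on {0..T})" by (simp only:)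
  qed (use cU \<Gamma>U in auto)
  have "u t \<in> U" if "t \<in> {0..T}" for t using u(2)[of t] that \<Gamma>U[of t] by auto
  then have adm: "admissible_control T U u"
    using u(1) unfolding admissible_control_def by (auto intro!: AE_I2)
  have "solves_inclusion T (sweeping_rhs I \<psi> f u) a x"
    unfolding solves_inclusion_iff
  proof (intro conjI ac x0 exI[of _ "N \<union> {T}"] ballI)
    show "negligible (N \<union> {T})" using N by simp
    fix t assume t: "t \<in> {0..T} - (N \<union> {T})"
    then have tT: "t \<in> {0..T} - N" "t \<in> {0..<T}" "t \<in> E" "t \<in> {0..T}" by (auto simp: E_def)
    obtain e where e: "(x has_vector_derivative e) (at t within {0..T})" using d[OF tT(1)] by blast
    have "u t \<in> \<Gamma> t" using u(2) tT(4) by simp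
    then have "f t (x t) (u t) - e \<in> limiting_normal_cone (C t) (x t)"
      using tT(3) xc[OF tT(4)] v[OF e tT(2)] by (simp add: \<Gamma>_def)
    moreover have "e = f t (x t) (u t) - (f t (x t) (u t) - e)" by simp
    ultimately have "e \<in> sweeping_rhs I \<psi> f u t (x t)" unfolding sweeping_rhs_def by blast
    then show "\<exists>d\<in>sweeping_rhs I \<psi> f u t (x t). (x has_vector_derivative d) (at t within {0..T})"
      using e by blast
  qed
  then show thesis using adm that by blast
qed

section \<open>Existence for the penalized equation\<close>

lemma pen_grad_lipschitz:
  assumes \<gamma>: "\<gamma> > 0"
  obtains H where "H \<ge> 0" "\<And>t x y. (t, x) \<in> Q \<Longrightarrow> (t, y) \<in> Q \<Longrightarrow>
    norm ((penalty \<sigma> \<gamma> t x) - (penalty \<sigma> \<gamma> t y)) \<le> H * norm (x - y)"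
    "\<And>t x. (t, x) \<in> Q \<Longrightarrow> norm (penalty \<sigma> \<gamma> t x) \<le> H"
proof -
  have cP: "continuous_on S (\<lambda>(t, x). pen \<sigma> \<gamma> i t x)" if "i \<in> {1..I}" for i
    using continuous_on_psi[OF that] unfolding pen_def case_prod_unfold by (intro continuous_intros)
  obtain P where P: "P > 0" "\<And>i z. i \<in> {1..I} \<Longrightarrow> z \<in> Q \<Longrightarrow> norm (case z of (t, x) \<Rightarrow> pen \<sigma> \<gamma> i t x) \<le> P"
    by (rule bounded_on_Q[OF cP]) blast+
  obtain G where G: "G > 0" "\<And>i t x. i \<in> {1..I} \<Longrightarrow> (t, x) \<in> Q \<Longrightarrow> norm (gr i t x) \<le> G"
    by (rule gr_bounded) blast
  obtain K where K: "K > 0"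
    "\<And>i t x t' y. i \<in> {1..I} \<Longrightarrow> (t, x) \<in> Q \<Longrightarrow> (t', y) \<in> Q \<Longrightarrow> norm (gr i t x - gr i t' y) \<le> K * norm ((t, x) - (t', y))"
    "\<And>i z w. i \<in> {1..I} \<Longrightarrow> z \<in> Q \<Longrightarrow> w \<in> Q \<Longrightarrow> \<bar>(case z of (t, x) \<Rightarrow> \<psi> i t x) - (case w of (t, x) \<Rightarrow> \<psi> i t x)\<bar> \<le> K * norm (z - w)"
    by (rule derivative_bounded_lipschitz) blast
  \<comment> \<open>The exponential stays above its tangent line at \<open>a\<close>; with the
    factor taken at one end point, the bound \<open>P\<close> on the multiplier there
    suffices.\<close>
  have expd: "exp a - exp b \<le> exp a * \<bar>a - b\<bar>" for a b :: real
  proof -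
    have "exp a * (1 + (b - a)) \<le> exp a * exp (b - a)"
      using exp_ge_add_one_self[of "b - a"] by (intro mult_left_mono) auto
    also have "\<dots> = exp b" by (simp add: exp_add[symmetric])
    finally have "exp a - exp b \<le> exp a * (a - b)" by (simp add: algebra_simps)
    also have "\<dots> \<le> exp a * \<bar>a - b\<bar>" by (intro mult_left_mono) auto
    finally show ?thesis .
  qed
  define H1 where "H1 = P * K + G * (P * \<gamma> * K)"
  have H1: "H1 \<ge> 0" using P K G \<gamma> by (simp add: H1_def)
  show thesis
  \<comment> \<open>One constant for both claims: the first summand bounds increments, the second
    values.\<close>
  proof (rule that[of "real I * H1 + real I * (P * G)"])
    show "real I * H1 + real I * (P * G) \<ge> 0" using H1 P G by simp
    have pb: "pen \<sigma> \<gamma> i t x \<le> P" if "i \<in> {1..I}" "(t, x) \<in> Q" for i t x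
      using P(2)[OF that] by simp
    have pd: "pen \<sigma> \<gamma> i t x - pen \<sigma> \<gamma> i t y \<le> P * \<gamma> * K * norm (x - y)"
      if i: "i \<in> {1..I}" and Q: "(t, x) \<in> Q" "(t, y) \<in> Q" for i t x y
    proof -
      have "\<bar>\<psi> i t x - \<psi> i t y\<bar> \<le> K * norm (x - y)"
        using K(3)[OF i Q] by (simp add: norm_Pair)
      then have d: "\<bar>\<gamma> * (\<psi> i t x - \<sigma>) - \<gamma> * (\<psi> i t y - \<sigma>)\<bar> \<le> \<gamma> * (K * norm (x - y))"
        using \<gamma> by (simp add: right_diff_distrib[symmetric] abs_mult)
      have "pen \<sigma> \<gamma> i t x - pen \<sigma> \<gamma> i t y = \<gamma> * (exp (\<gamma> * (\<psi> i t x - \<sigma>)) - exp (\<gamma> * (\<psi> i t y - \<sigma>)))"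
        by (simp add: pen_def right_diff_distrib)
      also have "\<dots> \<le> \<gamma> * (exp (\<gamma> * (\<psi> i t x - \<sigma>)) * \<bar>\<gamma> * (\<psi> i t x - \<sigma>) - \<gamma> * (\<psi> i t y - \<sigma>)\<bar>)"
        using \<gamma> by (intro mult_left_mono expd) auto
      also have "\<dots> = pen \<sigma> \<gamma> i t x * \<bar>\<gamma> * (\<psi> i t x - \<sigma>) - \<gamma> * (\<psi> i t y - \<sigma>)\<bar>" by (simp add: pen_def)
      also have "\<dots> \<le> P * (\<gamma> * (K * norm (x - y)))"
        using pb[OF i Q(1)] d P(1) by (intro mult_mono) auto
      finally show ?thesis by (simp add: mult.assoc)
    qed
    fix t x assume xQ: "(t, x) \<in> Q"
    have "norm (penalty \<sigma> \<gamma> t x) \<le> (\<Sum>i=1..I. P * G)"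
    proof (rule order_trans[OF norm_sum sum_mono])
      fix i assume i: "i \<in> {1..I}"
      have "pen \<sigma> \<gamma> i t x * norm (gr i t x) \<le> P * G"
        by (rule mult_mono[OF pb[OF i xQ] G(2)[OF i xQ]]) (use P in auto)
      then show "norm (pen \<sigma> \<gamma> i t x *\<^sub>R gr i t x) \<le> P * G"
        using pen_pos[OF \<gamma>, of \<sigma> i t x] by simp
    qed
    then have "norm (penalty \<sigma> \<gamma> t x) \<le> real I * (P * G)" by simp
    moreover have "real I * H1 \<ge> 0" using H1 by simp
    ultimately show "norm (penalty \<sigma> \<gamma> t x) \<le> real I * H1 + real I * (P * G)" by linarith
    fix y assume yQ: "(t, y) \<in> Q"
    have "norm ((penalty \<sigma> \<gamma> t x) - (penalty \<sigma> \<gamma> t y))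
       \<le> (\<Sum>i=1..I. H1 * norm (x - y))"
      unfolding sum_subtractf[symmetric]
    proof (rule order_trans[OF norm_sum sum_mono])
      fix i assume i: "i \<in> {1..I}"
      have eq: "pen \<sigma> \<gamma> i t x *\<^sub>R gr i t x - pen \<sigma> \<gamma> i t y *\<^sub>R gr i t y =
          pen \<sigma> \<gamma> i t x *\<^sub>R (gr i t x - gr i t y) + (pen \<sigma> \<gamma> i t x - pen \<sigma> \<gamma> i t y) *\<^sub>R gr i t y"
        by (simp add: algebra_simps)
      have "\<bar>pen \<sigma> \<gamma> i t x - pen \<sigma> \<gamma> i t y\<bar> \<le> P * \<gamma> * K * norm (x - y)"
        using pd[OF i xQ yQ] pd[OF i yQ xQ] by (simp add: norm_minus_commute)
      then have 1: "\<bar>pen \<sigma> \<gamma> i t x - pen \<sigma> \<gamma> i t y\<bar> * norm (gr i t y) \<le> (P * \<gamma> * K * norm (x - y)) * G"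
        by (rule mult_mono[OF _ G(2)[OF i yQ]]) (use P \<gamma> K in auto)
      have "norm (gr i t x - gr i t y) \<le> K * norm (x - y)" using K(2)[OF i xQ yQ] by (simp add: norm_Pair)
      then have 2: "\<bar>pen \<sigma> \<gamma> i t x\<bar> * norm (gr i t x - gr i t y) \<le> P * (K * norm (x - y))"
        using pb[OF i xQ] pen_pos[OF \<gamma>, of \<sigma> i t x] P(1) by (intro mult_mono) auto
      have "norm (pen \<sigma> \<gamma> i t x *\<^sub>R gr i t x - pen \<sigma> \<gamma> i t y *\<^sub>R gr i t y) \<le>
        norm (pen \<sigma> \<gamma> i t x *\<^sub>R (gr i t x - gr i t y)) + norm ((pen \<sigma> \<gamma> i t x - pen \<sigma> \<gamma> i t y) *\<^sub>R gr i t y)"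
        unfolding eq by (rule norm_triangle_ineq)
      also have "\<dots> \<le> P * (K * norm (x - y)) + (P * \<gamma> * K * norm (x - y)) * G"
        using 1 2 unfolding norm_scaleR by linarith
      also have "\<dots> = H1 * norm (x - y)" by (simp add: H1_def algebra_simps)
      finally show "norm (pen \<sigma> \<gamma> i t x *\<^sub>R gr i t x - pen \<sigma> \<gamma> i t y *\<^sub>R gr i t y) \<le> H1 * norm (x - y)" .
    qed
    also have "\<dots> = real I * H1 * norm (x - y)" by simp
    also have "\<dots> \<le> (real I * H1 + real I * (P * G)) * norm (x - y)" using P G by (intro mult_right_mono) auto
    finally show "norm ((penalty \<sigma> \<gamma> t x) - (penalty \<sigma> \<gamma> t y))
      \<le> (real I * H1 + real I * (P * G)) * norm (x - y)" .
  qed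
qed

text \<open>The penalized field is Lipschitz only on \<open>Q\<close>. It is extended by a metric projection in the
  space variable at each fixed time, because \<open>f\<close> is not Lipschitz in time.\<close>

lemma space_retraction:
  assumes Tr: "T < r"
  obtains \<pi> where "\<And>t x. t \<in> {0..T} \<Longrightarrow> (t, \<pi> t x) \<in> Q"
    "\<And>t x y. t \<in> {0..T} \<Longrightarrow> norm (\<pi> t x - \<pi> t y) \<le> norm (x - y)"
    "\<And>t x. (t, x) \<in> Q \<Longrightarrow> \<pi> t x = x"
    "\<And>y. continuous_on {0..T} y \<Longrightarrow> continuous_on {0..T} (\<lambda>t. \<pi> t (y t))"
proof -
  \<comment> \<open>The radius of the slice of the ball at time \<open>t\<close>; it stays positive
    up to \<open>T\<close> because \<open>T < r\<close>.\<close>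
  define R where "R t = sqrt (r\<^sup>2 - t\<^sup>2)" for t
  have R: "R t > 0" "(R t)\<^sup>2 = r\<^sup>2 - t\<^sup>2" if t: "t \<in> {0..T}" for t
  proof -
    have "t\<^sup>2 < r\<^sup>2" using t Tr by (intro power_strict_mono) auto
    then show "R t > 0" "(R t)\<^sup>2 = r\<^sup>2 - t\<^sup>2" by (auto simp: R_def)
  qed
  have inQ: "(t, x) \<in> Q \<longleftrightarrow> norm x \<le> R t" if t: "t \<in> {0..T}" for t x
  proof -
    have "(t, x) \<in> Q \<longleftrightarrow> sqrt (t\<^sup>2 + (norm x)\<^sup>2) \<le> r" using t by (simp add: norm_Pair)
    also have "\<dots> \<longleftrightarrow> t\<^sup>2 + (norm x)\<^sup>2 \<le> r\<^sup>2" using r_pos real_sqrt_le_iff[of "t\<^sup>2 + (norm x)\<^sup>2" "r\<^sup>2"] by simp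
    also have "\<dots> \<longleftrightarrow> (norm x)\<^sup>2 \<le> (R t)\<^sup>2" using R(2)[OF t] by auto
    also have "\<dots> \<longleftrightarrow> norm x \<le> R t" using R(1)[OF t] by (intro power_mono_iff) auto
    finally show ?thesis .
  qed
  let ?p = "closest_point (cball (0::'a) 1)"
  have B: "convex (cball (0::'a) 1)" "closed (cball (0::'a) 1)" "cball (0::'a) 1 \<noteq> {}" by auto
  \<comment> \<open>The slice is rescaled to the unit ball, so that the projection is onto one fixed
    set and time enters through \<open>R\<close> alone.\<close>
  define \<pi> where "\<pi> t x = R t *\<^sub>R ?p (x /\<^sub>R R t)" for t x
  show thesis
  proof (rule that[of \<pi>])
    fix t x assume t: "t \<in> {0..T}"
    have "?p (x /\<^sub>R R t) \<in> cball 0 1" by (rule closest_point_in_set[OF B(2,3)])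
    then have "R t * norm (?p (x /\<^sub>R R t)) \<le> R t * 1" using R(1)[OF t] by (intro mult_left_mono) auto
    then show "(t, \<pi> t x) \<in> Q" using inQ[OF t] R(1)[OF t] by (simp add: \<pi>_def)
    fix y
    have "norm (\<pi> t x - \<pi> t y) = R t * norm (?p (x /\<^sub>R R t) - ?p (y /\<^sub>R R t))"
      using R(1)[OF t] by (simp add: \<pi>_def scaleR_diff_right[symmetric])
    also have "\<dots> \<le> R t * norm (x /\<^sub>R R t - y /\<^sub>R R t)"
      using closest_point_lipschitz[OF B, of "x /\<^sub>R R t" "y /\<^sub>R R t"] R(1)[OF t] by (intro mult_left_mono) (auto simp: dist_norm)
    also have "\<dots> = norm (x - y)" using R(1)[OF t] by (simp add: scaleR_diff_right[symmetric])
    finally show "norm (\<pi> t x - \<pi> t y) \<le> norm (x - y)" .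
  next
    fix t x assume tx: "(t, x) \<in> Q"
    then have t: "t \<in> {0..T}" by simp
    have "norm x \<le> R t" using inQ[OF t] tx by simp
    then have "x /\<^sub>R R t \<in> cball 0 1" using R(1)[OF t] by (simp add: divide_inverse[symmetric] mult.commute[of "inverse _"])
    then have "?p (x /\<^sub>R R t) = x /\<^sub>R R t" by (rule closest_point_self)
    then show "\<pi> t x = x" using R(1)[OF t] by (simp add: \<pi>_def)
  next
    fix y :: "real \<Rightarrow> 'a" assume y: "continuous_on {0..T} y"
    have cR: "continuous_on {0..T} R" unfolding R_def[abs_def] by (intro continuous_intros)
    show "continuous_on {0..T} (\<lambda>t. \<pi> t (y t))"
      unfolding \<pi>_def
      by (intro continuous_intros cR continuous_on_compose2[OF continuous_on_closest_point[OF B, of UNIV]] y) (use R(1) in force)+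
  qed
qed

text \<open>The extended equation is solved globally. Its solution starts in the relaxed set, so by
  invariance it never leaves \<open>Q\<close>, where the extension changes nothing.\<close>

lemma penalized_solution_exists:
  assumes safe: "safe \<delta>" and tame: "tame \<delta> \<sigma> \<gamma>" and \<mu>: "\<mu> > 0" and u: "admissible_control T U u" and Tr: "T < r"
    and b: "b \<in> relaxed_moving_set I \<psi> \<sigma> (mu_fun \<mu> \<eta> \<gamma>) 0"
  shows "\<exists>x. penalized_solution T I \<psi> f \<sigma> \<gamma> (mu_fun \<mu> \<eta> \<gamma>) u b x"
proof -
  have \<gamma>: "\<gamma> > 0" using tame by (simp add: tame_def)
  obtain \<pi> where \<pi>: "\<And>t x. t \<in> {0..T} \<Longrightarrow> (t, \<pi> t x) \<in> Q"
    "\<And>t x y. t \<in> {0..T} \<Longrightarrow> norm (\<pi> t x - \<pi> t y) \<le> norm (x - y)"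
    "\<And>t x. (t, x) \<in> Q \<Longrightarrow> \<pi> t x = x"
    "\<And>y. continuous_on {0..T} y \<Longrightarrow> continuous_on {0..T} (\<lambda>t. \<pi> t (y t))"
    by (rule space_retraction[OF Tr]) blast
  obtain v where v: "v \<in> borel_measurable (lebesgue_on {0..T})" "\<And>t. v t \<in> U" "\<And>t. u t \<in> U \<Longrightarrow> v t = u t"
    using u by (rule control_representative) blast
  define g where "g t x = (penalty \<sigma> \<gamma> t x)" for t x
  obtain H where H: "H \<ge> 0" "\<And>t x y. (t, x) \<in> Q \<Longrightarrow> (t, y) \<in> Q \<Longrightarrow> norm (g t x - g t y) \<le> H * norm (x - y)"
    "\<And>t x. (t, x) \<in> Q \<Longrightarrow> norm (g t x) \<le> H"
    unfolding g_def by (rule pen_grad_lipschitz[OF \<gamma>, of \<sigma>]) blast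
  define F where "F t x = f t (\<pi> t x) (v t) - g t (\<pi> t x)" for t x
  obtain y N where y: "y 0 = b" "(M + H)-lipschitz_on {0..T} y" "negligible N"
    "\<And>t. t \<in> {0..T} - N \<Longrightarrow> (y has_vector_derivative F t (y t)) (at t within {0..T})"
  proof (rule caratheodory_lipschitz_solution[of T "M + H" F "M + H" b])
    show "T \<ge> 0" "M + H \<ge> 0" using T_pos M_pos H by auto
    fix s x x' assume s: "s \<in> {0..T}"
    have "norm (F s x - F s x') \<le> norm (f s (\<pi> s x) (v s) - f s (\<pi> s x') (v s)) + norm (g s (\<pi> s x) - g s (\<pi> s x'))"
      unfolding F_def using norm_triangle_ineq4[of "f s (\<pi> s x) (v s) - f s (\<pi> s x') (v s)" "g s (\<pi> s x) - g s (\<pi> s x')"]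
      by (simp add: algebra_simps)
    also have "\<dots> \<le> M * norm (\<pi> s x - \<pi> s x') + H * norm (\<pi> s x - \<pi> s x')"
      by (intro add_mono f_lipschitz H(2) \<pi>(1) s v(2))
    also have "\<dots> = (M + H) * norm (\<pi> s x - \<pi> s x')" by (simp add: distrib_right)
    also have "\<dots> \<le> (M + H) * norm (x - x')" using \<pi>(2)[OF s] M_pos H by (intro mult_left_mono) auto
    finally show "norm (F s x - F s x') \<le> (M + H) * norm (x - x')" .
  next
    fix s x assume s: "s \<in> {0..T}"
    show "norm (F s x) \<le> M + H"
      unfolding F_def using norm_triangle_ineq4[of "f s (\<pi> s x) (v s)" "g s (\<pi> s x)"] f_bound[OF \<pi>(1)[OF s] v(2)] H(3)[OF \<pi>(1)[OF s]]
      by (meson add_mono order_trans)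
  next
    fix y :: "real \<Rightarrow> 'a" assume "continuous_on {0..T} y"
    then have c: "continuous_on {0..T} (\<lambda>t. \<pi> t (y t))" by (rule \<pi>(4))
    have comp: "continuous_on {0..T} (\<lambda>t. h (t, \<pi> t (y t)))" if "continuous_on S h" for h :: "real \<times> 'a \<Rightarrow> 'c::topological_space"
      by (rule continuous_on_compose2[OF that]) (auto intro!: continuous_intros c)
    have "continuous_on {0..T} (\<lambda>t. g t (\<pi> t (y t)))"
      unfolding g_def pen_def
    proof (intro continuous_intros)
      fix i assume i: "i \<in> {1..I}"
      show "continuous_on {0..T} (\<lambda>t. \<psi> i t (\<pi> t (y t)))" using comp[OF continuous_on_psi[OF i]] by simp
      show "continuous_on {0..T} (\<lambda>t. gr i t (\<pi> t (y t)))" using comp[OF continuous_on_gr(1)[OF i]] by simp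
    qed
    then have "(\<lambda>t. g t (\<pi> t (y t))) \<in> borel_measurable (lebesgue_on {0..T})"
      by (rule continuous_imp_measurable_on_sets_lebesgue) simp
    then show "(\<lambda>s. F s (y s)) \<in> borel_measurable (lebesgue_on {0..T})"
      unfolding F_def by (intro borel_measurable_diff f_measurable[OF c v(1)])
  qed blast
  obtain N1 where N1: "negligible N1" "\<And>t. t \<in> {0..T} - N1 \<Longrightarrow> u t \<in> U"
    using u by (rule admissible_controlD) blast
  have ac: "abs_cont_on 0 T y" by (rule lipschitz_imp_abs_cont_on[OF y(2)])
  have der: "u t \<in> U \<and> ((t, y t) \<in> Q \<longrightarrow> (y has_vector_derivative f t (y t) (u t) - g t (y t)) (at t within {0..T}))"
    if t: "t \<in> {0..T} - (N \<union> N1)" for t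
  proof -
    have tn: "t \<in> {0..T} - N" "t \<in> {0..T} - N1" using t by auto
    have ut: "u t \<in> U" by (rule N1(2)[OF tn(2)])
    show ?thesis
    proof (intro conjI impI ut)
      assume q: "(t, y t) \<in> Q"
      show "(y has_vector_derivative f t (y t) (u t) - g t (y t)) (at t within {0..T})"
        using y(4)[OF tn(1)] unfolding F_def \<pi>(3)[OF q] v(3)[OF ut] .
    qed
  qed
  obtain L where L: "\<And>\<delta> \<sigma> \<gamma> u x N. \<lbrakk>safe \<delta>; tame \<delta> \<sigma> \<gamma>; \<mu> > 0; abs_cont_on 0 T x; negligible N;
    \<And>i. i \<in> {1..I} \<Longrightarrow> \<psi> i 0 (x 0) \<le> \<sigma> + mu_fun \<mu> \<eta> \<gamma>;
    \<And>t. t \<in> {0..T} - N \<Longrightarrow> u t \<in> U \<and> ((t, x t) \<in> Q \<longrightarrow>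
      (x has_vector_derivative f t (x t) (u t) - penalty \<sigma> \<gamma> t (x t)) (at t within {0..T}))\<rbrakk>
    \<Longrightarrow> pen_facts L \<sigma> \<gamma> u x N"
    by (rule penalized_solution_facts) blast
  have "pen_facts L \<sigma> \<gamma> u y (N \<union> N1)"
  proof (rule L[OF safe tame \<mu> ac])
    show "negligible (N \<union> N1)" using y(3) N1 by simp
    show "\<psi> i 0 (y 0) \<le> \<sigma> + mu_fun \<mu> \<eta> \<gamma>" if "i \<in> {1..I}" for i
      using b that by (force simp: y(1) relaxed_moving_set_def)
  qed (use der in \<open>simp add: g_def\<close>)
  then have yQ: "(t, y t) \<in> Q" if "t \<in> {0..T}" for t using that unfolding pen_facts_def by blast
  have "solves_inclusion T (\<lambda>t y. {penalized_rhs I \<psi> f \<sigma> \<gamma> u t y}) b y"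
    unfolding solves_inclusion_iff
  proof (intro conjI ac y(1) exI[of _ "N \<union> N1"] ballI)
    show "negligible (N \<union> N1)" using y(3) N1 by simp
    fix t assume t: "t \<in> {0..T} - (N \<union> N1)"
    then have "t \<in> {0..T}" by blast
    then show "\<exists>d\<in>{penalized_rhs I \<psi> f \<sigma> \<gamma> u t (y t)}. (y has_vector_derivative d) (at t within {0..T})"
      using der[OF t] yQ by (simp add: penalized_rhs_eq g_def)
  qed
  then show ?thesis using b unfolding penalized_solution_def by blast
qed

section \<open>Sequences of penalized solutions\<close>

lemma penalized_sequence_facts:
  assumes I: "I \<ge> 1" and \<gamma>: "\<And>k. \<gamma> k > 0" "filterlim \<gamma> at_top sequentially" and \<sigma>: "\<sigma> \<longlonglongrightarrow> 0"
    and sol: "\<forall>\<^sub>F k in sequentially. admissible_control T U (us k) \<and>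
      penalized_solution T I \<psi> f (\<sigma> k) (\<gamma> k) (mu_fun \<mu> \<eta> (\<gamma> k)) (us k) (b k) (xs k)"
  obtains L k0 where "\<And>k. k \<ge> k0 \<Longrightarrow> xs k 0 = b k \<and> (\<exists>N. pen_facts L (\<sigma> k) (\<gamma> k) (us k) (xs k) N)"
proof -
  obtain \<delta> where safe: "safe \<delta>" by (rule safe_exists)
  obtain L where L: "\<And>\<delta> \<sigma> \<gamma> u x N. \<lbrakk>safe \<delta>; tame \<delta> \<sigma> \<gamma>; \<mu> > 0; abs_cont_on 0 T x; negligible N;
    \<And>i. i \<in> {1..I} \<Longrightarrow> \<psi> i 0 (x 0) \<le> \<sigma> + mu_fun \<mu> \<eta> \<gamma>;
    \<And>t. t \<in> {0..T} - N \<Longrightarrow> u t \<in> U \<and> ((t, x t) \<in> Q \<longrightarrow>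
      (x has_vector_derivative f t (x t) (u t) - penalty \<sigma> \<gamma> t (x t)) (at t within {0..T}))\<rbrakk>
    \<Longrightarrow> pen_facts L \<sigma> \<gamma> u x N"
    by (rule penalized_solution_facts) blast
  obtain k0 where k0: "\<And>k. k \<ge> k0 \<Longrightarrow> tame \<delta> (\<sigma> k) (\<gamma> k) \<and> admissible_control T U (us k) \<and>
      penalized_solution T I \<psi> f (\<sigma> k) (\<gamma> k) (mu_fun \<mu> \<eta> (\<gamma> k)) (us k) (b k) (xs k)"
    using eventually_conj[OF eventually_tame[OF safe \<gamma> \<sigma>] sol] unfolding eventually_sequentially by blast
  show thesis
  proof (rule that)
    fix k assume "k \<ge> k0"
    note k = k0[OF this]
    then have tame: "tame \<delta> (\<sigma> k) (\<gamma> k)" and adm: "admissible_control T U (us k)"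
      and sol: "penalized_solution T I \<psi> f (\<sigma> k) (\<gamma> k) (mu_fun \<mu> \<eta> (\<gamma> k)) (us k) (b k) (xs k)" by auto
    obtain N where N: "abs_cont_on 0 T (xs k)" "xs k 0 = b k"
      "\<And>i. i \<in> {1..I} \<Longrightarrow> \<psi> i 0 (b k) \<le> \<sigma> k + mu_fun \<mu> \<eta> (\<gamma> k)" "negligible N"
      "\<And>t. t \<in> {0..T} - N \<Longrightarrow> us k t \<in> U \<and>
        (xs k has_vector_derivative f t (xs k t) (us k t) - (penalty (\<sigma> k) (\<gamma> k) t (xs k t))) (at t within {0..T})"
      using adm sol by (rule penalized_solutionD) blast
    \<comment> \<open>An initial value at a level of at most \<open>\<delta>\<close> lies near some
      point of \<open>C 0\<close>; such a point and a control together make \<open>\<mu>\<close>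
      positive.\<close>
    have "\<forall>i\<in>{1..I}. \<psi> i 0 (b k) \<le> \<delta>" using N(3) tame by (force simp: tame_def)
    then obtain c where c: "c \<in> C 0" using safe T_pos unfolding safe_def by fastforce
    obtain w where w: "w \<in> U" using admissible_control_nonempty[OF adm] by blast
    have "\<mu> \<ge> 1" by (rule mu_ge_1[OF I _ c w]) (use T_pos in simp)
    then have "pen_facts L (\<sigma> k) (\<gamma> k) (us k) (xs k) N"
      using N by (intro L[OF safe tame]) auto
    then show "xs k 0 = b k \<and> (\<exists>N. pen_facts L (\<sigma> k) (\<gamma> k) (us k) (xs k) N)" using N(2) by blast
  qed
qed

lemma penalized_subsequence_limit:
  assumes I: "I \<ge> 1" and \<gamma>: "\<And>k. \<gamma> k > 0" "filterlim \<gamma> at_top sequentially" and \<sigma>: "\<sigma> \<longlonglongrightarrow> 0"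
    and sol: "\<forall>\<^sub>F k in sequentially. admissible_control T U (us k) \<and>
      penalized_solution T I \<psi> f (\<sigma> k) (\<gamma> k) (mu_fun \<mu> \<eta> (\<gamma> k)) (us k) (b k) (xs k)"
    and b: "b \<longlonglongrightarrow> x\<^sub>0" and s: "strict_mono s"
    and unif: "uniform_limit {0..T} (\<lambda>k. xs (s k)) x sequentially"
  shows "solves_inclusion T (sweeping_inclusion_rhs I \<psi> f U) x\<^sub>0 x"
    and "\<And>u. admissible_control T U u \<Longrightarrow> (\<And>k t. t \<in> {0..T} \<Longrightarrow> us k t = u t) \<Longrightarrow>
      solves_inclusion T (sweeping_rhs I \<psi> f u) x\<^sub>0 x"
proof -
  obtain L k0 where L: "\<And>k. k \<ge> k0 \<Longrightarrow> xs k 0 = b k \<and> (\<exists>N. pen_facts L (\<sigma> k) (\<gamma> k) (us k) (xs k) N)"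
    by (rule penalized_sequence_facts[OF I \<gamma> \<sigma> sol]) blast
  \<comment> \<open>The shift drops the initial indices, for which the uniform estimates may
    fail.\<close>
  define r where "r k = s (k + k0)" for k
  have r: "strict_mono r" using s by (simp add: r_def strict_mono_def)
  have rk: "r k \<ge> k0" for k using strict_mono_imp_increasing[OF s, of "k + k0"] by (simp add: r_def)
  have rt: "filterlim r at_top sequentially" using r by (rule filterlim_subseq)
  have "\<forall>k. \<exists>N. pen_facts L (\<sigma> (r k)) (\<gamma> (r k)) (us (r k)) (xs (r k)) N" using L[OF rk] by blast
  then obtain N where N: "\<And>k. pen_facts L (\<sigma> (r k)) (\<gamma> (r k)) (us (r k)) (xs (r k)) (N k)" by metis
  have bl: "(\<lambda>k. xs (r k) 0) \<longlonglongrightarrow> x\<^sub>0" using filterlim_compose[OF b rt] L[OF rk] by simp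
  have ur: "uniform_limit {0..T} (\<lambda>k. xs (r k)) x sequentially"
    using filterlim_compose[OF unif filterlim_add_const_nat_at_top[of k0]] by (simp add: r_def)
  note lim = penalized_limit[of "\<lambda>k. \<gamma> (r k)" "\<lambda>k. \<sigma> (r k)" L "\<lambda>k. us (r k)" "\<lambda>k. xs (r k)" N x\<^sub>0 x,
      OF \<gamma>(1) filterlim_compose[OF \<gamma>(2) rt] filterlim_compose[OF \<sigma> rt] N bl ur]
  show "solves_inclusion T (sweeping_inclusion_rhs I \<psi> f U) x\<^sub>0 x" by (rule lim(1))
  show "solves_inclusion T (sweeping_rhs I \<psi> f u) x\<^sub>0 x"
    if "admissible_control T U u" "\<And>k t. t \<in> {0..T} \<Longrightarrow> us k t = u t" for u
    by (rule lim(2)) (use that in auto)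
qed

lemma penalized_subsequence_exists:
  assumes I: "I \<ge> 1" and \<gamma>: "\<And>k. \<gamma> k > 0" "filterlim \<gamma> at_top sequentially" and \<sigma>: "\<sigma> \<longlonglongrightarrow> 0"
    and sol: "\<forall>\<^sub>F k in sequentially. admissible_control T U (us k) \<and>
      penalized_solution T I \<psi> f (\<sigma> k) (\<gamma> k) (mu_fun \<mu> \<eta> (\<gamma> k)) (us k) (b k) (xs k)"
  obtains s x where "strict_mono s" "uniform_limit {0..T} (\<lambda>k. xs (s k)) x sequentially"
proof -
  obtain L k0 where L: "\<And>k. k \<ge> k0 \<Longrightarrow> xs k 0 = b k \<and> (\<exists>N. pen_facts L (\<sigma> k) (\<gamma> k) (us k) (xs k) N)"
    by (rule penalized_sequence_facts[OF I \<gamma> \<sigma> sol]) blast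
  have 1: "L-lipschitz_on {0..T} (xs (k + k0))" "\<And>t. t \<in> {0..T} \<Longrightarrow> (t, xs (k + k0) t) \<in> Q" for k
    using L[of "k + k0"] unfolding pen_facts_def by auto
  have 2: "norm (xs (k + k0) t) \<le> r" if "t \<in> {0..T}" for k t
    using 1(2)[OF that, of k] norm_snd_le[where x = t and y = "xs (k + k0) t"] by simp
  obtain s x where s: "strict_mono s" and u: "uniform_limit {0..T} (\<lambda>k. xs (s k + k0)) x sequentially"
    by (rule lipschitz_convergent_subsequence[OF 1(1) 2]) blast+
  have "strict_mono (\<lambda>k. s k + k0)" using s by (simp add: strict_mono_def)
  then show thesis using u by (rule that)
qed

lemma sweeping_solution_in_C:
  assumes "solves_inclusion T (sweeping_rhs I \<psi> f u) a x" "admissible_control T U u" "t \<in> {0..T}"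
  shows "x t \<in> C t"
proof -
  have "AE t in lebesgue_on {0..T}. u t \<in> U" using assms(2) by (simp add: admissible_control_def)
  with assms(1) obtain N where N: "negligible N" "\<And>t. t \<in> {0..T} - N \<Longrightarrow> t > 0 \<and> u t \<in> U \<and>
      (\<exists>v. v \<in> limiting_normal_cone (C t) (x t) \<and> (x has_vector_derivative f t (x t) (u t) - v) (at t within {0..T}))"
    by (rule sweeping_solutionD) blast
  have "continuous_on {0..T} x" using assms(1) by (auto simp: solves_inclusion_def intro: abs_cont_on_imp_continuous_on)
  then show ?thesis
    by (rule feasible_if_AE[OF _ N(1) _ assms(3)]) (use N(2) limiting_normal_cone_memD in blast)
qed

lemma unique_sweeping_solutionI:
  assumes "admissible_control T U u" "solves_inclusion T (sweeping_rhs I \<psi> f u) a x"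
  shows "unique_solution_of_inclusion T (sweeping_rhs I \<psi> f u) a x"
  unfolding unique_solution_of_inclusion_def
  using assms sweeping_solution_unique[of u a _ x] by (auto simp: admissible_control_def)

text \<open>Subsequence principle: every subsequence of penalized solutions has a uniformly
  convergent further one, whose limit solves the sweeping process with the same control and
  therefore equals \<open>x\<close> by uniqueness. So the whole sequence converges.\<close>

lemma sweeping_solution_approximable:
  assumes I: "I \<ge> 1" and \<gamma>: "\<And>k. \<gamma> k > 0" "filterlim \<gamma> at_top sequentially" and \<sigma>: "\<sigma> \<longlonglongrightarrow> 0"
    and x0: "\<And>k. x\<^sub>0 \<in> relaxed_moving_set I \<psi> (\<sigma> k) (mu_fun \<mu> \<eta> (\<gamma> k)) 0"
    and u: "admissible_control T U u" and x: "solves_inclusion T (sweeping_rhs I \<psi> f u) x\<^sub>0 x"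
  obtains y where
    "\<forall>\<^sub>F k in sequentially. penalized_solution T I \<psi> f (\<sigma> k) (\<gamma> k) (mu_fun \<mu> \<eta> (\<gamma> k)) u x\<^sub>0 (y k)"
    "uniform_limit {0..T} y x sequentially"
proof -
  have TT: "T \<in> {0..T}" using T_pos by simp
  have xT: "x T \<in> C T" by (rule sweeping_solution_in_C[OF x u TT])
  have "(T, x T) \<in> interior (cball 0 r)" using A1 xT TT unfolding assumption_A1_def by blast
  then have "norm (T, x T) < r" by (simp add: interior_cball)
  \<comment> \<open>The graph lies in the open ball of time and space, so its point at time
    \<open>T\<close> bounds \<open>T\<close> itself, as the retraction requires.\<close>
  then have Tr: "T < r" using norm_fst_le[of T "x T"] T_pos by simp
  obtain w where w: "w \<in> U" using admissible_control_nonempty[OF u] by blast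
  have \<mu>: "\<mu> > 0" using mu_ge_1[OF I TT xT w] by simp
  obtain \<delta> where safe: "safe \<delta>" by (rule safe_exists)
  \<comment> \<open>At the initial indices, where no solution need exist, the value is
    arbitrary.\<close>
  define y where "y k = (SOME y. penalized_solution T I \<psi> f (\<sigma> k) (\<gamma> k) (mu_fun \<mu> \<eta> (\<gamma> k)) u x\<^sub>0 y)" for k
  have sol: "\<forall>\<^sub>F k in sequentially. penalized_solution T I \<psi> f (\<sigma> k) (\<gamma> k) (mu_fun \<mu> \<eta> (\<gamma> k)) u x\<^sub>0 (y k)"
    using eventually_tame[OF safe \<gamma> \<sigma>]
  proof eventually_elim
    case (elim k)
    show ?case unfolding y_def
      by (rule someI_ex[OF penalized_solution_exists[OF safe elim \<mu> u Tr x0]])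
  qed
  have "uniform_limit {0..T} y x sequentially"
  proof (rule ccontr)
    assume "\<not> ?thesis"
    then obtain e where e: "e > 0" "\<not> (\<forall>\<^sub>F k in sequentially. \<forall>t\<in>{0..T}. dist (y k t) (x t) < e)"
      unfolding uniform_limit_iff by blast
    obtain s :: "nat \<Rightarrow> nat" where s: "strict_mono s" "\<And>k. \<not> (\<forall>t\<in>{0..T}. dist (y (s k) t) (x t) < e)"
      using not_eventually_sequentiallyD[OF e(2)] by blast
    have st: "filterlim s at_top sequentially" using s(1) by (rule filterlim_subseq)
    have adms: "\<forall>\<^sub>F k in sequentially. admissible_control T U u \<and>
        penalized_solution T I \<psi> f (\<sigma> (s k)) (\<gamma> (s k)) (mu_fun \<mu> \<eta> (\<gamma> (s k))) u x\<^sub>0 (y (s k))"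
      using eventually_compose_filterlim[OF sol st] u by (auto elim: eventually_mono)
    note seq = \<gamma>(1) filterlim_compose[OF \<gamma>(2) st] filterlim_compose[OF \<sigma> st] adms
    obtain s' z where s': "strict_mono s'" and z: "uniform_limit {0..T} (\<lambda>k. y (s (s' k))) z sequentially"
      by (rule penalized_subsequence_exists[OF I seq]) blast
    have "solves_inclusion T (sweeping_rhs I \<psi> f u) x\<^sub>0 z"
      by (rule penalized_subsequence_limit(2)[OF I seq tendsto_const s' z u]) simp
    then have zx: "z t = x t" if "t \<in> {0..T}" for t
      using sweeping_solution_unique[OF _ _ x that] u by (simp add: admissible_control_def)
    have "\<forall>\<^sub>F k in sequentially. \<forall>t\<in>{0..T}. dist (y (s (s' k)) t) (z t) < e"
      using z e(1) by (rule uniform_limitD)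
    then have "\<forall>\<^sub>F k :: nat in sequentially. False"
      by (rule eventually_mono) (use s(2) zx in auto)
    then show False by simp
  qed
  with sol show thesis by (rule that)
qed

end

theorem theorem2p2:
  fixes T :: real and I :: nat
    and f :: "real \<Rightarrow> real ^ 'n \<Rightarrow> real ^ 'm \<Rightarrow> real ^ 'n"
    and \<psi> :: "nat \<Rightarrow> real \<Rightarrow> real ^ 'n \<Rightarrow> real"
    and U :: "(real ^ 'm) set"
    and r \<beta> \<eta> \<rho> M \<mu> :: real
    and \<sigma> \<gamma> \<mu>s :: "nat \<Rightarrow> real"
  assumes T: "T > 0" and I: "I > 1"
    and A1: "assumption_A1 T I \<psi> r \<beta> \<eta> \<rho>"
    and A2: "assumption_A2 T f U r M"
    and A3: "assumption_A3 T f U"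
    and A4: "assumption_A4 U"
    and mu: "mu_bound T I \<psi> f U \<mu>"
    and sigma: "decseq \<sigma>" "\<sigma> \<longlonglongrightarrow> 0"
    and gamma: "\<And>k. \<gamma> k > 0" "incseq \<gamma>" "filterlim \<gamma> at_top sequentially"
    and mus: "\<And>k. \<mu>s k = mu_fun \<mu> \<eta> (\<gamma> k)"
    and inside: "\<And>k t. t \<in> {0..T} \<Longrightarrow>
      moving_set I \<psi> t \<subseteq> interior (relaxed_moving_set I \<psi> (\<sigma> k) (\<mu>s k) t)"
  shows
    "(\<forall>us xs b x\<^sub>0.
        (\<forall>k. admissible_control T U (us k) \<and>
             penalized_solution T I \<psi> f (\<sigma> k) (\<gamma> k) (\<mu>s k) (us k) (b k) (xs k)) \<and>
        b \<longlonglongrightarrow> x\<^sub>0 \<longrightarrow>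
        (\<exists>s u x. strict_mono s \<and> admissible_control T U u \<and>
           unique_solution_of_inclusion T (sweeping_rhs I \<psi> f u) x\<^sub>0 x \<and>
           uniform_limit {0..T} (\<lambda>k. xs (s k)) x sequentially) \<and>
        (\<forall>u. (\<forall>k. \<forall>t\<in>{0..T}. us k t = u t) \<longrightarrow>
           (\<forall>s x. strict_mono s \<and> uniform_limit {0..T} (\<lambda>k. xs (s k)) x sequentially \<longrightarrow>
              unique_solution_of_inclusion T (sweeping_rhs I \<psi> f u) x\<^sub>0 x))) \<and>
     (\<forall>x\<^sub>0 x. x\<^sub>0 \<in> moving_set I \<psi> 0 \<and>
        solves_inclusion T (sweeping_inclusion_rhs I \<psi> f U) x\<^sub>0 x \<longrightarrow>
        (\<exists>u b y. admissible_control T U u \<and>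
           (\<forall>\<^sub>F k in sequentially.
              penalized_solution T I \<psi> f (\<sigma> k) (\<gamma> k) (\<mu>s k) u (b k) (y k)) \<and>
           uniform_limit {0..T} y x sequentially))"
proof -
  interpret sweeping_data T I f \<psi> U r \<beta> \<eta> \<rho> M \<mu>
    by unfold_locales (fact T A1 A2 A3 A4 mu)+
  have I1: "I \<ge> 1" using I by simp
  show ?thesis
  proof (intro conjI allI impI; elim conjE)
    fix us xs b x\<^sub>0
    assume sol: "\<forall>k. admissible_control T U (us k) \<and>
             penalized_solution T I \<psi> f (\<sigma> k) (\<gamma> k) (\<mu>s k) (us k) (b k) (xs k)"
      and b: "b \<longlonglongrightarrow> x\<^sub>0"
    have ev: "\<forall>\<^sub>F k in sequentially. admissible_control T U (us k) \<and>
      penalized_solution T I \<psi> f (\<sigma> k) (\<gamma> k) (mu_fun \<mu> \<eta> (\<gamma> k)) (us k) (b k) (xs k)"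
      using sol by (intro always_eventually) (simp only: mus simp_thms)
    note seq = I1 gamma(1,3) sigma(2) ev
    show "\<exists>s u x. strict_mono s \<and> admissible_control T U u \<and>
           unique_solution_of_inclusion T (sweeping_rhs I \<psi> f u) x\<^sub>0 x \<and>
           uniform_limit {0..T} (\<lambda>k. xs (s k)) x sequentially"
    proof -
      obtain s x where s: "strict_mono s" and x: "uniform_limit {0..T} (\<lambda>k. xs (s k)) x sequentially"
        by (rule penalized_subsequence_exists[OF seq]) blast
      obtain u where "admissible_control T U u" "solves_inclusion T (sweeping_rhs I \<psi> f u) x\<^sub>0 x"
        using penalized_subsequence_limit(1)[OF seq b s x] by (rule inclusion_solution_control) blast
      then show ?thesis using s x unique_sweeping_solutionI by blast
    qed
    fix u s x
    assume eq: "\<forall>k. \<forall>t\<in>{0..T}. us k t = u t" and s: "strict_mono s"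
      and x: "uniform_limit {0..T} (\<lambda>k. xs (s k)) x sequentially"
    have "admissible_control T U (us 0)" using sol by blast
    \<comment> \<open>Agreement with \<open>us 0\<close> on \<open>{0..T}\<close> transfers
      measurability and the constraint on the values.\<close>
    then have u: "admissible_control T U u"
      unfolding admissible_control_def
      using eq measurable_cong[of "lebesgue_on {0..T}" "us 0" u borel]
        AE_cong[of "lebesgue_on {0..T}" "\<lambda>t. us 0 t \<in> U" "\<lambda>t. u t \<in> U"] by simp
    show "unique_solution_of_inclusion T (sweeping_rhs I \<psi> f u) x\<^sub>0 x"
      by (rule unique_sweeping_solutionI[OF u penalized_subsequence_limit(2)[OF seq b s x u]]) (use eq in blast)
  next
    fix x\<^sub>0 x
    assume x0: "x\<^sub>0 \<in> moving_set I \<psi> 0" and x: "solves_inclusion T (sweeping_inclusion_rhs I \<psi> f U) x\<^sub>0 x"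
    obtain u where u: "admissible_control T U u" "solves_inclusion T (sweeping_rhs I \<psi> f u) x\<^sub>0 x"
      using x by (rule inclusion_solution_control) blast
    \<comment> \<open>\<open>x\<^sub>0\<close> itself serves as initial value for every
      \<open>k\<close>, because the feasible set at time 0 lies in every relaxed set.\<close>
    have mem: "x\<^sub>0 \<in> relaxed_moving_set I \<psi> (\<sigma> k) (mu_fun \<mu> \<eta> (\<gamma> k)) 0" for k
      using inside[of 0 k] x0 T interior_subset unfolding mus by fastforce
    obtain y where y: "\<forall>\<^sub>F k in sequentially. penalized_solution T I \<psi> f (\<sigma> k) (\<gamma> k) (mu_fun \<mu> \<eta> (\<gamma> k)) u x\<^sub>0 (y k)"
      "uniform_limit {0..T} y x sequentially"
      by (rule sweeping_solution_approximable[OF I1 gamma(1,3) sigma(2) mem u]) blast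
    then show "\<exists>u b y. admissible_control T U u \<and>
           (\<forall>\<^sub>F k in sequentially.
              penalized_solution T I \<psi> f (\<sigma> k) (\<gamma> k) (\<mu>s k) u (b k) (y k)) \<and>
           uniform_limit {0..T} y x sequentially"
      unfolding mus using u(1) by (intro exI[of _ u] exI[of _ "\<lambda>_. x\<^sub>0"] exI[of _ y]) blast
  qed
qed

end
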